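(* Let $R$ be a two-sided (left and right) coherent ring. The following conditions are equivalent: (1) $R$ is a weakly quasi-Frobenius (WQF) ring; (2) the modules ${}_RR$ and $R_R$ are $FP$-injective; (3) ${}_RR$ and $R_R$ are $FP$-cogenerators; (4) the module $R_R$ is an $FP$-injective $FP$-cogenerator; (5) every left and every right finitely presented $R$-module is reflexive; (6) every left and every right cyclic finitely presented $R$-module is reflexive; (7) every left and every right cyclic finitely presented $R$-module embeds in a free module; (8) for every finitely generated left ideal $I$ and every finitely generated right ideal $J$ of $R$ one has $\mathfrak l\,\mathfrak r(I)=I$ and $\mathfrak r\,\mathfrak l(J)=J$.
   Context: Rings are associative with unit, not necessarily commutative. For $X\subseteq R$, $\mathfrak l(X)=\{r\in R\mid rX=0\}$ and $\mathfrak r(X)=\{r\in R\mid Xr=0\}$. The dual of a module $M$ is $M^*=\mathrm{Hom}_R(M,R)$. Definitions (one side; the other is symmetric): - $R$ is left coherent if every finitely generated left ideal is finitely presented. - A left module $M$ is $FP$-injective if $\mathrm{Ext}^1_R(F,M)=0$ for every finitely presented left $R$-module $F$; $R$ is left $FP$-injective if ${}_RR$ is $FP$-injective. - A left module $K$ is an $FP$-cogenerator if for every non-zero homomorphism $f:M\to N$ from a finitely generated left module $M$ to a finitely presented left module $N$ there exists $g\in\mathrm{Hom}_R(N,K)$ with $gf\neq0$. - $M$ is reflexive if the canonical homomorphism $M\to M^{**}$ is an isomorphism. - $R$ is weakly quasi-Frobenius (WQF) if the functors $\mathrm{Hom}_R(-,R)$ determine a duality between the categories of finitely presented left and finitely presented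 right $R$-modules; equivalently, $R$ is left and right coherent and left and right $FP$-injective. *)

theory Defs
  imports "HOL-Algebra.Module" "HOL-Algebra.Elementary_Groups"
begin

text \<open>
  The locale \<open>module\<close> of HOL-Algebra requires a commutative ring of scalars. We reuse its
  record type (whose fields \<open>mult\<close> and \<open>one\<close> play no role for a module) and its notion of
  submodule, which does not depend on commutativity.
\<close>

locale left_module = R?: ring R + M?: abelian_group M
  for R (structure) and M :: "('a, 'b, 'm) module_scheme" (structure) +
  assumes smult_closed:
      "\<lbrakk> a \<in> carrier R; x \<in> carrier M \<rbrakk> \<Longrightarrow> a \<odot>\<^bsub>M\<^esub> x \<in> carrier M"
    and smult_l_distr:
      "\<lbrakk> a \<in> carrier R; b \<in> carrier R; x \<in> carrier M \<rbrakk> \<Longrightarrow>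
        (a \<oplus> b) \<odot>\<^bsub>M\<^esub> x = a \<odot>\<^bsub>M\<^esub> x \<oplus>\<^bsub>M\<^esub> b \<odot>\<^bsub>M\<^esub> x"
    and smult_r_distr:
      "\<lbrakk> a \<in> carrier R; x \<in> carrier M; y \<in> carrier M \<rbrakk> \<Longrightarrow>
        a \<odot>\<^bsub>M\<^esub> (x \<oplus>\<^bsub>M\<^esub> y) = a \<odot>\<^bsub>M\<^esub> x \<oplus>\<^bsub>M\<^esub> a \<odot>\<^bsub>M\<^esub> y"
    and smult_assoc:
      "\<lbrakk> a \<in> carrier R; b \<in> carrier R; x \<in> carrier M \<rbrakk> \<Longrightarrow>
        (a \<otimes> b) \<odot>\<^bsub>M\<^esub> x = a \<odot>\<^bsub>M\<^esub> (b \<odot>\<^bsub>M\<^esub> x)"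
    and smult_one:
      "x \<in> carrier M \<Longrightarrow> \<one> \<odot>\<^bsub>M\<^esub> x = x"

text \<open>
  Right modules over \<open>R\<close> are left modules over the opposite ring, the scalar
  multiplication \<open>r \<odot> x\<close> of the latter being the right multiplication \<open>x r\<close>. So every notion is
  defined for left modules only, and its right-hand version is the instance at \<open>opp R\<close>.
\<close>

definition opp :: "('a, 'z) ring_scheme \<Rightarrow> ('a, 'z) ring_scheme" where
  "opp R = R\<lparr> mult := \<lambda>x y. y \<otimes>\<^bsub>R\<^esub> x \<rparr>"

lemma opp_opp [simp]: "opp (opp R) = R"
  by (simp add: opp_def)

lemma opp_simps [simp]:
  "carrier (opp R) = carrier R" "x \<otimes>\<^bsub>opp R\<^esub> y = y \<otimes>\<^bsub>R\<^esub> x" "\<one>\<^bsub>opp R\<^esub> = \<one>\<^bsub>R\<^esub>"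
  "x \<oplus>\<^bsub>opp R\<^esub> y = x \<oplus>\<^bsub>R\<^esub> y" "\<zero>\<^bsub>opp R\<^esub> = \<zero>\<^bsub>R\<^esub>"
  by (simp_all add: opp_def)

text \<open>The left module \<open>R\<close>; the right module \<open>R\<close> is \<open>reg_module (opp R)\<close>.\<close>

definition reg_module :: "('a, 'z) ring_scheme \<Rightarrow> ('a, 'a) module" where
  "reg_module R = \<lparr> carrier = carrier R, mult = mult R, one = one R,
     zero = zero R, add = add R, smult = mult R \<rparr>"

text \<open>
  Homomorphisms are extensional functions, so that equal homomorphisms are equal as functions.
\<close>

definition mod_hom ::
  "('a, 'z) ring_scheme \<Rightarrow> ('a, 'b) module \<Rightarrow> ('a, 'c) module \<Rightarrow> ('b \<Rightarrow> 'c) set" where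
  "mod_hom R M N = {f \<in> carrier M \<rightarrow>\<^sub>E carrier N.
     (\<forall>x\<in>carrier M. \<forall>y\<in>carrier M. f (x \<oplus>\<^bsub>M\<^esub> y) = f x \<oplus>\<^bsub>N\<^esub> f y) \<and>
     (\<forall>r\<in>carrier R. \<forall>x\<in>carrier M. f (r \<odot>\<^bsub>M\<^esub> x) = r \<odot>\<^bsub>N\<^esub> f x)}"

definition mod_iso ::
  "('a, 'z) ring_scheme \<Rightarrow> ('a, 'b) module \<Rightarrow> ('a, 'c) module \<Rightarrow> ('b \<Rightarrow> 'c) set" where
  "mod_iso R M N = {f \<in> mod_hom R M N. bij_betw f (carrier M) (carrier N)}"

text \<open>The free left module \<open>R\<^sup>(\<^sup>X\<^sup>)\<close> of finitely supported families; \<open>free_module R {..<n}\<close> is \<open>R\<^sup>n\<close>.\<close>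

definition free_module :: "('a, 'z) ring_scheme \<Rightarrow> 'x set \<Rightarrow> ('a, 'x \<Rightarrow> 'a) module" where
  "free_module R X = \<lparr>
     carrier = {v. (\<forall>x\<in>X. v x \<in> carrier R) \<and> (\<forall>x. x \<notin> X \<longrightarrow> v x = \<zero>\<^bsub>R\<^esub>) \<and>
       finite {x. v x \<noteq> \<zero>\<^bsub>R\<^esub>}},
     mult = undefined, one = undefined,
     zero = (\<lambda>x. \<zero>\<^bsub>R\<^esub>), add = (\<lambda>u v x. u x \<oplus>\<^bsub>R\<^esub> v x),
     smult = (\<lambda>r v x. r \<otimes>\<^bsub>R\<^esub> v x) \<rparr>"

definition mod_span :: "('a, 'z) ring_scheme \<Rightarrow> ('a, 'b) module \<Rightarrow> 'b set \<Rightarrow> 'b set" where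
  "mod_span R M X = \<Inter>{H. submodule H R M \<and> X \<subseteq> H}"

definition fg_submodule :: "('a, 'z) ring_scheme \<Rightarrow> ('a, 'b) module \<Rightarrow> 'b set \<Rightarrow> bool" where
  "fg_submodule R M N \<longleftrightarrow>
     (\<exists>X. finite X \<and> X \<subseteq> carrier M \<and> N = mod_span R M X)"

definition fin_gen :: "('a, 'z) ring_scheme \<Rightarrow> ('a, 'b) module \<Rightarrow> bool" where
  "fin_gen R M \<longleftrightarrow> left_module R M \<and> fg_submodule R M (carrier M)"

definition cyclic_module :: "('a, 'z) ring_scheme \<Rightarrow> ('a, 'b) module \<Rightarrow> bool" where
  "cyclic_module R M \<longleftrightarrow> left_module R M \<and>
     (\<exists>x\<in>carrier M. carrier M = mod_span R M {x})"

text \<open>Existence of an exact sequence \<open>R\<^sup>m \<rightarrow> R\<^sup>n \<rightarrow> M \<rightarrow> 0\<close>.\<close>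

definition fin_pres :: "('a, 'z) ring_scheme \<Rightarrow> ('a, 'b) module \<Rightarrow> bool" where
  "fin_pres R M \<longleftrightarrow> left_module R M \<and>
     (\<exists>(m::nat) (n::nat) p q.
        p \<in> mod_hom R (free_module R {..<m}) (free_module R {..<n}) \<and>
        q \<in> mod_hom R (free_module R {..<n}) M \<and>
        p ` carrier (free_module R {..<m}) =
          {v \<in> carrier (free_module R {..<n}). q v = \<zero>\<^bsub>M\<^esub>} \<and>
        q ` carrier (free_module R {..<n}) = carrier M)"

abbreviation fg_left_ideal :: "('a, 'z) ring_scheme \<Rightarrow> 'a set \<Rightarrow> bool" where
  "fg_left_ideal R I \<equiv> fg_submodule R (reg_module R) I"

abbreviation fg_right_ideal :: "('a, 'z) ring_scheme \<Rightarrow> 'a set \<Rightarrow> bool" where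
  "fg_right_ideal R J \<equiv> fg_left_ideal (opp R) J"

definition left_coherent :: "('a, 'z) ring_scheme \<Rightarrow> bool" where
  "left_coherent R \<longleftrightarrow> ring R \<and>
     (\<forall>I. fg_left_ideal R I \<longrightarrow> fin_pres R ((reg_module R)\<lparr> carrier := I \<rparr>))"

abbreviation right_coherent :: "('a, 'z) ring_scheme \<Rightarrow> bool" where
  "right_coherent R \<equiv> left_coherent (opp R)"

text \<open>
  Quantification over all finitely generated modules needs a fixed type of elements. Every
  finitely generated module over \<open>R\<close> is isomorphic to a quotient of some \<open>R\<^sup>n\<close>, whose
  elements are cosets in \<open>R\<^sup>n\<close>, so the following type contains a copy of each of them.
  The properties quantified over below are all invariant under isomorphism.
\<close>

type_synonym 'a fg_module = "('a, (nat \<Rightarrow> 'a) set) module"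

text \<open>
  \<open>Ext\<^sup>1(F, M)\<close> is the first cohomology of \<open>Hom(P\<^sub>\<bullet>, M)\<close> for the beginning
  \<open>P\<^sub>2 \<rightarrow> P\<^sub>1 \<rightarrow> P\<^sub>0 \<rightarrow> F \<rightarrow> 0\<close> of the standard free resolution of \<open>F\<close>, where \<open>P\<^sub>0\<close> is free on
  the elements of \<open>F\<close>, \<open>P\<^sub>1\<close> is free on the elements of the kernel of \<open>P\<^sub>0 \<rightarrow> F\<close>, and \<open>P\<^sub>2\<close> is
  free on the elements of the kernel of \<open>P\<^sub>1 \<rightarrow> P\<^sub>0\<close>. All maps are restrictions of \<open>lincomb\<close>.
\<close>

definition lincomb :: "('a, 'z) ring_scheme \<Rightarrow> ('a, 'b) module \<Rightarrow> ('b \<Rightarrow> 'a) \<Rightarrow> 'b" where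
  "lincomb R M v = (\<Oplus>\<^bsub>M\<^esub>x\<in>{x. v x \<noteq> \<zero>\<^bsub>R\<^esub>}. v x \<odot>\<^bsub>M\<^esub> x)"

definition relations :: "('a, 'z) ring_scheme \<Rightarrow> ('a, 'b) module \<Rightarrow> 'b set \<Rightarrow> ('b \<Rightarrow> 'a) set" where
  "relations R M X = {v \<in> carrier (free_module R X). lincomb R M v = \<zero>\<^bsub>M\<^esub>}"

definition hom_group ::
  "('a, 'z) ring_scheme \<Rightarrow> ('a, 'b) module \<Rightarrow> ('a, 'c) module \<Rightarrow> ('b \<Rightarrow> 'c) monoid" where
  "hom_group R M N = \<lparr> carrier = mod_hom R M N,
     mult = (\<lambda>f g. \<lambda>x\<in>carrier M. f x \<oplus>\<^bsub>N\<^esub> g x), one = (\<lambda>x\<in>carrier M. \<zero>\<^bsub>N\<^esub>) \<rparr>"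

definition Ext1 ::
  "('a, 'z) ring_scheme \<Rightarrow> ('a, 'f) module \<Rightarrow> ('a, 'b) module
    \<Rightarrow> ((('f \<Rightarrow> 'a) \<Rightarrow> 'a) \<Rightarrow> 'b) set monoid" where
  "Ext1 R F M =
    (let K0 = relations R F (carrier F);
         P0 = free_module R (carrier F);
         K1 = relations R P0 K0;
         P1 = free_module R K0;
         P2 = free_module R K1;
         Z = {f \<in> mod_hom R P1 M. \<forall>w\<in>carrier P2. f (lincomb R P1 w) = \<zero>\<^bsub>M\<^esub>};
         B = (\<lambda>g. \<lambda>v\<in>carrier P1. g (lincomb R P0 v)) ` mod_hom R P0 M
     in (hom_group R P1 M)\<lparr> carrier := Z \<rparr> Mod B)"

definition fp_injective :: "('a, 'z) ring_scheme \<Rightarrow> ('a, 'b) module \<Rightarrow> bool" where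
  "fp_injective R M \<longleftrightarrow> left_module R M \<and>
     (\<forall>F :: 'a fg_module. fin_pres R F \<longrightarrow> trivial_group (Ext1 R F M))"

definition fp_cogenerator :: "('a, 'z) ring_scheme \<Rightarrow> ('a, 'b) module \<Rightarrow> bool" where
  "fp_cogenerator R K \<longleftrightarrow> left_module R K \<and>
     (\<forall>(M :: 'a fg_module) (N :: 'a fg_module). \<forall>f \<in> mod_hom R M N.
        fin_gen R M \<and> fin_pres R N \<and> (\<exists>x\<in>carrier M. f x \<noteq> \<zero>\<^bsub>N\<^esub>) \<longrightarrow>
        (\<exists>g \<in> mod_hom R N K. \<exists>x\<in>carrier M. g (f x) \<noteq> \<zero>\<^bsub>K\<^esub>))"

text \<open>
  The dual \<open>Hom\<^sub>R(M, R)\<close> of a left \<open>R\<close>-module, with the right action \<open>(f r)(x) = f(x) r\<close>,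
  as a left module over \<open>opp R\<close>. Since \<open>opp (opp R) = R\<close>, the same construction
  over \<open>opp R\<close> turns right \<open>R\<close>-modules into left ones.
\<close>

definition dual :: "('a, 'z) ring_scheme \<Rightarrow> ('a, 'b) module \<Rightarrow> ('a, 'b \<Rightarrow> 'a) module" where
  "dual R M = \<lparr> carrier = mod_hom R M (reg_module R), mult = undefined, one = undefined,
     zero = (\<lambda>x\<in>carrier M. \<zero>\<^bsub>R\<^esub>),
     add = (\<lambda>f g. \<lambda>x\<in>carrier M. f x \<oplus>\<^bsub>R\<^esub> g x),
     smult = (\<lambda>r f. \<lambda>x\<in>carrier M. f x \<otimes>\<^bsub>R\<^esub> r) \<rparr>"

definition dual_map ::
  "('a, 'z) ring_scheme \<Rightarrow> ('a, 'b) module \<Rightarrow> ('a, 'c) module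
    \<Rightarrow> ('b \<Rightarrow> 'c) \<Rightarrow> ('c \<Rightarrow> 'a) \<Rightarrow> ('b \<Rightarrow> 'a)" where
  "dual_map R M N f = (\<lambda>h\<in>carrier (dual R N). compose (carrier M) h f)"

definition bidual :: "('a, 'z) ring_scheme \<Rightarrow> ('a, 'b) module \<Rightarrow> ('a, ('b \<Rightarrow> 'a) \<Rightarrow> 'a) module"
  where "bidual R M = dual (opp R) (dual R M)"

definition bidual_map ::
  "('a, 'z) ring_scheme \<Rightarrow> ('a, 'b) module \<Rightarrow> ('a, 'c) module
    \<Rightarrow> ('b \<Rightarrow> 'c) \<Rightarrow> (('b \<Rightarrow> 'a) \<Rightarrow> 'a) \<Rightarrow> (('c \<Rightarrow> 'a) \<Rightarrow> 'a)" where
  "bidual_map R M N f = dual_map (opp R) (dual R N) (dual R M) (dual_map R M N f)"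

definition reflexive_module :: "('a, 'z) ring_scheme \<Rightarrow> ('a, 'b) module \<Rightarrow> bool" where
  "reflexive_module R M \<longleftrightarrow> left_module R M \<and>
     (\<lambda>x\<in>carrier M. \<lambda>h\<in>carrier (dual R M). h x) \<in> mod_iso R M (bidual R M)"

text \<open>
  The identity functor of the finitely presented left modules is naturally isomorphic to the
  bidual functor; the natural isomorphism is not required to be the canonical one.
\<close>

definition id_iso_bidual :: "('a, 'z) ring_scheme \<Rightarrow> bool" where
  "id_iso_bidual R \<longleftrightarrow>
     (\<exists>\<eta> :: 'a fg_module \<Rightarrow> (nat \<Rightarrow> 'a) set \<Rightarrow> ((nat \<Rightarrow> 'a) set \<Rightarrow> 'a) \<Rightarrow> 'a.
        (\<forall>M. fin_pres R M \<longrightarrow> \<eta> M \<in> mod_iso R M (bidual R M)) \<and>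
        (\<forall>M N. \<forall>f \<in> mod_hom R M N. fin_pres R M \<and> fin_pres R N \<longrightarrow>
           (\<forall>x\<in>carrier M. \<eta> N (f x) = bidual_map R M N f (\<eta> M x))))"

definition weakly_quasi_frobenius :: "('a, 'z) ring_scheme \<Rightarrow> bool" where
  "weakly_quasi_frobenius R \<longleftrightarrow> ring R \<and>
     (\<forall>M :: 'a fg_module. fin_pres R M \<longrightarrow> fin_pres (opp R) (dual R M)) \<and>
     (\<forall>M :: 'a fg_module. fin_pres (opp R) M \<longrightarrow> fin_pres R (dual (opp R) M)) \<and>
     id_iso_bidual R \<and> id_iso_bidual (opp R)"

text \<open>
  The index type \<open>'b \<times> nat\<close> imposes no restriction: the elements of a submodule \<open>M\<close> of a free
  module have finite supports, so only as many basis elements as \<open>'b \<times> nat\<close> can index occur.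
\<close>

definition embeds_in_free :: "('a, 'z) ring_scheme \<Rightarrow> ('a, 'b) module \<Rightarrow> bool" where
  "embeds_in_free R M \<longleftrightarrow>
     (\<exists>(X :: ('b \<times> nat) set). \<exists>f \<in> mod_hom R M (free_module R X). inj_on f (carrier M))"

definition left_ann :: "('a, 'z) ring_scheme \<Rightarrow> 'a set \<Rightarrow> 'a set" where
  "left_ann R X = {r \<in> carrier R. \<forall>x\<in>X. r \<otimes>\<^bsub>R\<^esub> x = \<zero>\<^bsub>R\<^esub>}"

definition right_ann :: "('a, 'z) ring_scheme \<Rightarrow> 'a set \<Rightarrow> 'a set" where
  "right_ann R X = {r \<in> carrier R. \<forall>x\<in>X. x \<otimes>\<^bsub>R\<^esub> r = \<zero>\<^bsub>R\<^esub>}"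

end

theory Submission
  imports Defs
begin

text \<open>
  Everything is reduced to one condition on matrices. Call \<open>R\<close> \<^emph>\<open>free FP-injective\<close> if every
  functional on \<open>R\<^sup>m\<close> vanishing on the kernel of \<open>p : R\<^sup>m \<rightarrow> R\<^sup>n\<close> factors through \<open>p\<close>. By Schanuel's
  argument this is \<open>FP\<close>-injectivity of the left module \<open>R\<close>. The pairing \<open>(v, w) \<mapsto> \<Sum> v\<^sub>i w\<^sub>i\<close> between left and
  right free modules gives every \<open>p\<close> an adjoint \<open>p'\<close> over the opposite ring, and through it the
  condition says that every finitely presented right module, as a cokernel of some \<open>p'\<close>, is
  torsionless, i.e. that the right module \<open>R\<close> is an \<open>FP\<close>-cogenerator. Thus (2), (3) and (4) all say
  that \<open>R\<close> and its opposite are free FP-injective.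

  The dual of \<open>M = coker p\<close> is \<open>ker p'\<close>, which is finitely presented by coherence; FP-injectivity
  extends functionals on \<open>ker p'\<close> to the whole free module, so \<open>M\<close> is reflexive. Conversely, a
  natural isomorphism with the bidual, canonical or not, forces modules to be torsionless.
  A torsionless \<open>M\<close> embeds in a free module through finitely many generators of its dual, and an
  embedding of \<open>R/I\<close> exhibits \<open>I\<close> as an annihilator. Finally, the double annihilator conditions yield
  the extension of functionals from finitely generated ideals (Ikeda and Nakayama), and
  induction on \<open>n\<close> with coherence passes from ideals to submodules of \<open>R\<^sup>n\<close>.
\<close>

subsection \<open>Modules and homomorphisms\<close>

text \<open>The conditions quantify over modules on one fixed element type, so every test module is
  built as a quotient of some R^n: R^n / im p for a presentation, R^1 / I for a cyclic module, R^1 /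
  0 as the copy of R. \<open>Ext1\<close> is taken on the standard resolution, whose free modules
  are indexed by all elements of a module; comparing it with a finite presentation is what reduces
  it to matrices.

  Adjunction changes sides. Statements about a left module M are therefore proved from hypotheses on
  \<open>opp R\<close>: the dual of M is a right module, coherence on that side makes it finitely
  generated, and FP-injectivity on that side extends functionals from it.

  The obstacle on the way back from (8) is that annihilators speak of ideals only. A functional on a
  submodule of R^n is handled one coordinate at a time: on the kernel of the last coordinate the
  shorter case applies, and what remains is a functional on the left ideal formed by the last
  coordinates. By coherence that kernel is again an image of some R^k, so the source of the maps has
  to vary in the induction as well.\<close>

lemma (in abelian_group) minus_eq_zero_iff:
  "x \<in> carrier G \<Longrightarrow> y \<in> carrier G \<Longrightarrow> x \<ominus> y = \<zero> \<longleftrightarrow> x = y"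
  by (metis a_minus_def add.inv_closed add.inv_equality local.minus_minus r_neg)

lemma ring_opp: "ring R \<Longrightarrow> ring (opp R)"
proof -
  assume "ring R"
  then interpret ring R .
  show ?thesis
  proof (rule ringI)
    show "abelian_group (opp R)"
      by (rule abelian_groupI) (auto simp: a_ac intro: l_neg a_inv_closed)
    show "monoid (opp R)"
      by (rule monoidI) (auto simp: m_assoc)
  qed (auto simp: l_distr r_distr)
qed

text \<open>Additive inverses are replaced by the hypothesis \<open>zero\<close>: once 0 x = 0 is
  known, (-1) x is an inverse of x by distributivity.\<close>

lemma left_moduleI:
  assumes "ring R"
    and "\<And>x y. \<lbrakk>x \<in> carrier M; y \<in> carrier M\<rbrakk> \<Longrightarrow> x \<oplus>\<^bsub>M\<^esub> y \<in> carrier M"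
    and "\<zero>\<^bsub>M\<^esub> \<in> carrier M"
    and "\<And>x y z. \<lbrakk>x \<in> carrier M; y \<in> carrier M; z \<in> carrier M\<rbrakk>
      \<Longrightarrow> (x \<oplus>\<^bsub>M\<^esub> y) \<oplus>\<^bsub>M\<^esub> z = x \<oplus>\<^bsub>M\<^esub> (y \<oplus>\<^bsub>M\<^esub> z)"
    and "\<And>x y. \<lbrakk>x \<in> carrier M; y \<in> carrier M\<rbrakk> \<Longrightarrow> x \<oplus>\<^bsub>M\<^esub> y = y \<oplus>\<^bsub>M\<^esub> x"
    and "\<And>x. x \<in> carrier M \<Longrightarrow> \<zero>\<^bsub>M\<^esub> \<oplus>\<^bsub>M\<^esub> x = x"
    and "\<And>r x. \<lbrakk>r \<in> carrier R; x \<in> carrier M\<rbrakk> \<Longrightarrow> r \<odot>\<^bsub>M\<^esub> x \<in> carrier M"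
    and "\<And>r s x. \<lbrakk>r \<in> carrier R; s \<in> carrier R; x \<in> carrier M\<rbrakk>
      \<Longrightarrow> (r \<oplus>\<^bsub>R\<^esub> s) \<odot>\<^bsub>M\<^esub> x = r \<odot>\<^bsub>M\<^esub> x \<oplus>\<^bsub>M\<^esub> s \<odot>\<^bsub>M\<^esub> x"
    and "\<And>r x y. \<lbrakk>r \<in> carrier R; x \<in> carrier M; y \<in> carrier M\<rbrakk>
      \<Longrightarrow> r \<odot>\<^bsub>M\<^esub> (x \<oplus>\<^bsub>M\<^esub> y) = r \<odot>\<^bsub>M\<^esub> x \<oplus>\<^bsub>M\<^esub> r \<odot>\<^bsub>M\<^esub> y"
    and "\<And>r s x. \<lbrakk>r \<in> carrier R; s \<in> carrier R; x \<in> carrier M\<rbrakk>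
      \<Longrightarrow> (r \<otimes>\<^bsub>R\<^esub> s) \<odot>\<^bsub>M\<^esub> x = r \<odot>\<^bsub>M\<^esub> (s \<odot>\<^bsub>M\<^esub> x)"
    and "\<And>x. x \<in> carrier M \<Longrightarrow> \<one>\<^bsub>R\<^esub> \<odot>\<^bsub>M\<^esub> x = x"
    and zero: "\<And>x. x \<in> carrier M \<Longrightarrow> \<zero>\<^bsub>R\<^esub> \<odot>\<^bsub>M\<^esub> x = \<zero>\<^bsub>M\<^esub>"
  shows "left_module R M"
proof -
  interpret ring R by fact
  have "\<exists>y\<in>carrier M. y \<oplus>\<^bsub>M\<^esub> x = \<zero>\<^bsub>M\<^esub>" if x: "x \<in> carrier M" for x
  proof
    have "(\<ominus>\<^bsub>R\<^esub> \<one>\<^bsub>R\<^esub>) \<odot>\<^bsub>M\<^esub> x \<oplus>\<^bsub>M\<^esub> x = (\<ominus>\<^bsub>R\<^esub> \<one>\<^bsub>R\<^esub> \<oplus>\<^bsub>R\<^esub> \<one>\<^bsub>R\<^esub>) \<odot>\<^bsub>M\<^esub> x"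
      using x assms by simp
    then show "(\<ominus>\<^bsub>R\<^esub> \<one>\<^bsub>R\<^esub>) \<odot>\<^bsub>M\<^esub> x \<oplus>\<^bsub>M\<^esub> x = \<zero>\<^bsub>M\<^esub>"
      using zero x by (simp add: l_neg)
    show "(\<ominus>\<^bsub>R\<^esub> \<one>\<^bsub>R\<^esub>) \<odot>\<^bsub>M\<^esub> x \<in> carrier M"
      using x assms by simp
  qed
  then have "abelian_group M"
    by (intro abelian_groupI) (use assms in auto)
  then show ?thesis
    using assms by (auto simp: left_module_def left_module_axioms_def)
qed

context left_module
begin

lemma smult_zero_left [simp]: "x \<in> carrier M \<Longrightarrow> \<zero> \<odot>\<^bsub>M\<^esub> x = \<zero>\<^bsub>M\<^esub>"
  by (metis M.add.r_cancel_one' R.l_zero R.zero_closed smult_closed smult_l_distr)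

lemma smult_zero_right [simp]: "r \<in> carrier R \<Longrightarrow> r \<odot>\<^bsub>M\<^esub> \<zero>\<^bsub>M\<^esub> = \<zero>\<^bsub>M\<^esub>"
  by (metis M.add.r_cancel_one' M.l_zero M.zero_closed smult_closed smult_r_distr)

lemma smult_minus_right:
  assumes "r \<in> carrier R" "x \<in> carrier M"
  shows "r \<odot>\<^bsub>M\<^esub> (\<ominus>\<^bsub>M\<^esub> x) = \<ominus>\<^bsub>M\<^esub> (r \<odot>\<^bsub>M\<^esub> x)"
  by (metis M.add.inv_closed M.add.inv_equality M.l_neg assms smult_closed smult_r_distr
      smult_zero_right)

lemma smult_minus_one:
  assumes "x \<in> carrier M"
  shows "(\<ominus> \<one>) \<odot>\<^bsub>M\<^esub> x = \<ominus>\<^bsub>M\<^esub> x"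
  by (metis M.add.inv_equality R.add.inv_closed R.l_neg R.one_closed assms smult_closed
      smult_l_distr smult_one smult_zero_left)

text \<open>Closure under negatives comes from the scalar -1, so zero, sums and multiples
  suffice.\<close>

lemma submoduleI:
  assumes "H \<subseteq> carrier M" "\<zero>\<^bsub>M\<^esub> \<in> H"
    and "\<And>x y. x \<in> H \<Longrightarrow> y \<in> H \<Longrightarrow> x \<oplus>\<^bsub>M\<^esub> y \<in> H"
    and "\<And>r x. r \<in> carrier R \<Longrightarrow> x \<in> H \<Longrightarrow> r \<odot>\<^bsub>M\<^esub> x \<in> H"
  shows "submodule H R M"
proof -
  have "\<ominus>\<^bsub>M\<^esub> x \<in> H" if "x \<in> H" for x
    using assms(4)[of "\<ominus> \<one>" x] that assms(1) smult_minus_one by auto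
  then show ?thesis
    unfolding submodule_def submodule_axioms_def subgroup_def
    using assms by (auto simp: a_inv_def)
qed

lemma submodule_carrier: "submodule (carrier M) R M"
  by (rule submoduleI) (auto intro: smult_closed)

end

lemma submodule_subset: "submodule H R M \<Longrightarrow> H \<subseteq> carrier M"
  by (auto simp: submodule_def subgroup_def)

lemma submodule_zero: "submodule H R M \<Longrightarrow> \<zero>\<^bsub>M\<^esub> \<in> H"
  by (auto simp: submodule_def subgroup_def)

lemma submodule_add: "submodule H R M \<Longrightarrow> x \<in> H \<Longrightarrow> y \<in> H \<Longrightarrow> x \<oplus>\<^bsub>M\<^esub> y \<in> H"
  by (auto simp: submodule_def subgroup_def)

lemma submodule_smult: "submodule H R M \<Longrightarrow> r \<in> carrier R \<Longrightarrow> x \<in> H \<Longrightarrow> r \<odot>\<^bsub>M\<^esub> x \<in> H"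
  by (auto simp: submodule_def submodule_axioms_def)

lemma submodule_uminus: "submodule H R M \<Longrightarrow> x \<in> H \<Longrightarrow> \<ominus>\<^bsub>M\<^esub> x \<in> H"
  by (auto simp: submodule_def subgroup_def a_inv_def)

lemma submodule_minus: "submodule H R M \<Longrightarrow> x \<in> H \<Longrightarrow> y \<in> H \<Longrightarrow> x \<ominus>\<^bsub>M\<^esub> y \<in> H"
  by (simp add: a_minus_def submodule_add submodule_uminus)

lemma left_module_submodule:
  assumes "left_module R M" "submodule H R M"
  shows "left_module R (M\<lparr>carrier := H\<rparr>)"
proof -
  interpret left_module R M by fact
  have H: "x \<in> carrier M" if "x \<in> H" for x
    using that submodule_subset[OF assms(2)] by auto
  show ?thesis
    by (rule left_moduleI)
       (auto simp: submodule_add[OF assms(2)] submodule_zero[OF assms(2)]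
         submodule_smult[OF assms(2)] H M.a_ac smult_l_distr smult_r_distr
         smult_assoc smult_one R.ring_axioms)
qed

lemma mod_span_submodule:
  assumes "left_module R M" "X \<subseteq> carrier M"
  shows "submodule (mod_span R M X) R M"
proof -
  interpret left_module R M by fact
  show ?thesis
  proof (rule submoduleI)
    show "mod_span R M X \<subseteq> carrier M"
      using submodule_carrier assms by (auto simp: mod_span_def)
  qed (auto simp: mod_span_def submodule_zero submodule_add submodule_smult)
qed

lemma mod_span_superset: "X \<subseteq> mod_span R M X"
  by (auto simp: mod_span_def)

lemma mod_span_least: "submodule H R M \<Longrightarrow> X \<subseteq> H \<Longrightarrow> mod_span R M X \<subseteq> H"
  by (auto simp: mod_span_def)

lemma reg_simps [simp]:
  "carrier (reg_module R) = carrier R" "\<zero>\<^bsub>reg_module R\<^esub> = \<zero>\<^bsub>R\<^esub>"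
  "x \<oplus>\<^bsub>reg_module R\<^esub> y = x \<oplus>\<^bsub>R\<^esub> y" "x \<odot>\<^bsub>reg_module R\<^esub> y = x \<otimes>\<^bsub>R\<^esub> y"
  by (simp_all add: reg_module_def)

lemma left_module_reg: "ring R \<Longrightarrow> left_module R (reg_module R)"
proof -
  assume "ring R"
  then interpret ring R .
  show ?thesis
    by (rule left_moduleI)
       (auto simp: a_ac m_assoc l_distr r_distr ring_axioms)
qed

lemma free_simps [simp]:
  "\<zero>\<^bsub>free_module R X\<^esub> = (\<lambda>x. \<zero>\<^bsub>R\<^esub>)"
  "u \<oplus>\<^bsub>free_module R X\<^esub> v = (\<lambda>x. u x \<oplus>\<^bsub>R\<^esub> v x)"
  "r \<odot>\<^bsub>free_module R X\<^esub> v = (\<lambda>x. r \<otimes>\<^bsub>R\<^esub> v x)"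
  by (simp_all add: free_module_def)

lemma free_carrier:
  "carrier (free_module R X) = {v. (\<forall>x\<in>X. v x \<in> carrier R) \<and> (\<forall>x. x \<notin> X \<longrightarrow> v x = \<zero>\<^bsub>R\<^esub>) \<and>
       finite {x. v x \<noteq> \<zero>\<^bsub>R\<^esub>}}"
  by (simp add: free_module_def)

lemma free_opp [simp]: "carrier (free_module (opp R) X) = carrier (free_module R X)"
  by (simp add: free_carrier)

lemma free_closed: "ring R \<Longrightarrow> v \<in> carrier (free_module R X) \<Longrightarrow> v x \<in> carrier R"
  by (cases "x \<in> X") (auto simp: free_carrier ring.ring_simprules)

lemma free_finite_carrier:
  "finite X \<Longrightarrow> carrier (free_module R X) =
     {v. (\<forall>x\<in>X. v x \<in> carrier R) \<and> (\<forall>x. x \<notin> X \<longrightarrow> v x = \<zero>\<^bsub>R\<^esub>)}"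
  unfolding free_carrier by (auto elim!: finite_subset[rotated])

lemma left_module_free: assumes "ring R" shows "left_module R (free_module R X)"
proof -
  interpret ring R by fact
  \<comment> \<open>One bound serves all operations: a function that vanishes wherever u and v both
    vanish has its support in the union of their supports.\<close>
  have fin: "finite {x. f x \<noteq> \<zero>\<^bsub>R\<^esub>}" if "finite {x. u x \<noteq> \<zero>\<^bsub>R\<^esub>}" "finite {x. v x \<noteq> \<zero>\<^bsub>R\<^esub>}"
    "\<And>x. u x = \<zero>\<^bsub>R\<^esub> \<Longrightarrow> v x = \<zero>\<^bsub>R\<^esub> \<Longrightarrow> f x = \<zero>\<^bsub>R\<^esub>"
    for f u v :: "'c \<Rightarrow> 'a"
    by (rule finite_subset[OF _ finite_UnI[OF that(1,2)]]) (use that(3) in auto)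
  have C: "v x \<in> carrier R" if "v \<in> carrier (free_module R X)" for v x
    using that assms free_closed by metis
  show ?thesis
  proof (rule left_moduleI)
    fix u v assume u: "u \<in> carrier (free_module R X)" and v: "v \<in> carrier (free_module R X)"
    then show "u \<oplus>\<^bsub>free_module R X\<^esub> v \<in> carrier (free_module R X)"
      by (auto simp: free_carrier intro: fin[of u v])
  next
    fix r u assume r: "r \<in> carrier R" and u: "u \<in> carrier (free_module R X)"
    then show "r \<odot>\<^bsub>free_module R X\<^esub> u \<in> carrier (free_module R X)"
      by (auto simp: free_carrier intro: fin[of u u])
  next
    show "\<zero>\<^bsub>free_module R X\<^esub> \<in> carrier (free_module R X)"
      by (auto simp: free_carrier)
  qed (auto simp: assms fun_eq_iff C a_ac m_assoc l_distr r_distr)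
qed

lemma mod_hom_closed: "f \<in> mod_hom R M N \<Longrightarrow> x \<in> carrier M \<Longrightarrow> f x \<in> carrier N"
  by (auto simp: mod_hom_def)

lemma mod_hom_add: "f \<in> mod_hom R M N \<Longrightarrow> x \<in> carrier M \<Longrightarrow> y \<in> carrier M
  \<Longrightarrow> f (x \<oplus>\<^bsub>M\<^esub> y) = f x \<oplus>\<^bsub>N\<^esub> f y"
  by (auto simp: mod_hom_def)

lemma mod_hom_smult: "f \<in> mod_hom R M N \<Longrightarrow> r \<in> carrier R \<Longrightarrow> x \<in> carrier M
  \<Longrightarrow> f (r \<odot>\<^bsub>M\<^esub> x) = r \<odot>\<^bsub>N\<^esub> f x"
  by (auto simp: mod_hom_def)

lemma mod_hom_ext:
  "f \<in> mod_hom R M N \<Longrightarrow> g \<in> mod_hom R M N' \<Longrightarrow> (\<And>x. x \<in> carrier M \<Longrightarrow> f x = g x) \<Longrightarrow> f = g"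
  by (rule extensionalityI[of _ "carrier M"]) (auto simp: mod_hom_def PiE_def)

lemma mod_hom_restrictI:
  assumes "left_module R M"
    and "\<And>x. x \<in> carrier M \<Longrightarrow> f x \<in> carrier N"
    and "\<And>x y. x \<in> carrier M \<Longrightarrow> y \<in> carrier M \<Longrightarrow> f (x \<oplus>\<^bsub>M\<^esub> y) = f x \<oplus>\<^bsub>N\<^esub> f y"
    and "\<And>r x. r \<in> carrier R \<Longrightarrow> x \<in> carrier M \<Longrightarrow> f (r \<odot>\<^bsub>M\<^esub> x) = r \<odot>\<^bsub>N\<^esub> f x"
  shows "restrict f (carrier M) \<in> mod_hom R M N"
proof -
  interpret left_module R M by fact
  show ?thesis
    using assms by (auto simp: mod_hom_def smult_closed)
qed

lemma mod_hom_zero: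
  assumes "left_module R M" "left_module R N" "f \<in> mod_hom R M N"
  shows "f \<zero>\<^bsub>M\<^esub> = \<zero>\<^bsub>N\<^esub>"
proof -
  interpret M: left_module R M by fact
  interpret N: left_module R N by fact
  show ?thesis
    using mod_hom_smult[OF assms(3), of "\<zero>\<^bsub>R\<^esub>" "\<zero>\<^bsub>M\<^esub>"] mod_hom_closed[OF assms(3), of "\<zero>\<^bsub>M\<^esub>"]
    by simp
qed

lemma mod_hom_uminus:
  assumes "left_module R M" "left_module R N" "f \<in> mod_hom R M N" "x \<in> carrier M"
  shows "f (\<ominus>\<^bsub>M\<^esub> x) = \<ominus>\<^bsub>N\<^esub> f x"
proof -
  interpret M: left_module R M by fact
  interpret N: left_module R N by fact
  show ?thesis
    using mod_hom_smult[OF assms(3), of "\<ominus>\<^bsub>R\<^esub> \<one>\<^bsub>R\<^esub>" x] mod_hom_closed[OF assms(3), of x] assms(4)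
    by (simp add: M.smult_minus_one N.smult_minus_one)
qed

lemma mod_hom_minus:
  assumes "left_module R M" "left_module R N" "f \<in> mod_hom R M N" "x \<in> carrier M" "y \<in> carrier M"
  shows "f (x \<ominus>\<^bsub>M\<^esub> y) = f x \<ominus>\<^bsub>N\<^esub> f y"
proof -
  interpret M: left_module R M by fact
  interpret N: left_module R N by fact
  show ?thesis
    using assms mod_hom_uminus[OF assms(1-3,5)] by (simp add: a_minus_def mod_hom_add)
qed

lemma mod_hom_compose:
  assumes "left_module R L" "f \<in> mod_hom R L M" "g \<in> mod_hom R M N"
  shows "compose (carrier L) g f \<in> mod_hom R L N"
  unfolding compose_def
  by (rule mod_hom_restrictI[OF assms(1)])
     (auto simp: mod_hom_closed[OF assms(2)] mod_hom_closed[OF assms(3)] mod_hom_add[OF assms(2)]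
        mod_hom_smult[OF assms(2)] mod_hom_add[OF assms(3)] mod_hom_smult[OF assms(3)])

lemma mod_hom_subdomain:
  assumes "left_module R M" "submodule H R M" "f \<in> mod_hom R M N"
  shows "restrict f H \<in> mod_hom R (M\<lparr>carrier := H\<rparr>) N"
proof -
  have H: "x \<in> carrier M" if "x \<in> H" for x
    using that submodule_subset[OF assms(2)] by auto
  show ?thesis
    using mod_hom_restrictI[OF left_module_submodule[OF assms(1,2)], of f N]
    by (simp add: H mod_hom_closed[OF assms(3)] mod_hom_add[OF assms(3)] mod_hom_smult[OF assms(3)])
qed

lemma mod_hom_comb:
  assumes "left_module R M" "left_module R N" "f \<in> mod_hom R M N" "g \<in> mod_hom R M N"
  shows "(\<lambda>x\<in>carrier M. f x \<oplus>\<^bsub>N\<^esub> g x) \<in> mod_hom R M N"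
    and "(\<lambda>x\<in>carrier M. f x \<ominus>\<^bsub>N\<^esub> g x) \<in> mod_hom R M N"
proof -
  interpret M: left_module R M by fact
  interpret N: left_module R N by fact
  note h = mod_hom_closed[OF assms(3)] mod_hom_closed[OF assms(4)] mod_hom_add[OF assms(3)]
    mod_hom_smult[OF assms(3)] mod_hom_add[OF assms(4)] mod_hom_smult[OF assms(4)]
  show "(\<lambda>x\<in>carrier M. f x \<oplus>\<^bsub>N\<^esub> g x) \<in> mod_hom R M N"
    by (rule mod_hom_restrictI[OF assms(1)]) (auto simp: h N.a_ac N.smult_r_distr)
  show "(\<lambda>x\<in>carrier M. f x \<ominus>\<^bsub>N\<^esub> g x) \<in> mod_hom R M N"
    by (rule mod_hom_restrictI[OF assms(1)])
       (auto simp: h a_minus_def N.a_ac N.smult_r_distr N.minus_add N.smult_minus_right)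
qed

lemma mod_hom_ker:
  assumes "left_module R M" "left_module R N" "f \<in> mod_hom R M N"
  shows "submodule {x \<in> carrier M. f x = \<zero>\<^bsub>N\<^esub>} R M"
proof -
  interpret M: left_module R M by fact
  interpret N: left_module R N by fact
  show ?thesis
    by (rule M.submoduleI)
       (auto simp: mod_hom_zero[OF assms] mod_hom_add[OF assms(3)] mod_hom_smult[OF assms(3)] M.smult_closed)
qed

lemma mod_hom_vimage:
  assumes "left_module R M" "left_module R N" "f \<in> mod_hom R M N" "submodule H R N"
  shows "submodule {x \<in> carrier M. f x \<in> H} R M"
proof -
  interpret M: left_module R M by fact
  interpret N: left_module R N by fact
  show ?thesis
    by (rule M.submoduleI)
       (auto simp: mod_hom_zero[OF assms(1-3)] mod_hom_add[OF assms(3)] mod_hom_smult[OF assms(3)]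
         M.smult_closed submodule_zero[OF assms(4)] submodule_add[OF assms(4)] submodule_smult[OF assms(4)])
qed

lemma mod_hom_image:
  assumes "left_module R M" "left_module R N" "f \<in> mod_hom R M N" "submodule H R M"
  shows "submodule (f ` H) R N"
proof -
  interpret M: left_module R M by fact
  interpret N: left_module R N by fact
  have H: "x \<in> carrier M" if "x \<in> H" for x
    using that submodule_subset[OF assms(4)] by auto
  show ?thesis
  proof (rule N.submoduleI)
    show "\<zero>\<^bsub>N\<^esub> \<in> f ` H"
      using mod_hom_zero[OF assms(1-3)] submodule_zero[OF assms(4)] by (metis imageI)
    show "f ` H \<subseteq> carrier N"
      using H mod_hom_closed[OF assms(3)] by auto
  next
    fix x y assume "x \<in> f ` H" "y \<in> f ` H"
    then show "x \<oplus>\<^bsub>N\<^esub> y \<in> f ` H"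
      using H mod_hom_add[OF assms(3), symmetric] submodule_add[OF assms(4)] by auto
  next
    fix r x assume "r \<in> carrier R" "x \<in> f ` H"
    then show "r \<odot>\<^bsub>N\<^esub> x \<in> f ` H"
      using H mod_hom_smult[OF assms(3), symmetric] submodule_smult[OF assms(4)] by auto
  qed
qed

text \<open>The value at y is f of a chosen preimage of y; two preimages differ by an element of ker
  q, on which f vanishes. The factor lives on the image of q and not on M, because q may be the
  relation map of a presentation: its image is then the finitely generated submodule from which
  FP-injectivity extends homomorphisms.\<close>

lemma mod_hom_factor:
  assumes P: "left_module R P" and M: "left_module R M" and N: "left_module R N"
    and q: "q \<in> mod_hom R P M" and f: "f \<in> mod_hom R P N"
    and ker: "\<And>x. x \<in> carrier P \<Longrightarrow> q x = \<zero>\<^bsub>M\<^esub> \<Longrightarrow> f x = \<zero>\<^bsub>N\<^esub>"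
  obtains g where "g \<in> mod_hom R (M\<lparr>carrier := q ` carrier P\<rparr>) N"
    and "\<And>x. x \<in> carrier P \<Longrightarrow> g (q x) = f x"
proof -
  interpret P: left_module R P by fact
  interpret M: left_module R M by fact
  interpret N: left_module R N by fact
  let ?I = "M\<lparr>carrier := q ` carrier P\<rparr>"
  define g where "g = (\<lambda>y\<in>q ` carrier P. f (SOME x. x \<in> carrier P \<and> q x = y))"
  have g: "g (q x) = f x" if x: "x \<in> carrier P" for x
  proof -
    define y where "y = (SOME y. y \<in> carrier P \<and> q y = q x)"
    have "y \<in> carrier P \<and> q y = q x"
      unfolding y_def by (rule someI[of _ x]) (use x in auto)
    then have y: "y \<in> carrier P" "q y = q x" by auto
    have "q (y \<ominus>\<^bsub>P\<^esub> x) = \<zero>\<^bsub>M\<^esub>"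
      using x y mod_hom_closed[OF q x] by (simp add: mod_hom_minus[OF P M q] M.minus_eq_zero_iff)
    then have "f y \<ominus>\<^bsub>N\<^esub> f x = \<zero>\<^bsub>N\<^esub>"
      using x y ker[of "y \<ominus>\<^bsub>P\<^esub> x"] by (simp add: mod_hom_minus[OF P N f])
    then have "f y = f x"
      using mod_hom_closed[OF f] x y by (simp add: N.minus_eq_zero_iff)
    then show ?thesis
      using x by (simp add: g_def y_def)
  qed
  have "submodule (q ` carrier P) R M"
    by (rule mod_hom_image[OF P M q P.submodule_carrier])
  then have I: "left_module R ?I"
    by (rule left_module_submodule[OF M])
  have "restrict g (carrier ?I) \<in> mod_hom R ?I N"
  proof (rule mod_hom_restrictI[OF I])
    fix x y assume "x \<in> carrier ?I" "y \<in> carrier ?I"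
    then show "g (x \<oplus>\<^bsub>?I\<^esub> y) = g x \<oplus>\<^bsub>N\<^esub> g y"
      by (auto simp: g mod_hom_add[OF q, symmetric] mod_hom_add[OF f])
  next
    fix r x assume "r \<in> carrier R" "x \<in> carrier ?I"
    then show "g (r \<odot>\<^bsub>?I\<^esub> x) = r \<odot>\<^bsub>N\<^esub> g x"
      by (auto simp: g P.smult_closed mod_hom_smult[OF q, symmetric] mod_hom_smult[OF f])
  qed (auto simp: g mod_hom_closed[OF f])
  moreover have "restrict g (carrier ?I) = g"
    by (simp add: g_def)
  ultimately show ?thesis
    using that g by simp
qed

lemma mod_hom_factor_surj:
  assumes P: "left_module R P" and M: "left_module R M" and N: "left_module R N"
    and q: "q \<in> mod_hom R P M" "q ` carrier P = carrier M" and f: "f \<in> mod_hom R P N"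
    and ker: "\<And>x. x \<in> carrier P \<Longrightarrow> q x = \<zero>\<^bsub>M\<^esub> \<Longrightarrow> f x = \<zero>\<^bsub>N\<^esub>"
  obtains g where "g \<in> mod_hom R M N" and "\<And>x. x \<in> carrier P \<Longrightarrow> g (q x) = f x"
  using mod_hom_factor[OF P M N q(1) f ker] q(2) by auto

subsection \<open>Free modules, spans and quotients\<close>

lemma (in left_module) smult_finsum:
  assumes "finite A" "r \<in> carrier R" "f \<in> A \<rightarrow> carrier M"
  shows "r \<odot>\<^bsub>M\<^esub> (\<Oplus>\<^bsub>M\<^esub>x\<in>A. f x) = (\<Oplus>\<^bsub>M\<^esub>x\<in>A. r \<odot>\<^bsub>M\<^esub> f x)"
  using assms(1,3)
proof (induct rule: finite_induct)
  case empty
  then show ?case using assms(2) by simp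
next
  case (insert a A)
  then show ?case
    using assms(2) by (simp add: Pi_iff M.finsum_insert M.finsum_closed smult_r_distr smult_closed)
qed

definition unit_vec :: "('a, 'z) ring_scheme \<Rightarrow> 'x \<Rightarrow> 'x \<Rightarrow> 'a" where
  "unit_vec R x = (\<lambda>y. if y = x then \<one>\<^bsub>R\<^esub> else \<zero>\<^bsub>R\<^esub>)"

lemma unit_vec_closed:
  assumes "ring R" "x \<in> X" shows "unit_vec R x \<in> carrier (free_module R X)"
proof -
  interpret ring R by fact
  have "{y. unit_vec R x y \<noteq> \<zero>\<^bsub>R\<^esub>} \<subseteq> {x}"
    by (auto simp: unit_vec_def)
  then have "finite {y. unit_vec R x y \<noteq> \<zero>\<^bsub>R\<^esub>}"
    by (rule finite_subset) simp
  then show ?thesis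
    using assms(2) by (auto simp: free_carrier) (auto simp: unit_vec_def)
qed

text \<open>Unit vectors generate the free module, phrased as an induction rule. Setting one nonzero
  coordinate to zero shrinks the support by one element, so the argument also covers infinite index
  sets.\<close>

lemma free_module_induct [consumes 2, case_names zero step]:
  assumes R: "ring R" and v: "v \<in> carrier (free_module R X)"
    and zero: "P (\<lambda>x. \<zero>\<^bsub>R\<^esub>)"
    and step: "\<And>u r x. \<lbrakk>u \<in> carrier (free_module R X); r \<in> carrier R; x \<in> X; P u\<rbrakk>
      \<Longrightarrow> P (u \<oplus>\<^bsub>free_module R X\<^esub> r \<odot>\<^bsub>free_module R X\<^esub> unit_vec R x)"
  shows "P v"
  using v
proof (induct "card {x. v x \<noteq> \<zero>\<^bsub>R\<^esub>}" arbitrary: v)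
  case 0
  then have "v = (\<lambda>x. \<zero>\<^bsub>R\<^esub>)"
    by (auto simp: free_carrier fun_eq_iff)
  with zero show ?case by simp
next
  case (Suc n)
  interpret ring R by fact
  obtain x where x: "v x \<noteq> \<zero>\<^bsub>R\<^esub>"
    using Suc(2) by (metis (mono_tags, lifting) Collect_empty_eq card.empty nat.distinct(1))
  define u where "u = v(x := \<zero>\<^bsub>R\<^esub>)"
  have supp: "{y. u y \<noteq> \<zero>\<^bsub>R\<^esub>} = {y. v y \<noteq> \<zero>\<^bsub>R\<^esub>} - {x}"
    by (auto simp: u_def)
  have fin: "finite {y. v y \<noteq> \<zero>\<^bsub>R\<^esub>}" and xX: "x \<in> X"
    using Suc(3) x by (auto simp: free_carrier)
  have "n = card {y. u y \<noteq> \<zero>\<^bsub>R\<^esub>}"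
    using Suc(2) fin x unfolding supp by (simp add: card_Diff_singleton)
  moreover have u: "u \<in> carrier (free_module R X)"
    using Suc(3) fin unfolding free_carrier mem_Collect_eq supp by (auto simp: u_def)
  ultimately have "P u" by (rule Suc(1))
  moreover have "v x \<in> carrier R" using free_closed[OF R Suc(3)] .
  moreover have "u \<oplus>\<^bsub>free_module R X\<^esub> v x \<odot>\<^bsub>free_module R X\<^esub> unit_vec R x = v"
    using free_closed[OF R Suc(3)] by (auto simp: fun_eq_iff u_def unit_vec_def)
  ultimately show ?case
    using step[OF u _ xX, of "v x"] by simp
qed

lemma free_hom_eqI:
  assumes R: "ring R" and M: "left_module R M"
    and f: "f \<in> mod_hom R (free_module R X) M" and g: "g \<in> mod_hom R (free_module R X) M"
    and eq: "\<And>x. x \<in> X \<Longrightarrow> f (unit_vec R x) = g (unit_vec R x)"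
    and v: "v \<in> carrier (free_module R X)"
  shows "f v = g v"
proof -
  note F = left_module_free[OF R, of X]
  interpret F: left_module R "free_module R X" by (rule F)
  show ?thesis
    using R v
  proof (induct v rule: free_module_induct)
    case zero
    show ?case
      using mod_hom_zero[OF F M f] mod_hom_zero[OF F M g] by simp
  next
    case (step u r x)
    then have "r \<odot>\<^bsub>free_module R X\<^esub> unit_vec R x \<in> carrier (free_module R X)"
      by (intro F.smult_closed unit_vec_closed R)
    with step show ?case
      by (simp only: mod_hom_add[OF f] mod_hom_add[OF g] mod_hom_smult[OF f] mod_hom_smult[OF g]
          unit_vec_closed[OF R] eq)
  qed
qed

text \<open>In \<open>lincomb\<close> each element is its own index. Here the index set is arbitrary
  and the family may repeat elements, which is needed for maps out of R^n.\<close>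

definition family_lincomb ::
  "('a, 'z) ring_scheme \<Rightarrow> ('a, 'b) module \<Rightarrow> ('x \<Rightarrow> 'b) \<Rightarrow> ('x \<Rightarrow> 'a) \<Rightarrow> 'b" where
  "family_lincomb R M \<phi> v = (\<Oplus>\<^bsub>M\<^esub>x\<in>{x. v x \<noteq> \<zero>\<^bsub>R\<^esub>}. v x \<odot>\<^bsub>M\<^esub> \<phi> x)"

lemma lincomb_eq: "lincomb R M = family_lincomb R M (\<lambda>x. x)"
  by (simp add: lincomb_def family_lincomb_def fun_eq_iff)

text \<open>The support of a sum or of a multiple can be smaller than the supports of its terms.
  Linearity can be checked term by term only after all sums have been spread over one common finite
  index set.\<close>

lemma family_lincomb_superset:
  assumes M: "left_module R M" and \<phi>: "\<phi> \<in> X \<rightarrow> carrier M"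
    and v: "v \<in> carrier (free_module R X)"
    and A: "finite A" "{x. v x \<noteq> \<zero>\<^bsub>R\<^esub>} \<subseteq> A" "A \<subseteq> X"
  shows "family_lincomb R M \<phi> v = (\<Oplus>\<^bsub>M\<^esub>x\<in>A. v x \<odot>\<^bsub>M\<^esub> \<phi> x)"
proof -
  interpret left_module R M by fact
  have c: "v x \<odot>\<^bsub>M\<^esub> \<phi> x \<in> carrier M" if "x \<in> X" for x
    using that \<phi> free_closed[OF R.ring_axioms v] by (auto intro: smult_closed)
  show ?thesis
    unfolding family_lincomb_def
    by (rule M.add.finprod_mono_neutral_cong_left) (use A c \<phi> in \<open>auto simp: Pi_iff\<close>)
qed

text \<open>The universal property of free modules: existence of the homomorphism with prescribed
  values on unit vectors. Uniqueness is \<open>free_hom_eqI\<close>.\<close>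

lemma
  assumes M: "left_module R M" and \<phi>: "\<phi> \<in> X \<rightarrow> carrier M"
  shows family_lincomb_hom:
      "restrict (family_lincomb R M \<phi>) (carrier (free_module R X)) \<in> mod_hom R (free_module R X) M"
    and family_lincomb_unit_vec: "x \<in> X \<Longrightarrow> family_lincomb R M \<phi> (unit_vec R x) = \<phi> x"
proof -
  interpret left_module R M by fact
  note F = left_module_free[OF R.ring_axioms, of X]
  interpret F: left_module R "free_module R X" by (rule F)
  have c: "v x \<odot>\<^bsub>M\<^esub> \<phi> x \<in> carrier M" if "x \<in> X" "v \<in> carrier (free_module R X)" for x v
    using that \<phi> free_closed[OF R.ring_axioms] by (auto intro!: smult_closed)
  have supp: "finite {x. v x \<noteq> \<zero>\<^bsub>R\<^esub>}" "{x. v x \<noteq> \<zero>\<^bsub>R\<^esub>} \<subseteq> X" if "v \<in> carrier (free_module R X)" for v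
    using that by (auto simp: free_carrier)
  show "restrict (family_lincomb R M \<phi>) (carrier (free_module R X)) \<in> mod_hom R (free_module R X) M"
  proof (rule mod_hom_restrictI[OF F])
    fix v assume v: "v \<in> carrier (free_module R X)"
    show "family_lincomb R M \<phi> v \<in> carrier M"
      unfolding family_lincomb_def using v supp[OF v] c by (auto intro!: M.finsum_closed)
  next
    fix u v assume u: "u \<in> carrier (free_module R X)" and v: "v \<in> carrier (free_module R X)"
    let ?A = "{x. u x \<noteq> \<zero>\<^bsub>R\<^esub>} \<union> {x. v x \<noteq> \<zero>\<^bsub>R\<^esub>}"
    let ?w = "u \<oplus>\<^bsub>free_module R X\<^esub> v"
    have w: "?w \<in> carrier (free_module R X)" using u v by (rule F.M.a_closed)
    have A: "finite ?A" "?A \<subseteq> X" using supp[OF u] supp[OF v] by auto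
    have "family_lincomb R M \<phi> ?w = (\<Oplus>\<^bsub>M\<^esub>x\<in>?A. ?w x \<odot>\<^bsub>M\<^esub> \<phi> x)"
      by (rule family_lincomb_superset[OF M \<phi> w A(1) _ A(2)]) auto
    also have "\<dots> = (\<Oplus>\<^bsub>M\<^esub>x\<in>?A. u x \<odot>\<^bsub>M\<^esub> \<phi> x \<oplus>\<^bsub>M\<^esub> v x \<odot>\<^bsub>M\<^esub> \<phi> x)"
    proof (rule M.finsum_cong')
      fix x assume "x \<in> ?A"
      then have "x \<in> X" using A by auto
      then show "?w x \<odot>\<^bsub>M\<^esub> \<phi> x = u x \<odot>\<^bsub>M\<^esub> \<phi> x \<oplus>\<^bsub>M\<^esub> v x \<odot>\<^bsub>M\<^esub> \<phi> x"
        using \<phi> free_closed[OF R.ring_axioms u] free_closed[OF R.ring_axioms v]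
        by (auto simp: smult_l_distr Pi_iff)
    qed (use A c[OF _ u] c[OF _ v] in auto)
    also have "\<dots> = (\<Oplus>\<^bsub>M\<^esub>x\<in>?A. u x \<odot>\<^bsub>M\<^esub> \<phi> x) \<oplus>\<^bsub>M\<^esub> (\<Oplus>\<^bsub>M\<^esub>x\<in>?A. v x \<odot>\<^bsub>M\<^esub> \<phi> x)"
      by (rule M.finsum_addf) (use A c[OF _ u] c[OF _ v] in auto)
    also have "(\<Oplus>\<^bsub>M\<^esub>x\<in>?A. u x \<odot>\<^bsub>M\<^esub> \<phi> x) = family_lincomb R M \<phi> u"
      by (rule family_lincomb_superset[OF M \<phi> u A(1) _ A(2), symmetric]) auto
    also have "(\<Oplus>\<^bsub>M\<^esub>x\<in>?A. v x \<odot>\<^bsub>M\<^esub> \<phi> x) = family_lincomb R M \<phi> v"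
      by (rule family_lincomb_superset[OF M \<phi> v A(1) _ A(2), symmetric]) auto
    finally show "family_lincomb R M \<phi> ?w = family_lincomb R M \<phi> u \<oplus>\<^bsub>M\<^esub> family_lincomb R M \<phi> v" .
  next
    fix r v assume r: "r \<in> carrier R" and v: "v \<in> carrier (free_module R X)"
    let ?A = "{x. v x \<noteq> \<zero>\<^bsub>R\<^esub>}"
    let ?w = "r \<odot>\<^bsub>free_module R X\<^esub> v"
    have w: "?w \<in> carrier (free_module R X)" using r v by (rule F.smult_closed)
    note A = supp[OF v]
    have "family_lincomb R M \<phi> ?w = (\<Oplus>\<^bsub>M\<^esub>x\<in>?A. ?w x \<odot>\<^bsub>M\<^esub> \<phi> x)"
      by (rule family_lincomb_superset[OF M \<phi> w A(1) _ A(2)]) (use r in auto)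
    also have "\<dots> = (\<Oplus>\<^bsub>M\<^esub>x\<in>?A. r \<odot>\<^bsub>M\<^esub> (v x \<odot>\<^bsub>M\<^esub> \<phi> x))"
    proof (rule M.finsum_cong')
      fix x assume "x \<in> ?A"
      then have "x \<in> X" using A by auto
      then show "?w x \<odot>\<^bsub>M\<^esub> \<phi> x = r \<odot>\<^bsub>M\<^esub> (v x \<odot>\<^bsub>M\<^esub> \<phi> x)"
        using \<phi> r free_closed[OF R.ring_axioms v] by (auto simp: smult_assoc Pi_iff)
    qed (use A r c[OF _ v] in \<open>auto intro!: smult_closed[OF r]\<close>)
    also have "\<dots> = r \<odot>\<^bsub>M\<^esub> (\<Oplus>\<^bsub>M\<^esub>x\<in>?A. v x \<odot>\<^bsub>M\<^esub> \<phi> x)"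
      using A r c[OF _ v] by (intro smult_finsum[symmetric]) auto
    finally show "family_lincomb R M \<phi> ?w = r \<odot>\<^bsub>M\<^esub> family_lincomb R M \<phi> v"
      by (simp add: family_lincomb_def)
  qed
  assume x: "x \<in> X"
  have "family_lincomb R M \<phi> (unit_vec R x) = (\<Oplus>\<^bsub>M\<^esub>y\<in>{x}. unit_vec R x y \<odot>\<^bsub>M\<^esub> \<phi> y)"
    by (rule family_lincomb_superset[OF M \<phi> unit_vec_closed[OF R.ring_axioms x]])
       (use x in \<open>auto simp: unit_vec_def\<close>)
  also have "\<dots> = \<phi> x"
    using x \<phi> by (auto simp: unit_vec_def smult_one Pi_iff)
  finally show "family_lincomb R M \<phi> (unit_vec R x) = \<phi> x" .
qed

text \<open>Projectivity of free modules. Each unit vector is sent to a chosen preimage, and the two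
  maps into F then agree because they agree on unit vectors. The hypothesis compares images, so that
  it applies to maps onto an ideal inside R.\<close>

lemma free_hom_lift:
  assumes R: "ring R" and Q: "left_module R Q" and F: "left_module R F"
    and p: "p \<in> mod_hom R (free_module R X) F" and q: "q \<in> mod_hom R Q F"
    and im: "p ` carrier (free_module R X) \<subseteq> q ` carrier Q"
  obtains \<alpha> where "\<alpha> \<in> mod_hom R (free_module R X) Q"
    and "\<And>v. v \<in> carrier (free_module R X) \<Longrightarrow> q (\<alpha> v) = p v"
proof -
  let ?P = "free_module R X"
  note P = left_module_free[OF R, of X]
  define \<phi> where "\<phi> x = (SOME y. y \<in> carrier Q \<and> q y = p (unit_vec R x))" for x
  have \<phi>: "\<phi> x \<in> carrier Q \<and> q (\<phi> x) = p (unit_vec R x)" if x: "x \<in> X" for x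
    unfolding \<phi>_def by (rule someI_ex) (use im unit_vec_closed[OF R x] in force)
  define \<alpha> where "\<alpha> = restrict (family_lincomb R Q \<phi>) (carrier ?P)"
  have \<alpha>: "\<alpha> \<in> mod_hom R ?P Q"
    unfolding \<alpha>_def by (rule family_lincomb_hom[OF Q]) (use \<phi> in auto)
  have "compose (carrier ?P) q \<alpha> v = p v" if v: "v \<in> carrier ?P" for v
  proof (rule free_hom_eqI[OF R F mod_hom_compose[OF P \<alpha> q] p _ v])
    fix x assume x: "x \<in> X"
    have "\<phi> \<in> X \<rightarrow> carrier Q" using \<phi> by auto
    then show "compose (carrier ?P) q \<alpha> (unit_vec R x) = p (unit_vec R x)"
      using x \<phi> unit_vec_closed[OF R x]
      by (simp add: compose_def \<alpha>_def family_lincomb_unit_vec[OF Q, of \<phi> X])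
  qed
  then show ?thesis
    using that[OF \<alpha>] by (simp add: compose_def)
qed

text \<open>The preimage of the span is a submodule containing all unit vectors, hence everything;
  conversely the image is a submodule containing their images.\<close>

lemma free_hom_image_eq_span:
  assumes M: "left_module R M" and f: "f \<in> mod_hom R (free_module R X) M"
  shows "f ` carrier (free_module R X) = mod_span R M (f ` unit_vec R ` X)"
    and "f ` unit_vec R ` X \<subseteq> carrier M"
proof -
  interpret left_module R M by fact
  let ?P = "free_module R X"
  note R = R.ring_axioms
  note P = left_module_free[OF R, of X]
  interpret P: left_module R ?P by (rule P)
  let ?Y = "f ` unit_vec R ` X"
  show Y: "?Y \<subseteq> carrier M"
    by (auto intro!: mod_hom_closed[OF f] unit_vec_closed[OF R])
  have sp: "submodule (mod_span R M ?Y) R M"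
    by (rule mod_span_submodule[OF M Y])
  have "carrier ?P \<subseteq> {v \<in> carrier ?P. f v \<in> mod_span R M ?Y}"
  proof
    fix v assume "v \<in> carrier ?P"
    with R show "v \<in> {v \<in> carrier ?P. f v \<in> mod_span R M ?Y}"
    proof (induct v rule: free_module_induct)
      case zero
      show ?case
        using submodule_zero[OF mod_hom_vimage[OF P M f sp]] by simp
    next
      case (step u r x)
      have "unit_vec R x \<in> {v \<in> carrier ?P. f v \<in> mod_span R M ?Y}"
        using step(3) unit_vec_closed[OF R] mod_span_superset[of ?Y R M] by auto
      then show ?case
        by (intro submodule_add[OF mod_hom_vimage[OF P M f sp]] step
            submodule_smult[OF mod_hom_vimage[OF P M f sp]])
    qed
  qed
  moreover have "mod_span R M ?Y \<subseteq> f ` carrier ?P"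
    by (intro mod_span_least mod_hom_image[OF P M f P.submodule_carrier])
       (auto intro!: imageI unit_vec_closed[OF R])
  ultimately show "f ` carrier ?P = mod_span R M ?Y" by auto
qed

lemma fg_submodule_image_free:
  assumes M: "left_module R M" and X: "finite X" and f: "f \<in> mod_hom R (free_module R X) M"
  shows "fg_submodule R M (f ` carrier (free_module R X))"
  unfolding fg_submodule_def
  by (rule exI[of _ "f ` unit_vec R ` X"])
     (use X free_hom_image_eq_span[OF M f] in simp)

text \<open>The passage from spans to matrices: an enumeration of a finite generating set by
  \<open>{..<k}\<close> is a map out of R^k with the span as its image.\<close>

lemma fg_submodule_iff:
  assumes M: "left_module R M"
  shows "fg_submodule R M N \<longleftrightarrow>
    (\<exists>k f. f \<in> mod_hom R (free_module R {..<k::nat}) M \<and> N = f ` carrier (free_module R {..<k}))"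
proof
  interpret left_module R M by fact
  assume "fg_submodule R M N"
  then obtain X where X: "finite X" "X \<subseteq> carrier M" "N = mod_span R M X"
    by (auto simp: fg_submodule_def)
  obtain k \<phi> where \<phi>: "X = \<phi> ` {..<k::nat}"
    using finite_imp_nat_seg_image_inj_on[OF X(1)] unfolding lessThan_def by metis
  let ?P = "free_module R {..<k}"
  have \<phi>': "\<phi> \<in> {..<k} \<rightarrow> carrier M" using X(2) \<phi> by auto
  define f where "f = restrict (family_lincomb R M \<phi>) (carrier ?P)"
  have f: "f \<in> mod_hom R ?P M"
    unfolding f_def by (rule family_lincomb_hom[OF M \<phi>'])
  have "f (unit_vec R x) = \<phi> x" if "x < k" for x
    using family_lincomb_unit_vec[OF M \<phi>', of x] unit_vec_closed[OF R.ring_axioms, of x "{..<k}"] that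
    by (simp add: f_def)
  then have "f ` unit_vec R ` {..<k} = X"
    unfolding \<phi> image_image by (intro image_cong) auto
  then have "N = f ` carrier ?P"
    using X(3) free_hom_image_eq_span(1)[OF M f] by simp
  with f show "\<exists>k f. f \<in> mod_hom R (free_module R {..<k::nat}) M \<and> N = f ` carrier (free_module R {..<k})"
    by blast
qed (use fg_submodule_image_free[OF M] in auto)

lemma fg_submodule_image:
  assumes M: "left_module R M" and M': "left_module R M'" and f: "f \<in> mod_hom R M M'"
    and N: "fg_submodule R M N"
  shows "fg_submodule R M' (f ` N)"
proof -
  interpret left_module R M by fact
  obtain k g where g: "g \<in> mod_hom R (free_module R {..<k::nat}) M" "N = g ` carrier (free_module R {..<k})"
    using N fg_submodule_iff[OF M] by blast
  have "f ` N = compose (carrier (free_module R {..<k})) f g ` carrier (free_module R {..<k})"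
    using g(2) by (simp add: image_image compose_def)
  then show ?thesis
    using fg_submodule_iff[OF M'] mod_hom_compose[OF left_module_free[OF R.ring_axioms] g(1) f] by blast
qed

lemma fg_submodule_carrier_free:
  assumes R: "ring R" and X: "finite X"
  shows "fg_submodule R (free_module R X) (carrier (free_module R X))"
proof -
  note P = left_module_free[OF R, of X]
  have "restrict (\<lambda>x. x) (carrier (free_module R X)) \<in> mod_hom R (free_module R X) (free_module R X)"
    by (rule mod_hom_restrictI[OF P]) auto
  from fg_submodule_image_free[OF P X this] show ?thesis by simp
qed

text \<open>Serves twice: the kernel of a functional will be found as a sum of two images, and the
  gluing argument for ideals uses the sum of two annihilators.\<close>

lemma fg_submodule_sum:
  assumes M: "left_module R M" and I: "fg_submodule R M I" and J: "fg_submodule R M J"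
  shows "fg_submodule R M {x \<oplus>\<^bsub>M\<^esub> y |x y. x \<in> I \<and> y \<in> J}"
proof -
  interpret left_module R M by fact
  obtain X where X: "finite X" "X \<subseteq> carrier M" "I = mod_span R M X"
    using I by (auto simp: fg_submodule_def)
  obtain Y where Y: "finite Y" "Y \<subseteq> carrier M" "J = mod_span R M Y"
    using J by (auto simp: fg_submodule_def)
  let ?S = "{x \<oplus>\<^bsub>M\<^esub> y |x y. x \<in> I \<and> y \<in> J}"
  have I: "submodule I R M" and J: "submodule J R M"
    using X Y mod_span_submodule[OF M] by auto
  have i: "x \<in> I \<Longrightarrow> x \<in> carrier M" and j: "x \<in> J \<Longrightarrow> x \<in> carrier M" for x
    using submodule_subset[OF I] submodule_subset[OF J] by auto
  have "submodule ?S R M"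
  proof (rule submoduleI)
    show "\<zero>\<^bsub>M\<^esub> \<in> ?S"
      using submodule_zero[OF I] submodule_zero[OF J] M.l_zero[OF M.zero_closed] by (metis (mono_tags, lifting) mem_Collect_eq)
    show "?S \<subseteq> carrier M" using i j by auto
  next
    fix s t assume "s \<in> ?S" "t \<in> ?S"
    then obtain a b c d where *: "s = a \<oplus>\<^bsub>M\<^esub> b" "t = c \<oplus>\<^bsub>M\<^esub> d" "a \<in> I" "c \<in> I" "b \<in> J" "d \<in> J"
      by blast
    then have "s \<oplus>\<^bsub>M\<^esub> t = (a \<oplus>\<^bsub>M\<^esub> c) \<oplus>\<^bsub>M\<^esub> (b \<oplus>\<^bsub>M\<^esub> d)"
      using i j by (simp add: M.a_ac)
    then show "s \<oplus>\<^bsub>M\<^esub> t \<in> ?S"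
      using * submodule_add[OF I] submodule_add[OF J] by blast
  next
    fix r s assume r: "r \<in> carrier R" and "s \<in> ?S"
    then obtain a b where *: "s = a \<oplus>\<^bsub>M\<^esub> b" "a \<in> I" "b \<in> J"
      by blast
    then have "r \<odot>\<^bsub>M\<^esub> s = r \<odot>\<^bsub>M\<^esub> a \<oplus>\<^bsub>M\<^esub> r \<odot>\<^bsub>M\<^esub> b"
      using i j r by (simp add: smult_r_distr)
    then show "r \<odot>\<^bsub>M\<^esub> s \<in> ?S"
      using * r submodule_smult[OF I] submodule_smult[OF J] by blast
  qed
  moreover have "X \<union> Y \<subseteq> ?S"
  proof -
    have "x = x \<oplus>\<^bsub>M\<^esub> \<zero>\<^bsub>M\<^esub>" "x = \<zero>\<^bsub>M\<^esub> \<oplus>\<^bsub>M\<^esub> x" if "x \<in> X \<union> Y" for x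
      using that X(2) Y(2) by auto
    moreover have "X \<subseteq> I" "Y \<subseteq> J"
      unfolding X(3) Y(3) by (rule mod_span_superset)+
    ultimately show ?thesis
      using submodule_zero[OF I] submodule_zero[OF J] by blast
  qed
  ultimately have "mod_span R M (X \<union> Y) \<subseteq> ?S"
    by (rule mod_span_least)
  moreover have "?S \<subseteq> mod_span R M (X \<union> Y)"
  proof -
    have XY: "submodule (mod_span R M (X \<union> Y)) R M"
      by (rule mod_span_submodule[OF M]) (use X Y in auto)
    have "I \<subseteq> mod_span R M (X \<union> Y)" "J \<subseteq> mod_span R M (X \<union> Y)"
      unfolding X(3) Y(3) using mod_span_superset[of "X \<union> Y" R M]
      by (simp_all add: mod_span_least[OF XY])
    then show ?thesis by (auto intro!: submodule_add[OF XY])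
  qed
  ultimately have "?S = mod_span R M (X \<union> Y)" by auto
  then show ?thesis
    unfolding fg_submodule_def using X Y by (intro exI[of _ "X \<union> Y"]) auto
qed

text \<open>Cosets are plain sets of elements, so a quotient of \<open>free_module R {..<n}\<close>
  has the type \<open>'a fg_module\<close> over which the conditions of the theorem quantify. All
  test modules below are obtained in this way.\<close>

definition coset_of :: "('a, 'b) module \<Rightarrow> 'b set \<Rightarrow> 'b \<Rightarrow> 'b set" where
  "coset_of M K x = {y \<in> carrier M. y \<ominus>\<^bsub>M\<^esub> x \<in> K}"

definition quot_module :: "('a, 'b) module \<Rightarrow> 'b set \<Rightarrow> ('a, 'b set) module" where
  "quot_module M K = \<lparr>carrier = coset_of M K ` carrier M, mult = undefined, one = undefined,
     zero = coset_of M K \<zero>\<^bsub>M\<^esub>,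
     add = (\<lambda>A B. coset_of M K ((SOME x. x \<in> A) \<oplus>\<^bsub>M\<^esub> (SOME x. x \<in> B))),
     smult = (\<lambda>r A. coset_of M K (r \<odot>\<^bsub>M\<^esub> (SOME x. x \<in> A)))\<rparr>"

text \<open>The operations of the quotient pick representatives by choice. By \<open>rep\<close> and
  \<open>eq\<close> another choice changes a sum or a multiple by an element of K only, so the coset
  map respects the operations, and the module axioms are carried over along it.\<close>

lemma
  assumes M: "left_module R M" and K: "submodule K R M"
  shows left_module_quot: "left_module R (quot_module M K)"
    and quot_proj_hom: "restrict (coset_of M K) (carrier M) \<in> mod_hom R M (quot_module M K)"
    and quot_proj_surj: "restrict (coset_of M K) (carrier M) ` carrier M = carrier (quot_module M K)"
    and quot_proj_ker: "{x \<in> carrier M. restrict (coset_of M K) (carrier M) x = \<zero>\<^bsub>quot_module M K\<^esub>} = K"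
proof -
  interpret left_module R M by fact
  let ?c = "coset_of M K" and ?Q = "quot_module M K"
  have Kc: "x \<in> carrier M" if "x \<in> K" for x using submodule_subset[OF K] that by auto
  have eq: "?c x = ?c y \<longleftrightarrow> x \<ominus>\<^bsub>M\<^esub> y \<in> K" if x: "x \<in> carrier M" and y: "y \<in> carrier M" for x y
  proof
    assume "?c x = ?c y"
    moreover have "x \<in> ?c x"
      using x submodule_zero[OF K] by (auto simp: coset_of_def M.minus_eq_zero_iff[THEN iffD2])
    ultimately show "x \<ominus>\<^bsub>M\<^esub> y \<in> K" by (auto simp: coset_of_def)
  next
    assume k: "x \<ominus>\<^bsub>M\<^esub> y \<in> K"
    have 1: "z \<ominus>\<^bsub>M\<^esub> y = (z \<ominus>\<^bsub>M\<^esub> x) \<oplus>\<^bsub>M\<^esub> (x \<ominus>\<^bsub>M\<^esub> y)" if "z \<in> carrier M" for z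
      using that x y by (simp add: a_minus_def M.a_ac M.r_neg M.r_neg1 M.r_neg2)
    have 2: "z \<ominus>\<^bsub>M\<^esub> x = (z \<ominus>\<^bsub>M\<^esub> y) \<ominus>\<^bsub>M\<^esub> (x \<ominus>\<^bsub>M\<^esub> y)" if "z \<in> carrier M" for z
      unfolding 1[OF that] using that x y by (simp add: a_minus_def M.a_assoc M.r_neg)
    have "z \<ominus>\<^bsub>M\<^esub> x \<in> K \<longleftrightarrow> z \<ominus>\<^bsub>M\<^esub> y \<in> K" if "z \<in> carrier M" for z
      using 1[OF that] 2[OF that] submodule_add[OF K _ k] submodule_minus[OF K _ k] by metis
    then show "?c x = ?c y"
      by (auto simp: coset_of_def)
  qed
  have rep: "(SOME y. y \<in> ?c x) \<in> carrier M" "(SOME y. y \<in> ?c x) \<ominus>\<^bsub>M\<^esub> x \<in> K" if x: "x \<in> carrier M" for x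
  proof -
    have "x \<in> ?c x"
      using x submodule_zero[OF K] by (auto simp: coset_of_def M.minus_eq_zero_iff[THEN iffD2])
    then have "(SOME y. y \<in> ?c x) \<in> ?c x" by (rule someI)
    then show "(SOME y. y \<in> ?c x) \<in> carrier M" "(SOME y. y \<in> ?c x) \<ominus>\<^bsub>M\<^esub> x \<in> K"
      by (auto simp: coset_of_def)
  qed
  have add: "?c x \<oplus>\<^bsub>?Q\<^esub> ?c y = ?c (x \<oplus>\<^bsub>M\<^esub> y)" if x: "x \<in> carrier M" and y: "y \<in> carrier M" for x y
  proof -
    define a b where "a = (SOME z. z \<in> ?c x)" and "b = (SOME z. z \<in> ?c y)"
    have ab: "a \<in> carrier M" "a \<ominus>\<^bsub>M\<^esub> x \<in> K" "b \<in> carrier M" "b \<ominus>\<^bsub>M\<^esub> y \<in> K"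
      using rep x y by (auto simp: a_def b_def)
    have "(a \<oplus>\<^bsub>M\<^esub> b) \<ominus>\<^bsub>M\<^esub> (x \<oplus>\<^bsub>M\<^esub> y) = (a \<ominus>\<^bsub>M\<^esub> x) \<oplus>\<^bsub>M\<^esub> (b \<ominus>\<^bsub>M\<^esub> y)"
      using ab x y by (simp add: a_minus_def M.a_ac M.minus_add)
    then have "(a \<oplus>\<^bsub>M\<^esub> b) \<ominus>\<^bsub>M\<^esub> (x \<oplus>\<^bsub>M\<^esub> y) \<in> K"
      using submodule_add[OF K ab(2,4)] by simp
    then show ?thesis
      using ab x y eq[of "a \<oplus>\<^bsub>M\<^esub> b" "x \<oplus>\<^bsub>M\<^esub> y"] by (simp add: quot_module_def a_def b_def)
  qed
  have smult: "r \<odot>\<^bsub>?Q\<^esub> ?c x = ?c (r \<odot>\<^bsub>M\<^esub> x)" if r: "r \<in> carrier R" and x: "x \<in> carrier M" for r x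
  proof -
    define a where "a = (SOME z. z \<in> ?c x)"
    have a: "a \<in> carrier M" "a \<ominus>\<^bsub>M\<^esub> x \<in> K"
      using rep x by (auto simp: a_def)
    have "r \<odot>\<^bsub>M\<^esub> a \<ominus>\<^bsub>M\<^esub> r \<odot>\<^bsub>M\<^esub> x = r \<odot>\<^bsub>M\<^esub> (a \<ominus>\<^bsub>M\<^esub> x)"
      using a x r by (simp add: a_minus_def smult_r_distr smult_minus_right)
    then have "r \<odot>\<^bsub>M\<^esub> a \<ominus>\<^bsub>M\<^esub> r \<odot>\<^bsub>M\<^esub> x \<in> K"
      using submodule_smult[OF K r a(2)] by simp
    then show ?thesis
      using a x r eq[of "r \<odot>\<^bsub>M\<^esub> a" "r \<odot>\<^bsub>M\<^esub> x"] by (simp add: quot_module_def a_def smult_closed)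
  qed
  have car: "carrier ?Q = ?c ` carrier M" and zero: "\<zero>\<^bsub>?Q\<^esub> = ?c \<zero>\<^bsub>M\<^esub>"
    by (simp_all add: quot_module_def)
  show "left_module R ?Q"
    by (rule left_moduleI[OF R.ring_axioms])
       (auto simp: car zero add smult M.a_ac smult_closed smult_l_distr smult_r_distr smult_assoc smult_one)
  show "restrict ?c (carrier M) \<in> mod_hom R M ?Q"
    by (rule mod_hom_restrictI[OF M]) (auto simp: car add smult)
  show "restrict ?c (carrier M) ` carrier M = carrier ?Q"
    by (simp add: car)
  show "{x \<in> carrier M. restrict ?c (carrier M) x = \<zero>\<^bsub>?Q\<^esub>} = K"
  proof -
    have "x \<ominus>\<^bsub>M\<^esub> \<zero>\<^bsub>M\<^esub> = x" if "x \<in> carrier M" for x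
      using that M.minus_unique[of "\<zero>\<^bsub>M\<^esub>" "\<zero>\<^bsub>M\<^esub>" "\<ominus>\<^bsub>M\<^esub> \<zero>\<^bsub>M\<^esub>"] by (simp add: a_minus_def M.r_neg)
    then show ?thesis
      using Kc by (auto simp: zero eq)
  qed
qed

lemma fin_pres_quot:
  assumes R: "ring R" and p: "p \<in> mod_hom R (free_module R {..<m::nat}) (free_module R {..<n::nat})"
  shows "fin_pres R (quot_module (free_module R {..<n}) (p ` carrier (free_module R {..<m})))"
proof -
  note P = left_module_free[OF R]
  note K = mod_hom_image[OF P P p left_module.submodule_carrier[OF P]]
  show ?thesis
    unfolding fin_pres_def
    by (intro conjI exI[of _ m] exI[of _ n] exI[of _ p]
        exI[of _ "restrict (coset_of (free_module R {..<n}) (p ` carrier (free_module R {..<m})))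
          (carrier (free_module R {..<n}))"] left_module_quot[OF P K]
        quot_proj_hom[OF P K] quot_proj_surj[OF P K] quot_proj_ker[OF P K, symmetric] p)
qed

subsection \<open>The pairing of left and right free modules\<close>

lemma finsum_reg: "finsum (reg_module R) = finsum R"
  by (intro ext) (simp add: finsum_def finprod_def reg_module_def)

lemma finsum_opp: "finsum (opp R) = finsum R"
  by (intro ext) (simp add: finsum_def finprod_def opp_def)

definition dot :: "('a, 'z) ring_scheme \<Rightarrow> nat \<Rightarrow> (nat \<Rightarrow> 'a) \<Rightarrow> (nat \<Rightarrow> 'a) \<Rightarrow> 'a" where
  "dot R n v w = (\<Oplus>\<^bsub>R\<^esub>i\<in>{..<n}. v i \<otimes>\<^bsub>R\<^esub> w i)"

text \<open>The pairing is left linear in the first argument and right linear in the second. Over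
  the opposite ring the arguments trade places, so every fact about one argument yields the fact
  about the other.\<close>

lemma dot_opp: "dot (opp R) n w v = dot R n v w"
  by (simp add: dot_def finsum_opp)

text \<open>Reading the pairing as a linear combination of the entries of w gives linearity in v
  from the universal property.\<close>

lemma dot_eq_family_lincomb:
  assumes R: "ring R" and v: "v \<in> carrier (free_module R {..<n})" and w: "w \<in> carrier (free_module R {..<n})"
  shows "dot R n v w = family_lincomb R (reg_module R) w v"
proof -
  have "family_lincomb R (reg_module R) w v = (\<Oplus>\<^bsub>reg_module R\<^esub>x\<in>{..<n}. v x \<odot>\<^bsub>reg_module R\<^esub> w x)"
    by (rule family_lincomb_superset[OF left_module_reg[OF R] _ v])
       (use v w free_closed[OF R w] in \<open>auto simp: free_carrier\<close>)
  then show ?thesis by (simp add: dot_def finsum_reg)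
qed

lemma dot_hom:
  assumes R: "ring R" and w: "w \<in> carrier (free_module R {..<n})"
  shows "(\<lambda>v\<in>carrier (free_module R {..<n}). dot R n v w) \<in> mod_hom R (free_module R {..<n}) (reg_module R)"
proof -
  have "(\<lambda>v\<in>carrier (free_module R {..<n}). dot R n v w)
      = restrict (family_lincomb R (reg_module R) w) (carrier (free_module R {..<n}))"
    by (rule restrict_ext) (simp add: dot_eq_family_lincomb[OF R _ w])
  then show ?thesis
    using family_lincomb_hom[OF left_module_reg[OF R], of w "{..<n}"] free_closed[OF R w] by simp
qed

lemma dot_hom_opp:
  assumes R: "ring R" and v: "v \<in> carrier (free_module R {..<n})"
  shows "(\<lambda>w\<in>carrier (free_module R {..<n}). dot R n v w)
    \<in> mod_hom (opp R) (free_module (opp R) {..<n}) (reg_module (opp R))"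
  using dot_hom[OF ring_opp[OF R], of v n] v by (simp add: dot_opp)

lemma dot_unit_vec:
  assumes R: "ring R" and w: "w \<in> carrier (free_module R {..<n})" and i: "i < n"
  shows "dot R n (unit_vec R i) w = w i"
  using dot_eq_family_lincomb[OF R unit_vec_closed[OF R] w, of i]
    family_lincomb_unit_vec[OF left_module_reg[OF R], of w "{..<n}" i] i free_closed[OF R w]
  by simp

lemma dot_add_left:
  assumes "ring R" "u \<in> carrier (free_module R {..<n})" "v \<in> carrier (free_module R {..<n})"
    "w \<in> carrier (free_module R {..<n})"
  shows "dot R n (\<lambda>x. u x \<oplus>\<^bsub>R\<^esub> v x) w = dot R n u w \<oplus>\<^bsub>R\<^esub> dot R n v w"
proof -
  interpret F: left_module R "free_module R {..<n}" by (rule left_module_free[OF assms(1)])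
  show ?thesis
    using mod_hom_add[OF dot_hom[OF assms(1,4)] assms(2,3)] F.M.a_closed[OF assms(2,3)] assms(2,3)
    by simp
qed

lemma dot_smult_left:
  assumes "ring R" "r \<in> carrier R" "v \<in> carrier (free_module R {..<n})"
    "w \<in> carrier (free_module R {..<n})"
  shows "dot R n (\<lambda>x. r \<otimes>\<^bsub>R\<^esub> v x) w = r \<otimes>\<^bsub>R\<^esub> dot R n v w"
proof -
  interpret F: left_module R "free_module R {..<n}" by (rule left_module_free[OF assms(1)])
  show ?thesis
    using mod_hom_smult[OF dot_hom[OF assms(1,4)] assms(2,3)] F.smult_closed[OF assms(2,3)] assms(2,3)
    by simp
qed

lemma dot_add_right:
  assumes "ring R" "u \<in> carrier (free_module R {..<n})" "v \<in> carrier (free_module R {..<n})"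
    "w \<in> carrier (free_module R {..<n})"
  shows "dot R n u (\<lambda>x. v x \<oplus>\<^bsub>R\<^esub> w x) = dot R n u v \<oplus>\<^bsub>R\<^esub> dot R n u w"
  using dot_add_left[OF ring_opp[OF assms(1)], of v n w u] assms by (simp add: dot_opp)

lemma dot_smult_right:
  assumes "ring R" "r \<in> carrier R" "v \<in> carrier (free_module R {..<n})"
    "w \<in> carrier (free_module R {..<n})"
  shows "dot R n v (\<lambda>x. w x \<otimes>\<^bsub>R\<^esub> r) = dot R n v w \<otimes>\<^bsub>R\<^esub> r"
  using dot_smult_left[OF ring_opp[OF assms(1)], of r w n v] assms by (simp add: dot_opp)

lemma dot_zero:
  assumes "ring R" "v \<in> carrier (free_module R {..<n})"
  shows "dot R n v (\<lambda>x. \<zero>\<^bsub>R\<^esub>) = \<zero>\<^bsub>R\<^esub>" "dot R n (\<lambda>x. \<zero>\<^bsub>R\<^esub>) v = \<zero>\<^bsub>R\<^esub>"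
proof -
  interpret ring R by fact
  show "dot R n v (\<lambda>x. \<zero>\<^bsub>R\<^esub>) = \<zero>\<^bsub>R\<^esub>" "dot R n (\<lambda>x. \<zero>\<^bsub>R\<^esub>) v = \<zero>\<^bsub>R\<^esub>"
    using free_closed[OF assms] by (simp_all add: dot_def)
qed

text \<open>Nondegeneracy: pairing with the unit vectors reads off the entries of w.\<close>

lemma dot_right_eqI:
  assumes R: "ring R" and w: "w \<in> carrier (free_module R {..<n})" "w' \<in> carrier (free_module R {..<n})"
    and eq: "\<And>v. v \<in> carrier (free_module R {..<n}) \<Longrightarrow> dot R n v w = dot R n v w'"
  shows "w = w'"
proof
  fix i
  show "w i = w' i"
  proof (cases "i < n")
    case True
    then show ?thesis
      using eq[OF unit_vec_closed[OF R, of i]] dot_unit_vec[OF R w(1) True] dot_unit_vec[OF R w(2) True]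
      by simp
  qed (use w in \<open>auto simp: free_carrier\<close>)
qed

lemma dot_left_eqI:
  assumes R: "ring R" and v: "v \<in> carrier (free_module R {..<n})" "v' \<in> carrier (free_module R {..<n})"
    and eq: "\<And>w. w \<in> carrier (free_module R {..<n}) \<Longrightarrow> dot R n v w = dot R n v' w"
  shows "v = v'"
  by (rule dot_right_eqI[OF ring_opp[OF R], of _ n]) (use v eq in \<open>auto simp: dot_opp\<close>)

text \<open>The entries of d are the values of h at the unit vectors. From here on functionals on
  R^n are handled as vectors.\<close>

lemma free_hom_reg:
  assumes R: "ring R" and h: "h \<in> mod_hom R (free_module R {..<n}) (reg_module R)"
  obtains d where "d \<in> carrier (free_module R {..<n})"
    and "\<And>v. v \<in> carrier (free_module R {..<n}) \<Longrightarrow> h v = dot R n v d"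
proof -
  let ?P = "free_module R {..<n}"
  define d where "d i = (if i < n then h (unit_vec R i) else \<zero>\<^bsub>R\<^esub>)" for i
  have d: "d \<in> carrier ?P"
    using mod_hom_closed[OF h unit_vec_closed[OF R]]
    by (auto simp: free_finite_carrier d_def)
  have "h v = (\<lambda>v\<in>carrier ?P. dot R n v d) v" if "v \<in> carrier ?P" for v
    by (rule free_hom_eqI[OF R left_module_reg[OF R] h dot_hom[OF R d] _ that])
       (auto simp: unit_vec_closed[OF R] dot_unit_vec[OF R d], auto simp: d_def)
  then show ?thesis using that d by auto
qed

text \<open>This is the transposed matrix, obtained without matrix entries. For fixed w the map v
  \<mapsto> \<open>dot R n (p v) w\<close> is a functional on R^m, hence the pairing with some
  vector, which is taken as the value at w. Nondegeneracy of the pairing makes this choice linear in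
  w over the opposite ring.\<close>

lemma adjoint:
  assumes R: "ring R" and p: "p \<in> mod_hom R (free_module R {..<m}) (free_module R {..<n})"
  obtains p' where "p' \<in> mod_hom (opp R) (free_module (opp R) {..<n}) (free_module (opp R) {..<m})"
    and "\<And>v w. v \<in> carrier (free_module R {..<m}) \<Longrightarrow> w \<in> carrier (free_module R {..<n})
      \<Longrightarrow> dot R n (p v) w = dot R m v (p' w)"
proof -
  let ?M = "free_module R {..<m}" and ?N = "free_module R {..<n}"
  note M = left_module_free[OF R, of "{..<m}"] and N = left_module_free[OF R, of "{..<n}"]
  have "\<exists>d. d \<in> carrier ?M \<and> (\<forall>v\<in>carrier ?M. dot R n (p v) w = dot R m v d)"
    if w: "w \<in> carrier ?N" for w
  proof -
    have "compose (carrier ?M) (\<lambda>v\<in>carrier ?N. dot R n v w) p \<in> mod_hom R ?M (reg_module R)"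
      by (rule mod_hom_compose[OF M p dot_hom[OF R w]])
    then obtain d where "d \<in> carrier ?M"
      "\<And>v. v \<in> carrier ?M \<Longrightarrow> compose (carrier ?M) (\<lambda>v\<in>carrier ?N. dot R n v w) p v = dot R m v d"
      using free_hom_reg[OF R] by blast
    then show ?thesis using mod_hom_closed[OF p] by (auto simp: compose_def)
  qed
  then obtain f where f: "\<And>w. w \<in> carrier ?N \<Longrightarrow> f w \<in> carrier ?M"
    "\<And>v w. w \<in> carrier ?N \<Longrightarrow> v \<in> carrier ?M \<Longrightarrow> dot R n (p v) w = dot R m v (f w)"
    by metis
  let ?M' = "free_module (opp R) {..<m}" and ?N' = "free_module (opp R) {..<n}"
  note M' = left_module_free[OF ring_opp[OF R], of "{..<m}"] and N' = left_module_free[OF ring_opp[OF R], of "{..<n}"]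
  interpret M': left_module "opp R" ?M' by (rule M')
  interpret N': left_module "opp R" ?N' by (rule N')
  have "restrict f (carrier ?N') \<in> mod_hom (opp R) ?N' ?M'"
  proof (rule mod_hom_restrictI[OF N'])
    fix u w assume u: "u \<in> carrier ?N'" and w: "w \<in> carrier ?N'"
    have s: "u \<oplus>\<^bsub>?N'\<^esub> w \<in> carrier ?N'" "f u \<oplus>\<^bsub>?M'\<^esub> f w \<in> carrier ?M'"
      using u w f(1) N'.M.a_closed M'.M.a_closed by (metis free_opp)+
    show "f (u \<oplus>\<^bsub>?N'\<^esub> w) = f u \<oplus>\<^bsub>?M'\<^esub> f w"
    proof (rule dot_right_eqI[OF R])
      fix v assume v: "v \<in> carrier ?M"
      show "dot R m v (f (u \<oplus>\<^bsub>?N'\<^esub> w)) = dot R m v (f u \<oplus>\<^bsub>?M'\<^esub> f w)"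
        using u w s v f(1) mod_hom_closed[OF p v]
        by (simp add: f(2)[symmetric] dot_add_right[OF R])
    qed (use s f(1) in auto)
  next
    fix r w assume r: "r \<in> carrier (opp R)" and w: "w \<in> carrier ?N'"
    have s: "r \<odot>\<^bsub>?N'\<^esub> w \<in> carrier ?N'" "r \<odot>\<^bsub>?M'\<^esub> f w \<in> carrier ?M'"
      using r w f(1) N'.smult_closed M'.smult_closed by (metis free_opp)+
    show "f (r \<odot>\<^bsub>?N'\<^esub> w) = r \<odot>\<^bsub>?M'\<^esub> f w"
    proof (rule dot_right_eqI[OF R])
      fix v assume v: "v \<in> carrier ?M"
      show "dot R m v (f (r \<odot>\<^bsub>?N'\<^esub> w)) = dot R m v (r \<odot>\<^bsub>?M'\<^esub> f w)"
        using r w s v f(1) mod_hom_closed[OF p v]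
        by (simp add: f(2)[symmetric] dot_smult_right[OF R])
    qed (use s f(1) in auto)
  qed (use f in auto)
  then show ?thesis
    using that f(2) by auto
qed

subsection \<open>Ext and extension of homomorphisms\<close>

text \<open>For a submodule K of a free module P this expresses Ext^1(P/K, M) = 0: every
  homomorphism from K is the restriction of one from P.\<close>

definition extendable ::
  "('a, 'z) ring_scheme \<Rightarrow> ('a, 'b) module \<Rightarrow> 'b set \<Rightarrow> ('a, 'c) module \<Rightarrow> bool" where
  "extendable R P K M \<longleftrightarrow>
     (\<forall>g \<in> mod_hom R (P\<lparr>carrier := K\<rparr>) M. \<exists>h \<in> mod_hom R P M. \<forall>x\<in>K. h x = g x)"

lemma (in comm_group) trivial_Mod_iff:
  assumes B: "subgroup B G"
  shows "trivial_group (G Mod B) \<longleftrightarrow> carrier G \<subseteq> B"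
proof -
  interpret normal B G by (rule subgroup_imp_normal[OF B])
  have "B #> \<one> = B"
    by (rule coset_join2[OF _ B]) auto
  then have "carrier (G Mod B) = {B} \<longleftrightarrow> (\<forall>a\<in>carrier G. B #> a = B)"
    by (auto simp: FactGroup_def RCOSETS_def)
  also have "\<dots> \<longleftrightarrow> carrier G \<subseteq> B"
    using coset_join1[OF _ _ B] coset_join2[OF _ B] by (meson subset_eq subgroup.subset[OF B])
  finally show ?thesis
    using factorgroup_is_group by (simp add: trivial_group_def FactGroup_def)
qed

text \<open>The cocycles in \<open>Ext1\<close> form a group of this shape, with K the kernel of P1
  -> P0.\<close>

lemma comm_group_hom_group_vanishing:
  assumes P: "left_module R P" and M: "left_module R M" and K: "K \<subseteq> carrier P"
  shows "comm_group ((hom_group R P M)\<lparr>carrier := {f \<in> mod_hom R P M. \<forall>x\<in>K. f x = \<zero>\<^bsub>M\<^esub>}\<rparr>)"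
    (is "comm_group ?G")
proof -
  interpret P: left_module R P by fact
  interpret M: left_module R M by fact
  have K: "x \<in> carrier P" if "x \<in> K" for x using K that by auto
  have z: "(\<lambda>x\<in>carrier P. \<zero>\<^bsub>M\<^esub>) \<in> mod_hom R P M"
    by (rule mod_hom_restrictI[OF P]) auto
  show ?thesis
  proof (rule comm_groupI)
    fix f g assume f: "f \<in> carrier ?G" and g: "g \<in> carrier ?G"
    then show "f \<otimes>\<^bsub>?G\<^esub> g \<in> carrier ?G"
      using mod_hom_comb(1)[OF P M, of f g] K by (simp add: hom_group_def)
    show "f \<otimes>\<^bsub>?G\<^esub> g = g \<otimes>\<^bsub>?G\<^esub> f"
      using f g by (auto simp: hom_group_def intro!: restrict_ext M.a_comm mod_hom_closed[of _ R P M])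
  next
    fix f g h assume "f \<in> carrier ?G" "g \<in> carrier ?G" "h \<in> carrier ?G"
    then show "f \<otimes>\<^bsub>?G\<^esub> g \<otimes>\<^bsub>?G\<^esub> h = f \<otimes>\<^bsub>?G\<^esub> (g \<otimes>\<^bsub>?G\<^esub> h)"
      by (auto simp: hom_group_def intro!: restrict_ext M.a_assoc mod_hom_closed[of _ R P M])
  next
    show "\<one>\<^bsub>?G\<^esub> \<in> carrier ?G"
      using z K by (simp add: hom_group_def)
  next
    fix f assume f: "f \<in> carrier ?G"
    then have f': "f \<in> mod_hom R P M" by simp
    show "\<one>\<^bsub>?G\<^esub> \<otimes>\<^bsub>?G\<^esub> f = f"
      using mod_hom_comb(1)[OF P M z f'] mod_hom_closed[OF f']
      by (simp add: hom_group_def) (rule mod_hom_ext[OF _ f'], auto)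
    have n: "(\<lambda>x\<in>carrier P. (\<lambda>x\<in>carrier P. \<zero>\<^bsub>M\<^esub>) x \<ominus>\<^bsub>M\<^esub> f x) \<in> carrier ?G"
      using mod_hom_comb(2)[OF P M z f'] f K by (simp add: a_minus_def)
    show "\<exists>g\<in>carrier ?G. g \<otimes>\<^bsub>?G\<^esub> f = \<one>\<^bsub>?G\<^esub>"
      by (rule bexI[OF _ n])
         (use mod_hom_closed[OF f'] in \<open>auto simp: hom_group_def a_minus_def M.l_neg intro!: restrict_ext\<close>)
  qed
qed

lemma mod_hom_lincomb:
  assumes "left_module R M" "X \<subseteq> carrier M"
  shows "restrict (lincomb R M) (carrier (free_module R X)) \<in> mod_hom R (free_module R X) M"
  unfolding lincomb_eq by (rule family_lincomb_hom[OF assms(1)]) (use assms(2) in auto)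

text \<open>Each x in H is the image of its own unit vector. This is exactness of the standard
  resolution: the free module on the elements of a kernel maps onto that kernel.\<close>

lemma lincomb_image:
  assumes M: "left_module R M" and H: "submodule H R M"
  shows "lincomb R M ` carrier (free_module R H) = H"
proof -
  interpret left_module R M by fact
  have HM: "H \<subseteq> carrier M" by (rule submodule_subset[OF H])
  have "lincomb R M (unit_vec R x) = x" if "x \<in> H" for x
    unfolding lincomb_eq by (rule family_lincomb_unit_vec[OF M _ that]) (use HM in auto)
  then have "restrict (lincomb R M) (carrier (free_module R H)) (unit_vec R x) = x" if "x \<in> H" for x
    using that unit_vec_closed[OF R.ring_axioms that] by simp
  then have "restrict (lincomb R M) (carrier (free_module R H)) ` unit_vec R ` H = H"
    unfolding image_image by simp
  moreover have "mod_span R M H = H"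
    using mod_span_least[OF H subset_refl] mod_span_superset[of H R M] by auto
  ultimately show ?thesis
    using free_hom_image_eq_span(1)[OF M mod_hom_lincomb[OF M HM]] by simp
qed

lemma relations_submodule:
  assumes M: "left_module R M" and X: "X \<subseteq> carrier M"
  shows "submodule (relations R M X) R (free_module R X)"
proof -
  interpret left_module R M by fact
  have "relations R M X = {v \<in> carrier (free_module R X). restrict (lincomb R M) (carrier (free_module R X)) v = \<zero>\<^bsub>M\<^esub>}"
    by (auto simp: relations_def)
  then show ?thesis
    using mod_hom_ker[OF left_module_free[OF R.ring_axioms] M mod_hom_lincomb[OF M X]] by simp
qed

text \<open>Cocycles on P1 vanish on the kernel of d : P1 -> P0, so they are the homomorphisms from
  its image K0, composed with d. Coboundaries are those whose factor is a restriction from P0. Hence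
  Ext^1 is Hom(K0, M) modulo restrictions, and it is trivial iff every homomorphism on K0
  extends.\<close>

lemma trivial_Ext1_iff:
  assumes F: "left_module R F" and M: "left_module R M"
  shows "trivial_group (Ext1 R F M) \<longleftrightarrow>
    extendable R (free_module R (carrier F)) (relations R F (carrier F)) M"
proof -
  interpret F: left_module R F by fact
  interpret M: left_module R M by fact
  define K0 where "K0 = relations R F (carrier F)"
  define P0 where "P0 = free_module R (carrier F)"
  define K1 where "K1 = relations R P0 K0"
  define P1 where "P1 = free_module R K0"
  define P2 where "P2 = free_module R K1"
  define Z where "Z = {f \<in> mod_hom R P1 M. \<forall>w\<in>carrier P2. f (lincomb R P1 w) = \<zero>\<^bsub>M\<^esub>}"
  define B where "B = (\<lambda>g. \<lambda>v\<in>carrier P1. g (lincomb R P0 v)) ` mod_hom R P0 M"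
  have P0: "left_module R P0" and P1: "left_module R P1"
    unfolding P0_def P1_def by (rule left_module_free[OF F.R.ring_axioms])+
  have K0: "submodule K0 R P0"
    unfolding K0_def P0_def by (rule relations_submodule[OF F]) simp
  have K0P: "K0 \<subseteq> carrier P0" by (rule submodule_subset[OF K0])
  have K1: "submodule K1 R P1"
    unfolding K1_def P1_def by (rule relations_submodule[OF P0 K0P])
  define d where "d = restrict (lincomb R P0) (carrier P1)"
  have d: "d \<in> mod_hom R P1 P0"
    unfolding d_def P1_def by (rule mod_hom_lincomb[OF P0 K0P])
  have dim: "d ` carrier P1 = K0"
    using lincomb_image[OF P0 K0] by (simp add: d_def P1_def)
  have dker: "x \<in> K1 \<longleftrightarrow> x \<in> carrier P1 \<and> d x = \<zero>\<^bsub>P0\<^esub>" for x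
    by (auto simp: K1_def relations_def d_def P1_def)
  \<comment> \<open>P2 is free on the elements of K1, so its image in P1 is all of K1.\<close>
  have Z: "Z = {f \<in> mod_hom R P1 M. \<forall>x\<in>K1. f x = \<zero>\<^bsub>M\<^esub>}"
  proof -
    have im: "K1 = lincomb R P1 ` carrier P2"
      using lincomb_image[OF P1 K1] by (simp add: P2_def)
    show ?thesis
      unfolding Z_def by (simp only: im ball_simps)
  qed
  have B: "B = (\<lambda>g. compose (carrier P1) g d) ` mod_hom R P0 M"
    unfolding B_def by (intro image_cong refl) (auto simp: compose_def d_def)
  let ?G = "(hom_group R P1 M)\<lparr>carrier := Z\<rparr>"
  have G: "comm_group ?G"
    unfolding Z by (rule comm_group_hom_group_vanishing[OF P1 M submodule_subset[OF K1]])
  then interpret G: comm_group ?G .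
  have "subgroup B ?G"
  proof (rule G.subgroupI)
    show BG: "B \<subseteq> carrier ?G"
      using mod_hom_zero[OF P0 M] mod_hom_compose[OF P1 d] by (auto simp: Z B dker compose_def)
    have z: "(\<lambda>x\<in>carrier P0. \<zero>\<^bsub>M\<^esub>) \<in> mod_hom R P0 M"
      by (rule mod_hom_restrictI[OF P0]) auto
    then show "B \<noteq> {}" unfolding B by auto
    have mult: "compose (carrier P1) f d \<otimes>\<^bsub>?G\<^esub> compose (carrier P1) g d
        = compose (carrier P1) (\<lambda>x\<in>carrier P0. f x \<oplus>\<^bsub>M\<^esub> g x) d" for f g
      using mod_hom_closed[OF d] by (auto simp: hom_group_def compose_def intro!: restrict_ext)
    fix b assume "b \<in> B"
    then obtain f where f: "f \<in> mod_hom R P0 M" "b = compose (carrier P1) f d"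
      unfolding B by auto
    let ?n = "\<lambda>x\<in>carrier P0. (\<lambda>x\<in>carrier P0. \<zero>\<^bsub>M\<^esub>) x \<ominus>\<^bsub>M\<^esub> f x"
    have n: "?n \<in> mod_hom R P0 M"
      by (rule mod_hom_comb(2)[OF P0 M z f(1)])
    have "compose (carrier P1) ?n d \<otimes>\<^bsub>?G\<^esub> b = \<one>\<^bsub>?G\<^esub>"
      unfolding f(2) mult
      using mod_hom_closed[OF d] mod_hom_closed[OF f(1)]
      by (auto simp: hom_group_def compose_def a_minus_def M.l_neg intro!: restrict_ext)
    moreover have "compose (carrier P1) ?n d \<in> B" using n unfolding B by blast
    ultimately show "inv\<^bsub>?G\<^esub> b \<in> B"
      using G.inv_equality[of "compose (carrier P1) ?n d" b] subsetD[OF BG] \<open>b \<in> B\<close> by simp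
    fix c assume "c \<in> B"
    then obtain g where g: "g \<in> mod_hom R P0 M" "c = compose (carrier P1) g d"
      unfolding B by auto
    show "b \<otimes>\<^bsub>?G\<^esub> c \<in> B"
      unfolding f(2) g(2) mult unfolding B using mod_hom_comb(1)[OF P0 M f(1) g(1)] by blast
  qed
  then have "trivial_group (?G Mod B) \<longleftrightarrow> Z \<subseteq> B"
    using G.trivial_Mod_iff[of B] by simp
  moreover have "Ext1 R F M = ?G Mod B"
    by (simp add: Ext1_def Let_def K0_def P0_def K1_def P1_def P2_def Z_def B_def)
  moreover have "Z \<subseteq> B \<longleftrightarrow> extendable R P0 K0 M"
  proof
    assume ZB: "Z \<subseteq> B"
    show "extendable R P0 K0 M"
      unfolding extendable_def
    proof
      fix g assume g: "g \<in> mod_hom R (P0\<lparr>carrier := K0\<rparr>) M"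
      \<comment> \<open>Since g is defined on K0 alone, d is regarded as a map into K0 before the
        composition.\<close>
      have d': "d \<in> mod_hom R P1 (P0\<lparr>carrier := K0\<rparr>)"
        using d dim by (auto simp: mod_hom_def PiE_iff)
      have "compose (carrier P1) g d \<in> mod_hom R P1 M"
        by (rule mod_hom_compose[OF P1 d' g])
      moreover have "g \<zero>\<^bsub>P0\<^esub> = \<zero>\<^bsub>M\<^esub>"
        using mod_hom_zero[OF left_module_submodule[OF P0 K0] M g] by simp
      ultimately have "compose (carrier P1) g d \<in> Z"
        by (auto simp: Z dker compose_def)
      then obtain h where h: "h \<in> mod_hom R P0 M" "compose (carrier P1) g d = compose (carrier P1) h d"
        using ZB unfolding B by auto
      have "h x = g x" if "x \<in> K0" for x
      proof -
        obtain v where "v \<in> carrier P1" "x = d v" using \<open>x \<in> K0\<close> dim by auto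
        then show ?thesis using fun_cong[OF h(2), of v] by (simp add: compose_def)
      qed
      with h(1) show "\<exists>h\<in>mod_hom R P0 M. \<forall>x\<in>K0. h x = g x" by blast
    qed
  next
    assume ext: "extendable R P0 K0 M"
    show "Z \<subseteq> B"
    proof
      fix f assume "f \<in> Z"
      then have f: "f \<in> mod_hom R P1 M" "\<And>x. x \<in> carrier P1 \<Longrightarrow> d x = \<zero>\<^bsub>P0\<^esub> \<Longrightarrow> f x = \<zero>\<^bsub>M\<^esub>"
        by (auto simp: Z dker)
      obtain g where g: "g \<in> mod_hom R (P0\<lparr>carrier := K0\<rparr>) M" "\<And>x. x \<in> carrier P1 \<Longrightarrow> g (d x) = f x"
        using mod_hom_factor[OF P1 P0 M d f] unfolding dim by blast
      obtain h where h: "h \<in> mod_hom R P0 M" "\<And>x. x \<in> K0 \<Longrightarrow> h x = g x"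
        using ext g(1) unfolding extendable_def by blast
      have "f = compose (carrier P1) h d"
        by (rule mod_hom_ext[OF f(1) mod_hom_compose[OF P1 d h(1)]])
           (use h(2) g(2) dim in \<open>auto simp: compose_def\<close>)
      then show "f \<in> B" unfolding B using h(1) by blast
    qed
  qed
  ultimately show ?thesis by (simp add: P0_def K0_def)
qed

text \<open>
  Schanuel's argument: with lifts \<open>\<alpha>\<close>, \<open>\<beta>\<close> comparing the two presentations, \<open>g\<close> on \<open>ker p\<close> is extended
  by \<open>h \<circ> \<alpha> + g \<circ> (1 - \<beta> \<circ> \<alpha>)\<close>, where \<open>h\<close> extends \<open>g \<circ> \<beta>\<close>.
\<close>

lemma extendable_transfer:
  assumes F: "left_module R F" and M: "left_module R M"
    and p: "p \<in> mod_hom R (free_module R X) F" and q: "q \<in> mod_hom R (free_module R Y) F"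
    and im: "p ` carrier (free_module R X) = q ` carrier (free_module R Y)"
    and ext: "extendable R (free_module R Y) {v \<in> carrier (free_module R Y). q v = \<zero>\<^bsub>F\<^esub>} M"
  shows "extendable R (free_module R X) {v \<in> carrier (free_module R X). p v = \<zero>\<^bsub>F\<^esub>} M"
  unfolding extendable_def
proof
  interpret F: left_module R F by fact
  interpret M: left_module R M by fact
  note R = F.R.ring_axioms
  let ?P = "free_module R X" and ?Q = "free_module R Y"
  note P = left_module_free[OF R, of X] and Q = left_module_free[OF R, of Y]
  interpret P: left_module R ?P by (rule P)
  let ?K = "{v \<in> carrier ?P. p v = \<zero>\<^bsub>F\<^esub>}" and ?L = "{v \<in> carrier ?Q. q v = \<zero>\<^bsub>F\<^esub>}"
  fix g assume g: "g \<in> mod_hom R (?P\<lparr>carrier := ?K\<rparr>) M"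
  obtain \<alpha> where \<alpha>: "\<alpha> \<in> mod_hom R ?P ?Q" "\<And>v. v \<in> carrier ?P \<Longrightarrow> q (\<alpha> v) = p v"
    using free_hom_lift[OF R Q F p q] im by auto
  obtain \<beta> where \<beta>: "\<beta> \<in> mod_hom R ?Q ?P" "\<And>v. v \<in> carrier ?Q \<Longrightarrow> p (\<beta> v) = q v"
    using free_hom_lift[OF R P F q p] im by auto
  have K: "submodule ?K R ?P" by (rule mod_hom_ker[OF P F p])
  have L: "submodule ?L R ?Q" by (rule mod_hom_ker[OF Q F q])
  have \<beta>': "restrict \<beta> ?L \<in> mod_hom R (?Q\<lparr>carrier := ?L\<rparr>) (?P\<lparr>carrier := ?K\<rparr>)"
    using mod_hom_subdomain[OF Q L \<beta>(1)] \<beta>(2) by (auto simp: mod_hom_def)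
  have "compose ?L g (restrict \<beta> ?L) \<in> mod_hom R (?Q\<lparr>carrier := ?L\<rparr>) M"
    using mod_hom_compose[OF left_module_submodule[OF Q L] \<beta>' g] by simp
  then obtain h where h: "h \<in> mod_hom R ?Q M"
    "\<And>y. y \<in> ?L \<Longrightarrow> h y = compose ?L g (restrict \<beta> ?L) y"
    using ext unfolding extendable_def by blast
  have i: "restrict (\<lambda>x. x) (carrier ?P) \<in> mod_hom R ?P ?P"
    by (rule mod_hom_restrictI[OF P]) auto
  define e where "e = (\<lambda>x\<in>carrier ?P. restrict (\<lambda>x. x) (carrier ?P) x \<ominus>\<^bsub>?P\<^esub> compose (carrier ?P) \<beta> \<alpha> x)"
  have e: "e \<in> mod_hom R ?P ?P"
    unfolding e_def by (rule mod_hom_comb(2)[OF P P i mod_hom_compose[OF P \<alpha>(1) \<beta>(1)]])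
  have ex: "e x = x \<ominus>\<^bsub>?P\<^esub> \<beta> (\<alpha> x)" if "x \<in> carrier ?P" for x
    using that by (simp add: e_def compose_def)
  \<comment> \<open>As p \<circ> \<beta> \<circ> \<alpha> = q \<circ> \<alpha> = p, the map 1 -
    \<beta> \<circ> \<alpha> sends everything into ker p, where g is defined.\<close>
  have "p (e x) = \<zero>\<^bsub>F\<^esub>" if x: "x \<in> carrier ?P" for x
    using mod_hom_closed[OF \<alpha>(1) x] mod_hom_closed[OF \<beta>(1), of "\<alpha> x"] x mod_hom_closed[OF p x]
    by (simp add: ex mod_hom_minus[OF P F p] \<alpha> \<beta> F.M.minus_eq_zero_iff)
  then have e': "e \<in> mod_hom R ?P (?P\<lparr>carrier := ?K\<rparr>)"
    using e by (auto simp: mod_hom_def PiE_iff)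
  let ?h = "\<lambda>x\<in>carrier ?P. compose (carrier ?P) h \<alpha> x \<oplus>\<^bsub>M\<^esub> compose (carrier ?P) g e x"
  have "?h \<in> mod_hom R ?P M"
    by (rule mod_hom_comb(1)[OF P M mod_hom_compose[OF P \<alpha>(1) h(1)] mod_hom_compose[OF P e' g]])
  moreover have "?h x = g x" if x: "x \<in> ?K" for x
  proof -
    have xP: "x \<in> carrier ?P" using x by simp
    have \<alpha>x: "\<alpha> x \<in> ?L" using x \<alpha> mod_hom_closed[OF \<alpha>(1) xP] by auto
    have \<beta>x: "\<beta> (\<alpha> x) \<in> ?K" using mod_hom_closed[OF \<beta>'] \<alpha>x by auto
    \<comment> \<open>For x in ker p the element \<alpha> x lies in ker q, where h agrees with g
      \<circ> \<beta>. The two values of g then add up to g x.\<close>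
    have "?h x = g (\<beta> (\<alpha> x)) \<oplus>\<^bsub>M\<^esub> g (x \<ominus>\<^bsub>?P\<^esub> \<beta> (\<alpha> x))"
      using \<alpha>x xP by (simp add: compose_def h(2) ex)
    also have "\<dots> = g (\<beta> (\<alpha> x) \<oplus>\<^bsub>?P\<^esub> (x \<ominus>\<^bsub>?P\<^esub> \<beta> (\<alpha> x)))"
      using mod_hom_add[OF g, of "\<beta> (\<alpha> x)" "x \<ominus>\<^bsub>?P\<^esub> \<beta> (\<alpha> x)"] \<beta>x submodule_minus[OF K x \<beta>x]
      by (simp del: free_simps)
    also have "\<beta> (\<alpha> x) \<oplus>\<^bsub>?P\<^esub> (x \<ominus>\<^bsub>?P\<^esub> \<beta> (\<alpha> x)) = x"
      using xP \<beta>x by (simp del: free_simps add: a_minus_def P.M.a_lcomm P.M.r_neg)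
    finally show ?thesis .
  qed
  ultimately show "\<exists>h\<in>mod_hom R ?P M. \<forall>x\<in>?K. h x = g x" by blast
qed

text \<open>Triviality of \<open>Ext1\<close> is extendability for the presentation of F by all its
  elements; \<open>extendable_transfer\<close> exchanges this presentation for a finite one and
  back. For the direction from left to right F is the quotient of R^n by the image of p.\<close>

lemma fp_injective_iff:
  fixes R :: "('a, 'z) ring_scheme"
  assumes R: "ring R" and M: "left_module R M"
  shows "fp_injective R M \<longleftrightarrow>
    (\<forall>m n p. p \<in> mod_hom R (free_module R {..<m::nat}) (free_module R {..<n::nat}) \<longrightarrow>
      extendable R (free_module R {..<n}) (p ` carrier (free_module R {..<m})) M)"
    (is "_ \<longleftrightarrow> ?rhs")
proof -
  have rel: "relations R F (carrier F) = {v \<in> carrier (free_module R (carrier F)).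
      restrict (lincomb R F) (carrier (free_module R (carrier F))) v = \<zero>\<^bsub>F\<^esub>}" for F :: "'a fg_module"
    by (auto simp: relations_def)
  have im: "restrict (lincomb R F) (carrier (free_module R (carrier F))) ` carrier (free_module R (carrier F))
      = carrier F" if "left_module R F" for F :: "'a fg_module"
    using lincomb_image[OF that left_module.submodule_carrier[OF that]] by simp
  show ?thesis
  proof
    assume inj: "fp_injective R M"
    show ?rhs
    proof (intro allI impI)
      fix m n p assume p: "p \<in> mod_hom R (free_module R {..<m::nat}) (free_module R {..<n::nat})"
      note P = left_module_free[OF R]
      note K = mod_hom_image[OF P P p left_module.submodule_carrier[OF P]]
      let ?F = "quot_module (free_module R {..<n}) (p ` carrier (free_module R {..<m}))"
      have F: "left_module R ?F" by (rule left_module_quot[OF P K])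
      have "trivial_group (Ext1 R ?F M)"
        using inj fin_pres_quot[OF R p] unfolding fp_injective_def by blast
      then have "extendable R (free_module R (carrier ?F)) (relations R ?F (carrier ?F)) M"
        by (simp add: trivial_Ext1_iff[OF F M])
      then show "extendable R (free_module R {..<n}) (p ` carrier (free_module R {..<m})) M"
        using extendable_transfer[OF F M quot_proj_hom[OF P K] mod_hom_lincomb[OF F subset_refl]]
        unfolding rel im[OF F] quot_proj_surj[OF P K] quot_proj_ker[OF P K] by simp
    qed
  next
    assume rhs: ?rhs
    have "trivial_group (Ext1 R F M)" if fp: "fin_pres R F" for F :: "'a fg_module"
    proof -
      obtain m n p q where F: "left_module R F"
        and p: "p \<in> mod_hom R (free_module R {..<m::nat}) (free_module R {..<n::nat})"
        and q: "q \<in> mod_hom R (free_module R {..<n}) F"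
        and ker: "p ` carrier (free_module R {..<m}) = {v \<in> carrier (free_module R {..<n}). q v = \<zero>\<^bsub>F\<^esub>}"
        and surj: "q ` carrier (free_module R {..<n}) = carrier F"
        using fp unfolding fin_pres_def by auto
      have "extendable R (free_module R {..<n}) {v \<in> carrier (free_module R {..<n}). q v = \<zero>\<^bsub>F\<^esub>} M"
        using rhs p ker by metis
      then have "extendable R (free_module R (carrier F)) (relations R F (carrier F)) M"
        unfolding rel
        using extendable_transfer[OF F M mod_hom_lincomb[OF F subset_refl] q] im[OF F] surj by simp
      then show ?thesis by (simp add: trivial_Ext1_iff[OF F M])
    qed
    then show "fp_injective R M"
      unfolding fp_injective_def using M by blast
  qed
qed

definition free_fp_injective :: "('a, 'z) ring_scheme \<Rightarrow> bool" where
  "free_fp_injective R \<longleftrightarrow>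
     (\<forall>m n. \<forall>p \<in> mod_hom R (free_module R {..<m::nat}) (free_module R {..<n::nat}).
        \<forall>g \<in> mod_hom R (free_module R {..<m}) (reg_module R).
        (\<forall>v \<in> carrier (free_module R {..<m}). p v = (\<lambda>_. \<zero>\<^bsub>R\<^esub>) \<longrightarrow> g v = \<zero>\<^bsub>R\<^esub>) \<longrightarrow>
        (\<exists>h \<in> mod_hom R (free_module R {..<n}) (reg_module R).
           \<forall>v \<in> carrier (free_module R {..<m}). g v = h (p v)))"

text \<open>Functionals on the image of p correspond to functionals on R^m that vanish on ker p, by
  composition with p in one direction and \<open>mod_hom_factor\<close> in the other.\<close>

lemma fp_injective_reg_iff:
  assumes R: "ring R"
  shows "fp_injective R (reg_module R) \<longleftrightarrow> free_fp_injective R"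
proof -
  note M = left_module_reg[OF R]
  note P = left_module_free[OF R]
  have "extendable R (free_module R {..<n}) (p ` carrier (free_module R {..<m})) (reg_module R) \<longleftrightarrow>
     (\<forall>g \<in> mod_hom R (free_module R {..<m}) (reg_module R).
        (\<forall>v \<in> carrier (free_module R {..<m}). p v = (\<lambda>_. \<zero>\<^bsub>R\<^esub>) \<longrightarrow> g v = \<zero>\<^bsub>R\<^esub>) \<longrightarrow>
        (\<exists>h \<in> mod_hom R (free_module R {..<n}) (reg_module R).
           \<forall>v \<in> carrier (free_module R {..<m}). g v = h (p v)))"
    if p: "p \<in> mod_hom R (free_module R {..<m::nat}) (free_module R {..<n::nat})" for m n p
  proof (intro iffI ballI impI)
    fix g assume ext: "extendable R (free_module R {..<n}) (p ` carrier (free_module R {..<m})) (reg_module R)"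
      and g: "g \<in> mod_hom R (free_module R {..<m}) (reg_module R)"
      and 0: "\<forall>v \<in> carrier (free_module R {..<m}). p v = (\<lambda>_. \<zero>\<^bsub>R\<^esub>) \<longrightarrow> g v = \<zero>\<^bsub>R\<^esub>"
    obtain f where f: "f \<in> mod_hom R ((free_module R {..<n})\<lparr>carrier := p ` carrier (free_module R {..<m})\<rparr>) (reg_module R)"
      "\<And>x. x \<in> carrier (free_module R {..<m}) \<Longrightarrow> f (p x) = g x"
      using mod_hom_factor[OF P P M p g] 0 by auto
    obtain h where "h \<in> mod_hom R (free_module R {..<n}) (reg_module R)"
      "\<forall>x \<in> p ` carrier (free_module R {..<m}). h x = f x"
      using ext f(1) unfolding extendable_def by blast
    then show "\<exists>h \<in> mod_hom R (free_module R {..<n}) (reg_module R).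
           \<forall>v \<in> carrier (free_module R {..<m}). g v = h (p v)"
      using f(2) by (intro bexI[of _ h]) auto
  next
    assume *: "\<forall>g \<in> mod_hom R (free_module R {..<m}) (reg_module R).
        (\<forall>v \<in> carrier (free_module R {..<m}). p v = (\<lambda>_. \<zero>\<^bsub>R\<^esub>) \<longrightarrow> g v = \<zero>\<^bsub>R\<^esub>) \<longrightarrow>
        (\<exists>h \<in> mod_hom R (free_module R {..<n}) (reg_module R).
           \<forall>v \<in> carrier (free_module R {..<m}). g v = h (p v))"
    note K = mod_hom_image[OF P P p left_module.submodule_carrier[OF P]]
    show "extendable R (free_module R {..<n}) (p ` carrier (free_module R {..<m})) (reg_module R)"
      unfolding extendable_def
    proof
      let ?I = "(free_module R {..<n})\<lparr>carrier := p ` carrier (free_module R {..<m})\<rparr>"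
      fix g assume g: "g \<in> mod_hom R ?I (reg_module R)"
      have p': "p \<in> mod_hom R (free_module R {..<m}) ?I"
        using p by (auto simp: mod_hom_def PiE_iff)
      have "compose (carrier (free_module R {..<m})) g p \<in> mod_hom R (free_module R {..<m}) (reg_module R)"
        by (rule mod_hom_compose[OF P p' g])
      moreover have "g (\<lambda>_. \<zero>\<^bsub>R\<^esub>) = \<zero>\<^bsub>R\<^esub>"
        using mod_hom_zero[OF left_module_submodule[OF P K] M g] by simp
      ultimately obtain h where "h \<in> mod_hom R (free_module R {..<n}) (reg_module R)"
        "\<forall>v \<in> carrier (free_module R {..<m}). compose (carrier (free_module R {..<m})) g p v = h (p v)"
        using * by (force simp: compose_def)
      then show "\<exists>h\<in>mod_hom R (free_module R {..<n}) (reg_module R).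
          \<forall>x\<in>p ` carrier (free_module R {..<m}). h x = g x"
        by (intro bexI[of _ h]) (auto simp: compose_def)
    qed
  qed
  then show ?thesis
    unfolding fp_injective_iff[OF R M] free_fp_injective_def by (intro iff_allI) blast
qed

subsection \<open>Torsionless modules and coherence\<close>

definition torsionless :: "('a, 'z) ring_scheme \<Rightarrow> ('a, 'b) module \<Rightarrow> bool" where
  "torsionless R M \<longleftrightarrow>
     (\<forall>x\<in>carrier M. x \<noteq> \<zero>\<^bsub>M\<^esub> \<longrightarrow> (\<exists>h\<in>mod_hom R M (reg_module R). h x \<noteq> \<zero>\<^bsub>R\<^esub>))"

text \<open>To separate x from zero, the cogenerator property is applied to the inclusion of the
  cyclic submodule R x into N: a functional that is nonzero somewhere on R x is nonzero at x.
  Conversely a functional that is nonzero at some value f x detects f.\<close>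

lemma fp_cogenerator_reg_iff:
  fixes R :: "('a, 'z) ring_scheme"
  assumes R: "ring R"
  shows "fp_cogenerator R (reg_module R) \<longleftrightarrow>
    (\<forall>N :: 'a fg_module. fin_pres R N \<longrightarrow> torsionless R N)"
proof (intro iffI allI impI)
  fix N :: "'a fg_module"
  assume cog: "fp_cogenerator R (reg_module R)" and N: "fin_pres R N"
  interpret left_module R N using N by (simp add: fin_pres_def)
  note NM = left_module_axioms
  show "torsionless R N"
    unfolding torsionless_def
  proof (intro ballI impI)
    fix x assume x: "x \<in> carrier N" "x \<noteq> \<zero>\<^bsub>N\<^esub>"
    have X: "{x} \<subseteq> carrier N" using x by simp
    let ?S = "mod_span R N {x}"
    let ?M = "N\<lparr>carrier := ?S\<rparr>"
    note S = mod_span_submodule[OF NM X]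
    have xS: "x \<in> ?S" using mod_span_superset[of "{x}"] by auto
    define i where "i = restrict (\<lambda>x. x) (carrier N)"
    have i: "i \<in> mod_hom R N N"
      unfolding i_def by (rule mod_hom_restrictI[OF NM]) auto
    have M: "left_module R ?M" by (rule left_module_submodule[OF NM S])
    \<comment> \<open>Spans are taken in an ambient module, so generation of R x by x within the
      module R x has to be deduced from the span taken in N.\<close>
    have "submodule H R ?M \<Longrightarrow> submodule H R N" for H
      using submodule_subset[OF S] submodule_subset[of H R ?M] submodule_zero[of H R ?M]
        submodule_add[of H R ?M] submodule_smult[of H R ?M]
      by (intro submoduleI) auto
    then have "?S \<subseteq> mod_span R ?M {x}"
      by (auto simp: mod_span_def)
    moreover have "mod_span R ?M {x} \<subseteq> ?S"
      using submodule_subset[OF mod_span_submodule[OF M, of "{x}"]] xS by simp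
    ultimately have "fin_gen R ?M"
      unfolding fin_gen_def fg_submodule_def using M xS by (intro conjI exI[of _ "{x}"]) auto
    moreover have "restrict i ?S \<in> mod_hom R ?M N"
      by (rule mod_hom_subdomain[OF NM S i])
    moreover have "\<exists>y\<in>carrier ?M. restrict i ?S y \<noteq> \<zero>\<^bsub>N\<^esub>"
      using x xS by (intro bexI[of _ x]) (auto simp: i_def)
    ultimately obtain g where g: "g \<in> mod_hom R N (reg_module R)"
      "\<exists>y\<in>?S. g (restrict i ?S y) \<noteq> \<zero>\<^bsub>R\<^esub>"
      using cog[unfolded fp_cogenerator_def, THEN conjunct2, rule_format, of "restrict i ?S" ?M N] N
      by auto
    have "g x \<noteq> \<zero>\<^bsub>R\<^esub>"
    proof
      assume "g x = \<zero>\<^bsub>R\<^esub>"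
      then have "?S \<subseteq> {y \<in> carrier N. g y = \<zero>\<^bsub>reg_module R\<^esub>}"
        using x by (intro mod_span_least mod_hom_ker[OF NM left_module_reg[OF R] g(1)]) auto
      then show False using g(2) by (auto simp: i_def)
    qed
    with g(1) show "\<exists>h\<in>mod_hom R N (reg_module R). h x \<noteq> \<zero>\<^bsub>R\<^esub>" by blast
  qed
next
  assume tl: "\<forall>N :: 'a fg_module. fin_pres R N \<longrightarrow> torsionless R N"
  show "fp_cogenerator R (reg_module R)"
    unfolding fp_cogenerator_def
  proof (intro conjI allI ballI impI left_module_reg[OF R])
    fix M N :: "'a fg_module" and f
    assume f: "f \<in> mod_hom R M N"
      and *: "fin_gen R M \<and> fin_pres R N \<and> (\<exists>x\<in>carrier M. f x \<noteq> \<zero>\<^bsub>N\<^esub>)"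
    then obtain x where "x \<in> carrier M" "f x \<noteq> \<zero>\<^bsub>N\<^esub>" by blast
    then show "\<exists>g\<in>mod_hom R N (reg_module R). \<exists>x\<in>carrier M. g (f x) \<noteq> \<zero>\<^bsub>reg_module R\<^esub>"
      using tl * mod_hom_closed[OF f] unfolding torsionless_def by fastforce
  qed
qed

text \<open>An exact sequence R^m -> R^n -> M -> 0 together with the adjoint \<open>p'\<close> of
  its relation map. Through \<open>adj\<close>, functionals on M become vectors w with
  \<open>p' w\<close> zero, and questions about M become questions about the matrix
  \<open>p'\<close> over the opposite ring.\<close>

locale presentation =
  fixes R :: "('a, 'z) ring_scheme" and M :: "('a, 'b) module" and m n :: nat and p q p'
  assumes R: "ring R" and M: "left_module R M"
    and p: "p \<in> mod_hom R (free_module R {..<m}) (free_module R {..<n})"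
    and q: "q \<in> mod_hom R (free_module R {..<n}) M"
    and q_ker: "p ` carrier (free_module R {..<m}) = {v \<in> carrier (free_module R {..<n}). q v = \<zero>\<^bsub>M\<^esub>}"
    and q_surj: "q ` carrier (free_module R {..<n}) = carrier M"
    and p': "p' \<in> mod_hom (opp R) (free_module (opp R) {..<n}) (free_module (opp R) {..<m})"
    and adj: "\<And>v w. v \<in> carrier (free_module R {..<m}) \<Longrightarrow> w \<in> carrier (free_module R {..<n})
      \<Longrightarrow> dot R n (p v) w = dot R m v (p' w)"

lemma fin_pres_presentation:
  assumes "fin_pres R M"
  obtains m n p q p' where "presentation R M m n p q p'"
proof -
  obtain m n p q where M: "left_module R M"
    and p: "p \<in> mod_hom R (free_module R {..<m::nat}) (free_module R {..<n::nat})"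
    and q: "q \<in> mod_hom R (free_module R {..<n}) M"
      "p ` carrier (free_module R {..<m}) = {v \<in> carrier (free_module R {..<n}). q v = \<zero>\<^bsub>M\<^esub>}"
      "q ` carrier (free_module R {..<n}) = carrier M"
    using assms unfolding fin_pres_def by auto
  interpret left_module R M by fact
  obtain p' where "p' \<in> mod_hom (opp R) (free_module (opp R) {..<n}) (free_module (opp R) {..<m})"
    "\<And>v w. v \<in> carrier (free_module R {..<m}) \<Longrightarrow> w \<in> carrier (free_module R {..<n})
      \<Longrightarrow> dot R n (p v) w = dot R m v (p' w)"
    using adjoint[OF R.ring_axioms p] by blast
  then show ?thesis
    using that[of m n p q p'] M p q R.ring_axioms by (simp add: presentation_def)
qed

context presentation
begin

lemma q_closed: "v \<in> carrier (free_module R {..<n}) \<Longrightarrow> q v \<in> carrier M"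
  by (rule mod_hom_closed[OF q])

lemma carrier_imp_q: "x \<in> carrier M \<Longrightarrow> \<exists>v\<in>carrier (free_module R {..<n}). x = q v"
  using q_surj by auto

lemma p_closed: "v \<in> carrier (free_module R {..<m}) \<Longrightarrow> p v \<in> carrier (free_module R {..<n})"
  by (rule mod_hom_closed[OF p])

lemma q_p: "v \<in> carrier (free_module R {..<m}) \<Longrightarrow> q (p v) = \<zero>\<^bsub>M\<^esub>"
  using q_ker by blast

lemma p'_closed: "w \<in> carrier (free_module R {..<n}) \<Longrightarrow> p' w \<in> carrier (free_module R {..<m})"
  using mod_hom_closed[OF p'] by simp

text \<open>Pairing with w kills im p = ker q, since the pairing of p u with w is that of u with
  \<open>p' w\<close>; hence it descends to M.\<close>

lemma functional_of_vector:
  assumes w: "w \<in> carrier (free_module R {..<n})" "p' w = (\<lambda>_. \<zero>\<^bsub>R\<^esub>)"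
  obtains h where "h \<in> mod_hom R M (reg_module R)"
    and "\<And>v. v \<in> carrier (free_module R {..<n}) \<Longrightarrow> h (q v) = dot R n v w"
proof -
  note P = left_module_free[OF R, of "{..<n}"]
  have "dot R n v w = \<zero>\<^bsub>R\<^esub>" if v: "v \<in> carrier (free_module R {..<n})" "q v = \<zero>\<^bsub>M\<^esub>" for v
  proof -
    obtain u where "u \<in> carrier (free_module R {..<m})" "v = p u"
      using v q_ker by blast
    then show ?thesis using adj[of u w] w dot_zero[OF R, of u m] by simp
  qed
  then show ?thesis
    using mod_hom_factor_surj[OF P M left_module_reg[OF R] q q_surj dot_hom[OF R w(1)]] that
    by auto
qed

text \<open>The functional h \<circ> q on R^n is the pairing with some w. Every u pairs with
  \<open>p' w\<close> to h (q (p u)) = 0, so \<open>p' w\<close> is zero by nondegeneracy.\<close>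

lemma vector_of_functional:
  assumes h: "h \<in> mod_hom R M (reg_module R)"
  obtains w where "w \<in> carrier (free_module R {..<n})" "p' w = (\<lambda>_. \<zero>\<^bsub>R\<^esub>)"
    and "\<And>v. v \<in> carrier (free_module R {..<n}) \<Longrightarrow> h (q v) = dot R n v w"
proof -
  note P = left_module_free[OF R, of "{..<n}"]
  have "compose (carrier (free_module R {..<n})) h q \<in> mod_hom R (free_module R {..<n}) (reg_module R)"
    by (rule mod_hom_compose[OF P q h])
  then obtain w where w: "w \<in> carrier (free_module R {..<n})"
    "\<And>v. v \<in> carrier (free_module R {..<n}) \<Longrightarrow> compose (carrier (free_module R {..<n})) h q v = dot R n v w"
    using free_hom_reg[OF R] by blast
  have "p' w = (\<lambda>_. \<zero>\<^bsub>R\<^esub>)"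
  proof (rule dot_right_eqI[OF R p'_closed[OF w(1)]])
    show "(\<lambda>_. \<zero>\<^bsub>R\<^esub>) \<in> carrier (free_module R {..<m})"
      using left_module.submodule_carrier[OF left_module_free[OF R]] submodule_zero by fastforce
    fix v assume v: "v \<in> carrier (free_module R {..<m})"
    have "dot R m v (p' w) = h (q (p v))"
      using adj[OF v w(1)] w(2)[OF p_closed[OF v]] p_closed[OF v] by (simp add: compose_def)
    then show "dot R m v (p' w) = dot R m v (\<lambda>_. \<zero>\<^bsub>R\<^esub>)"
      using q_p[OF v] mod_hom_zero[OF M left_module_reg[OF R] h] dot_zero[OF R v] by simp
  qed
  then show ?thesis
    using that[OF w(1)] w(2) by (simp add: compose_def)
qed

text \<open>Suppose all functionals vanish at q y. Then pairing with y is a functional on the right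
  module R^n that vanishes on the kernel of \<open>p'\<close>. By FP-injectivity on the right it
  factors through \<open>p'\<close>, and this places y in the image of p.\<close>

lemma torsionless:
  assumes inj: "free_fp_injective (opp R)"
  shows "torsionless R M"
  unfolding torsionless_def
proof (intro ballI impI)
  fix x assume x: "x \<in> carrier M" "x \<noteq> \<zero>\<^bsub>M\<^esub>"
  then obtain y where y: "y \<in> carrier (free_module R {..<n})" "x = q y"
    using carrier_imp_q by blast
  note T = ring_opp[OF R]
  let ?g = "\<lambda>w\<in>carrier (free_module R {..<n}). dot R n y w"
  have "\<exists>w. w \<in> carrier (free_module R {..<n}) \<and> p' w = (\<lambda>_. \<zero>\<^bsub>R\<^esub>) \<and> dot R n y w \<noteq> \<zero>\<^bsub>R\<^esub>"
  proof (rule ccontr)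
    assume "\<not> ?thesis"
    then obtain h where h: "h \<in> mod_hom (opp R) (free_module (opp R) {..<m}) (reg_module (opp R))"
      "\<And>w. w \<in> carrier (free_module R {..<n}) \<Longrightarrow> dot R n y w = h (p' w)"
      using inj[unfolded free_fp_injective_def, rule_format, OF p' dot_hom_opp[OF R y(1)]]
      by (auto cong: ball_cong)
    obtain d where d: "d \<in> carrier (free_module R {..<m})"
      "\<And>v. v \<in> carrier (free_module R {..<m}) \<Longrightarrow> h v = dot R m d v"
      using free_hom_reg[OF T h(1)] by (auto simp: dot_opp)
    \<comment> \<open>Pairing y with w gives h (\<open>p' w\<close>), that is d paired with
      \<open>p' w\<close>, that is p d paired with w; this holds for every w.\<close>
    have "y = p d"
      by (rule dot_left_eqI[OF R y(1) p_closed[OF d(1)]]) (simp add: h(2) d p'_closed adj)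
    then show False using x y(2) q_p[OF d(1)] by simp
  qed
  then obtain w where w: "w \<in> carrier (free_module R {..<n})" "p' w = (\<lambda>_. \<zero>\<^bsub>R\<^esub>)" "dot R n y w \<noteq> \<zero>\<^bsub>R\<^esub>"
    by blast
  obtain h where "h \<in> mod_hom R M (reg_module R)"
    "\<And>v. v \<in> carrier (free_module R {..<n}) \<Longrightarrow> h (q v) = dot R n v w"
    using functional_of_vector[OF w(1,2)] by blast
  then show "\<exists>h\<in>mod_hom R M (reg_module R). h x \<noteq> \<zero>\<^bsub>R\<^esub>"
    using w(3) y by (intro bexI[of _ h]) auto
qed

end

text \<open>The functional g is the pairing with a vector y, and a factorization through p amounts
  to y = \<open>p' d\<close> for the adjoint \<open>p'\<close>. So the class of y in the cokernel N
  of \<open>p'\<close> has to vanish. A functional on N is represented by a vector v with p v = 0,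
  and its value at the class of y is g v = 0; as N is torsionless, the class is zero.\<close>

lemma free_fp_injective_opp_if_torsionless:
  fixes R :: "('a, 'z) ring_scheme"
  assumes R: "ring R" and tl: "\<And>N :: 'a fg_module. fin_pres R N \<Longrightarrow> torsionless R N"
  shows "free_fp_injective (opp R)"
  unfolding free_fp_injective_def
proof (intro allI ballI impI)
  let ?T = "opp R"
  note T = ring_opp[OF R]
  fix m n p g
  assume p: "p \<in> mod_hom ?T (free_module ?T {..<m::nat}) (free_module ?T {..<n::nat})"
    and g: "g \<in> mod_hom ?T (free_module ?T {..<m}) (reg_module ?T)"
    and ker: "\<forall>v\<in>carrier (free_module ?T {..<m}). p v = (\<lambda>_. \<zero>\<^bsub>?T\<^esub>) \<longrightarrow> g v = \<zero>\<^bsub>?T\<^esub>"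
  obtain y where y: "y \<in> carrier (free_module R {..<m})"
    "\<And>v. v \<in> carrier (free_module R {..<m}) \<Longrightarrow> g v = dot ?T m v y"
    using free_hom_reg[OF T g] by auto
  obtain p' where p': "p' \<in> mod_hom R (free_module R {..<n}) (free_module R {..<m})"
    and adj: "\<And>v w. v \<in> carrier (free_module R {..<m}) \<Longrightarrow> w \<in> carrier (free_module R {..<n})
      \<Longrightarrow> dot ?T n (p v) w = dot ?T m v (p' w)"
    using adjoint[OF T p] by auto
  note P = left_module_free[OF R]
  note K = mod_hom_image[OF P P p' left_module.submodule_carrier[OF P]]
  let ?K = "p' ` carrier (free_module R {..<n})"
  let ?N = "quot_module (free_module R {..<m}) ?K"
  define c where "c = restrict (coset_of (free_module R {..<m}) ?K) (carrier (free_module R {..<m}))"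
  have N: "left_module R ?N" by (rule left_module_quot[OF P K])
  have c: "c \<in> mod_hom R (free_module R {..<m}) ?N"
    unfolding c_def by (rule quot_proj_hom[OF P K])
  have cker: "{v \<in> carrier (free_module R {..<m}). c v = \<zero>\<^bsub>?N\<^esub>} = ?K"
    unfolding c_def by (rule quot_proj_ker[OF P K])
  have "torsionless R ?N" by (rule tl[OF fin_pres_quot[OF R p']])
  have "c y = \<zero>\<^bsub>?N\<^esub>"
  proof (rule ccontr)
    assume "c y \<noteq> \<zero>\<^bsub>?N\<^esub>"
    then obtain t where t: "t \<in> mod_hom R ?N (reg_module R)" "t (c y) \<noteq> \<zero>\<^bsub>R\<^esub>"
      using \<open>torsionless R ?N\<close> mod_hom_closed[OF c y(1)] unfolding torsionless_def by blast
    obtain v where v: "v \<in> carrier (free_module R {..<m})"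
      "\<And>u. u \<in> carrier (free_module R {..<m}) \<Longrightarrow>
         compose (carrier (free_module R {..<m})) t c u = dot R m u v"
      using free_hom_reg[OF R mod_hom_compose[OF P c t(1)]] by blast
    have tv: "t (c u) = dot ?T m v u" if "u \<in> carrier (free_module R {..<m})" for u
      using v(2)[OF that] that by (simp add: compose_def dot_opp)
    have pv: "p v \<in> carrier (free_module R {..<n})"
      using mod_hom_closed[OF p, of v] v(1) by simp
    have "p v = (\<lambda>_. \<zero>\<^bsub>R\<^esub>)"
    proof (rule dot_left_eqI[OF T])
      show "(\<lambda>_. \<zero>\<^bsub>R\<^esub>) \<in> carrier (free_module ?T {..<n})"
        using submodule_zero[OF left_module.submodule_carrier[OF P[of "{..<n}"]]] by simp
      fix w assume w: "w \<in> carrier (free_module ?T {..<n})"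
      then have w': "w \<in> carrier (free_module R {..<n})" by simp
      have "p' w \<in> ?K" using w' by blast
      then have "c (p' w) = \<zero>\<^bsub>?N\<^esub>" "p' w \<in> carrier (free_module R {..<m})"
        using cker by blast+
      then have "dot ?T m v (p' w) = \<zero>\<^bsub>R\<^esub>"
        using tv[of "p' w"] mod_hom_zero[OF N left_module_reg[OF R] t(1)] by simp
      then show "dot ?T n (p v) w = dot ?T n (\<lambda>_. \<zero>\<^bsub>R\<^esub>) w"
        using adj[OF v(1) w'] dot_zero(2)[OF T w] by simp
    qed (use pv in simp)
    then have "g v = \<zero>\<^bsub>R\<^esub>" using ker v(1) by simp
    then show False using t(2) tv[OF y(1)] y(2)[OF v(1)] by simp
  qed
  then obtain d where d: "d \<in> carrier (free_module R {..<n})" "y = p' d"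
    using cker y(1) by blast
  have d': "d \<in> carrier (free_module ?T {..<n})" using d by simp
  show "\<exists>h\<in>mod_hom ?T (free_module ?T {..<n}) (reg_module ?T).
      \<forall>v\<in>carrier (free_module ?T {..<m}). g v = h (p v)"
    by (rule bexI[OF _ dot_hom[OF T d']])
       (use y d adj mod_hom_closed[OF p] in auto)
qed

lemma fin_pres_torsionless_iff:
  fixes R :: "('a, 'z) ring_scheme"
  assumes R: "ring R"
  shows "(\<forall>N :: 'a fg_module. fin_pres R N \<longrightarrow> torsionless R N) \<longleftrightarrow> free_fp_injective (opp R)"
  using free_fp_injective_opp_if_torsionless[OF R] presentation.torsionless fin_pres_presentation
  by metis

section \<open>Coherence: kernels of maps between finite free modules are finitely generated\<close>

lemma mod_hom_codomain_mono:
  "f \<in> mod_hom R P (M\<lparr>carrier := K\<rparr>) \<Longrightarrow> K \<subseteq> carrier M \<Longrightarrow> f \<in> mod_hom R P M"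
  by (auto simp: mod_hom_def PiE_iff)

text \<open>Coherence provides some finite presentation of the image I of h, with generators q : R^b
  -> I, but not one that uses h. As in Schanuel's lemma, lifts \<alpha> : R^b -> R^n and \<beta> :
  R^n -> R^b between the two covers of I transport finite generation of ker q to ker h.\<close>

lemma left_coherent_ker_functional:
  assumes coh: "left_coherent R" and h: "h \<in> mod_hom R (free_module R {..<n::nat}) (reg_module R)"
  shows "fg_submodule R (free_module R {..<n}) {v \<in> carrier (free_module R {..<n}). h v = \<zero>\<^bsub>R\<^esub>}"
proof -
  have R: "ring R" using coh by (simp add: left_coherent_def)
  note P = left_module_free[OF R] and G = left_module_reg[OF R]
  let ?I = "h ` carrier (free_module R {..<n})"
  have "fg_left_ideal R ?I"
    by (rule fg_submodule_image_free[OF G _ h]) simp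
  then have "fin_pres R ((reg_module R)\<lparr>carrier := ?I\<rparr>)"
    using coh by (simp add: left_coherent_def)
  then obtain a b p q where p: "p \<in> mod_hom R (free_module R {..<a::nat}) (free_module R {..<b::nat})"
    and q': "q \<in> mod_hom R (free_module R {..<b}) ((reg_module R)\<lparr>carrier := ?I\<rparr>)"
    and ker: "p ` carrier (free_module R {..<a}) = {v \<in> carrier (free_module R {..<b}). q v = \<zero>\<^bsub>R\<^esub>}"
    and im: "q ` carrier (free_module R {..<b}) = ?I"
    unfolding fin_pres_def by auto
  have q: "q \<in> mod_hom R (free_module R {..<b}) (reg_module R)"
    by (rule mod_hom_codomain_mono[OF q']) (use mod_hom_closed[OF h] in auto)
  let ?P = "free_module R {..<n}" and ?Q = "free_module R {..<b}"
  interpret P: left_module R ?P by (rule P)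
  obtain \<alpha> where \<alpha>: "\<alpha> \<in> mod_hom R ?Q ?P" "\<And>v. v \<in> carrier ?Q \<Longrightarrow> h (\<alpha> v) = q v"
    using free_hom_lift[OF R P G q h] im by auto
  obtain \<beta> where \<beta>: "\<beta> \<in> mod_hom R ?P ?Q" "\<And>v. v \<in> carrier ?P \<Longrightarrow> q (\<beta> v) = h v"
    using free_hom_lift[OF R P G h q] im by auto
  have i: "restrict (\<lambda>x. x) (carrier ?P) \<in> mod_hom R ?P ?P"
    by (rule mod_hom_restrictI[OF P]) auto
  define e where "e = (\<lambda>x\<in>carrier ?P. restrict (\<lambda>x. x) (carrier ?P) x \<ominus>\<^bsub>?P\<^esub> compose (carrier ?P) \<alpha> \<beta> x)"
  have e: "e \<in> mod_hom R ?P ?P"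
    unfolding e_def by (rule mod_hom_comb(2)[OF P P i mod_hom_compose[OF P \<beta>(1) \<alpha>(1)]])
  have ex: "e x = x \<ominus>\<^bsub>?P\<^esub> \<alpha> (\<beta> x)" if "x \<in> carrier ?P" for x
    using that by (simp add: e_def compose_def)
  have ab: "\<alpha> (\<beta> x) \<in> carrier ?P" if "x \<in> carrier ?P" for x
    using that mod_hom_closed[OF \<alpha>(1)] mod_hom_closed[OF \<beta>(1)] by blast
  have he: "h (e x) = \<zero>\<^bsub>R\<^esub>" if x: "x \<in> carrier ?P" for x
    using mod_hom_minus[OF P G h x ab[OF x]] \<alpha>(2)[OF mod_hom_closed[OF \<beta>(1) x]] \<beta>(2)[OF x]
      mod_hom_closed[OF h x] left_module.axioms(2)[OF G]
      abelian_group.minus_eq_zero_iff[of "reg_module R" "h x" "h x"]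
    by (simp add: ex[OF x])
  let ?A = "compose (carrier (free_module R {..<a})) \<alpha> p"
  have A: "?A \<in> mod_hom R (free_module R {..<a}) ?P"
    by (rule mod_hom_compose[OF P p \<alpha>(1)])
  have Ax: "?A u = \<alpha> (p u)" "h (?A u) = \<zero>\<^bsub>R\<^esub>" if u: "u \<in> carrier (free_module R {..<a})" for u
  proof -
    show 1: "?A u = \<alpha> (p u)" using u by (simp add: compose_def)
    have "p u \<in> {v \<in> carrier ?Q. q v = \<zero>\<^bsub>R\<^esub>}" using ker u by blast
    then show "h (?A u) = \<zero>\<^bsub>R\<^esub>" using \<alpha>(2) unfolding 1 by simp
  qed
  \<comment> \<open>Write x = \<alpha> (\<beta> x) + e x with e = 1 - \<alpha> \<circ> \<beta>. For
    x in ker h the element \<beta> x lies in ker q = im p, so ker h is the sum of the images of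
    \<alpha> \<circ> p and of e.\<close>
  have "{v \<in> carrier ?P. h v = \<zero>\<^bsub>R\<^esub>}
      = {x \<oplus>\<^bsub>?P\<^esub> y |x y. x \<in> ?A ` carrier (free_module R {..<a}) \<and> y \<in> e ` carrier ?P}"
  proof (intro equalityI subsetI)
    fix x assume "x \<in> {v \<in> carrier ?P. h v = \<zero>\<^bsub>R\<^esub>}"
    then have x: "x \<in> carrier ?P" "h x = \<zero>\<^bsub>R\<^esub>" by auto
    then have "\<beta> x \<in> {v \<in> carrier ?Q. q v = \<zero>\<^bsub>R\<^esub>}"
      using \<beta>(2)[OF x(1)] mod_hom_closed[OF \<beta>(1) x(1)] by simp
    then obtain u where u: "u \<in> carrier (free_module R {..<a})" "\<beta> x = p u"
      using ker by blast
    have "x = ?A u \<oplus>\<^bsub>?P\<^esub> e x"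
      using x(1) ab[OF x(1)]
      by (simp add: Ax(1)[OF u(1)] u(2)[symmetric] ex a_minus_def P.M.a_lcomm P.M.r_neg del: free_simps)
    then show "x \<in> {x \<oplus>\<^bsub>?P\<^esub> y |x y. x \<in> ?A ` carrier (free_module R {..<a}) \<and> y \<in> e ` carrier ?P}"
      using u(1) x(1) by blast
  next
    fix x assume "x \<in> {x \<oplus>\<^bsub>?P\<^esub> y |x y. x \<in> ?A ` carrier (free_module R {..<a}) \<and> y \<in> e ` carrier ?P}"
    then obtain u y where *: "x = ?A u \<oplus>\<^bsub>?P\<^esub> e y" "u \<in> carrier (free_module R {..<a})" "y \<in> carrier ?P"
      by blast
    have "h x = \<zero>\<^bsub>reg_module R\<^esub>" "x \<in> carrier ?P"
      unfolding *(1)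
      using mod_hom_add[OF h mod_hom_closed[OF A *(2)] mod_hom_closed[OF e *(3)]] Ax(2)[OF *(2)] he[OF *(3)]
        P.M.a_closed[OF mod_hom_closed[OF A *(2)] mod_hom_closed[OF e *(3)]] R
      by (simp_all add: ring.ring_simprules del: free_simps)
    then show "x \<in> {v \<in> carrier ?P. h v = \<zero>\<^bsub>R\<^esub>}" by simp
  qed
  then show ?thesis
    using fg_submodule_sum[OF P fg_submodule_image_free[OF P _ A] fg_submodule_image_free[OF P _ e]]
    by simp
qed

text \<open>The kernel of the last functional is the image of some b : R^k -> R^n. The remaining
  functionals are pulled back along b, and the finitely generated common kernel found in R^k is
  pushed forward again. The rank changes at each step, hence the generalization over n and
  h.\<close>

lemma left_coherent_ker_functionals:
  assumes coh: "left_coherent R"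
    and "\<And>j. j < m \<Longrightarrow> h j \<in> mod_hom R (free_module R {..<n::nat}) (reg_module R)"
  shows "fg_submodule R (free_module R {..<n}) {v \<in> carrier (free_module R {..<n}). \<forall>j<m::nat. h j v = \<zero>\<^bsub>R\<^esub>}"
  using assms(2)
proof (induct m arbitrary: h n)
  have R: "ring R" using coh by (simp add: left_coherent_def)
  note P = left_module_free[OF R]
  case 0
  show ?case using fg_submodule_carrier_free[OF R, of "{..<n}"] by simp
next
  have R: "ring R" using coh by (simp add: left_coherent_def)
  note P = left_module_free[OF R]
  case (Suc m)
  obtain k b where b: "b \<in> mod_hom R (free_module R {..<k::nat}) (free_module R {..<n})"
    "{v \<in> carrier (free_module R {..<n}). h m v = \<zero>\<^bsub>R\<^esub>} = b ` carrier (free_module R {..<k})"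
    using left_coherent_ker_functional[OF coh Suc(2)[of m]] unfolding fg_submodule_iff[OF P] by blast
  let ?C = "\<lambda>j. compose (carrier (free_module R {..<k})) (h j) b"
  have "fg_submodule R (free_module R {..<k}) {v \<in> carrier (free_module R {..<k}). \<forall>j<m. ?C j v = \<zero>\<^bsub>R\<^esub>}"
    by (rule Suc(1), rule mod_hom_compose[OF P b(1)], rule Suc(2)) simp
  from fg_submodule_image[OF P P b(1) this]
  show ?case
  proof (rule back_subst[of "fg_submodule R (free_module R {..<n})"], intro equalityI subsetI)
    fix v assume "v \<in> b ` {v \<in> carrier (free_module R {..<k}). \<forall>j<m. ?C j v = \<zero>\<^bsub>R\<^esub>}"
    then show "v \<in> {v \<in> carrier (free_module R {..<n}). \<forall>j<Suc m. h j v = \<zero>\<^bsub>R\<^esub>}"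
      using b(2) by (auto simp: compose_def less_Suc_eq)
  next
    fix v assume "v \<in> {v \<in> carrier (free_module R {..<n}). \<forall>j<Suc m. h j v = \<zero>\<^bsub>R\<^esub>}"
    moreover from this obtain u where "u \<in> carrier (free_module R {..<k})" "v = b u"
      using b(2) by fastforce
    ultimately show "v \<in> b ` {v \<in> carrier (free_module R {..<k}). \<forall>j<m. ?C j v = \<zero>\<^bsub>R\<^esub>}"
      by (auto simp: compose_def)
  qed
qed

text \<open>The kernel of p is the common kernel of its m coordinate functionals.\<close>

lemma left_coherent_ker:
  assumes coh: "left_coherent R"
    and p: "p \<in> mod_hom R (free_module R {..<n::nat}) (free_module R {..<m::nat})"
  obtains k b where "b \<in> mod_hom R (free_module R {..<k::nat}) (free_module R {..<n})"
    and "b ` carrier (free_module R {..<k}) = {v \<in> carrier (free_module R {..<n}). p v = (\<lambda>_. \<zero>\<^bsub>R\<^esub>)}"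
proof -
  have R: "ring R" using coh by (simp add: left_coherent_def)
  note P = left_module_free[OF R]
  have pc: "p v j \<in> carrier R" if "v \<in> carrier (free_module R {..<n})" for v j
    using free_closed[OF R mod_hom_closed[OF p that]] .
  have "(\<lambda>v\<in>carrier (free_module R {..<n}). p v j) \<in> mod_hom R (free_module R {..<n}) (reg_module R)" for j
    by (rule mod_hom_restrictI[OF P])
       (auto simp: pc mod_hom_add[OF p, simplified] mod_hom_smult[OF p, simplified])
  then have "fg_submodule R (free_module R {..<n})
      {v \<in> carrier (free_module R {..<n}). \<forall>j<m. (\<lambda>v\<in>carrier (free_module R {..<n}). p v j) v = \<zero>\<^bsub>R\<^esub>}"
    by (intro left_coherent_ker_functionals[OF coh])
  moreover have "(\<forall>j<m. p v j = \<zero>\<^bsub>R\<^esub>) \<longleftrightarrow> p v = (\<lambda>_. \<zero>\<^bsub>R\<^esub>)" if "v \<in> carrier (free_module R {..<n})" for v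
    using mod_hom_closed[OF p that] by (auto simp: free_carrier fun_eq_iff)
  ultimately have "fg_submodule R (free_module R {..<n})
      {v \<in> carrier (free_module R {..<n}). p v = (\<lambda>_. \<zero>\<^bsub>R\<^esub>)}"
    by (simp cong: conj_cong)
  then show ?thesis
    unfolding fg_submodule_iff[OF P] using that by blast
qed

subsection \<open>Duals of finitely presented modules\<close>

lemma dual_simps [simp]:
  "carrier (dual R M) = mod_hom R M (reg_module R)"
  "\<zero>\<^bsub>dual R M\<^esub> = (\<lambda>x\<in>carrier M. \<zero>\<^bsub>R\<^esub>)"
  "f \<oplus>\<^bsub>dual R M\<^esub> g = (\<lambda>x\<in>carrier M. f x \<oplus>\<^bsub>R\<^esub> g x)"
  "r \<odot>\<^bsub>dual R M\<^esub> f = (\<lambda>x\<in>carrier M. f x \<otimes>\<^bsub>R\<^esub> r)"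
  by (simp_all add: dual_def)

lemma left_module_dual:
  assumes M: "left_module R M" shows "left_module (opp R) (dual R M)"
proof -
  interpret left_module R M by fact
  note G = left_module_reg[OF R.ring_axioms]
  have c: "f x \<in> carrier R" if "f \<in> mod_hom R M (reg_module R)" "x \<in> carrier M" for f x
    using mod_hom_closed[OF that] by simp
  have e: "(\<lambda>x\<in>carrier M. f x) = f" if "f \<in> mod_hom R M (reg_module R)" for f
    using that by (auto simp: mod_hom_def PiE_def extensional_restrict)
  show ?thesis
  proof (rule left_moduleI[OF ring_opp[OF R.ring_axioms]])
    fix f g assume f: "f \<in> carrier (dual R M)" and g: "g \<in> carrier (dual R M)"
    show "f \<oplus>\<^bsub>dual R M\<^esub> g \<in> carrier (dual R M)"
      using mod_hom_comb(1)[OF M G, of f g] f g by simp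
    show "f \<oplus>\<^bsub>dual R M\<^esub> g = g \<oplus>\<^bsub>dual R M\<^esub> f"
      using f g by (auto simp: c R.a_comm intro!: restrict_ext)
    fix r assume "r \<in> carrier (opp R)"
    then show "r \<odot>\<^bsub>dual R M\<^esub> (f \<oplus>\<^bsub>dual R M\<^esub> g) = r \<odot>\<^bsub>dual R M\<^esub> f \<oplus>\<^bsub>dual R M\<^esub> r \<odot>\<^bsub>dual R M\<^esub> g"
      using f g by (auto simp: c R.l_distr intro!: restrict_ext)
  next
    show "\<zero>\<^bsub>dual R M\<^esub> \<in> carrier (dual R M)"
      by simp (rule mod_hom_restrictI[OF M], auto)
  next
    fix f g h assume "f \<in> carrier (dual R M)" "g \<in> carrier (dual R M)" "h \<in> carrier (dual R M)"
    then show "f \<oplus>\<^bsub>dual R M\<^esub> g \<oplus>\<^bsub>dual R M\<^esub> h = f \<oplus>\<^bsub>dual R M\<^esub> (g \<oplus>\<^bsub>dual R M\<^esub> h)"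
      by (auto simp: c R.a_assoc intro!: restrict_ext)
  next
    fix f assume "f \<in> carrier (dual R M)"
    then have f: "f \<in> mod_hom R M (reg_module R)" by simp
    show "\<zero>\<^bsub>dual R M\<^esub> \<oplus>\<^bsub>dual R M\<^esub> f = f" "\<one>\<^bsub>opp R\<^esub> \<odot>\<^bsub>dual R M\<^esub> f = f"
        "\<zero>\<^bsub>opp R\<^esub> \<odot>\<^bsub>dual R M\<^esub> f = \<zero>\<^bsub>dual R M\<^esub>"
      using c[OF f] e[OF f] by (simp_all cong: restrict_cong)
    fix r assume r: "r \<in> carrier (opp R)"
    have "(\<lambda>x\<in>carrier M. f x \<otimes>\<^bsub>R\<^esub> r) \<in> mod_hom R M (reg_module R)"
      by (rule mod_hom_restrictI[OF M])
         (use r c[OF f] in \<open>auto simp: mod_hom_add[OF f] mod_hom_smult[OF f] R.l_distr R.m_assoc\<close>)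
    then show "r \<odot>\<^bsub>dual R M\<^esub> f \<in> carrier (dual R M)" by simp
    fix s assume s: "s \<in> carrier (opp R)"
    show "(r \<oplus>\<^bsub>opp R\<^esub> s) \<odot>\<^bsub>dual R M\<^esub> f = r \<odot>\<^bsub>dual R M\<^esub> f \<oplus>\<^bsub>dual R M\<^esub> s \<odot>\<^bsub>dual R M\<^esub> f"
      "(r \<otimes>\<^bsub>opp R\<^esub> s) \<odot>\<^bsub>dual R M\<^esub> f = r \<odot>\<^bsub>dual R M\<^esub> (s \<odot>\<^bsub>dual R M\<^esub> f)"
      using r s c[OF f] by (auto simp: R.r_distr R.m_assoc intro!: restrict_ext)
  qed
qed

lemma bidual_simps [simp]:
  "carrier (bidual R M) = mod_hom (opp R) (dual R M) (reg_module (opp R))"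
  "\<zero>\<^bsub>bidual R M\<^esub> = (\<lambda>x\<in>carrier (dual R M). \<zero>\<^bsub>R\<^esub>)"
  "f \<oplus>\<^bsub>bidual R M\<^esub> g = (\<lambda>x\<in>carrier (dual R M). f x \<oplus>\<^bsub>R\<^esub> g x)"
  "r \<odot>\<^bsub>bidual R M\<^esub> f = (\<lambda>x\<in>carrier (dual R M). r \<otimes>\<^bsub>R\<^esub> f x)"
  by (simp_all add: bidual_def)

lemma left_module_bidual: "left_module R M \<Longrightarrow> left_module R (bidual R M)"
  using left_module_dual[OF left_module_dual, of R M] by (simp add: bidual_def)

lemma evaluation_hom:
  assumes M: "left_module R M"
  shows "(\<lambda>x\<in>carrier M. \<lambda>h\<in>carrier (dual R M). h x) \<in> mod_hom R M (bidual R M)"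
proof (rule mod_hom_restrictI[OF M])
  interpret left_module R M by fact
  fix x assume x: "x \<in> carrier M"
  have "(\<lambda>h\<in>carrier (dual R M). h x) \<in> mod_hom (opp R) (dual R M) (reg_module (opp R))"
    by (rule mod_hom_restrictI[OF left_module_dual[OF M]])
       (use x in \<open>auto dest: mod_hom_closed\<close>)
  then show "(\<lambda>h\<in>carrier (dual R M). h x) \<in> carrier (bidual R M)" by simp
qed (auto simp: mod_hom_add mod_hom_smult intro!: restrict_ext)

context presentation
begin

text \<open>The map b covers the kernel of \<open>p'\<close> by coherence on the right, and
  \<open>\<delta> w\<close> is the functional on M represented by the vector b w. Since b and
  \<delta> have the same kernel, and \<delta> is onto the dual, this records the isomorphism of the
  dual with the kernel of \<open>p'\<close> in terms of a finite cover.\<close>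

lemma dual_cover:
  assumes coh: "left_coherent (opp R)"
  obtains k b \<delta> where "b \<in> mod_hom (opp R) (free_module (opp R) {..<k::nat}) (free_module (opp R) {..<n})"
    and "b ` carrier (free_module R {..<k}) = {w \<in> carrier (free_module R {..<n}). p' w = (\<lambda>_. \<zero>\<^bsub>R\<^esub>)}"
    and "\<delta> \<in> mod_hom (opp R) (free_module (opp R) {..<k}) (dual R M)"
    and "\<delta> ` carrier (free_module R {..<k}) = carrier (dual R M)"
    and "\<forall>v \<in> carrier (free_module R {..<n}). \<forall>w \<in> carrier (free_module R {..<k}).
      \<delta> w (q v) = dot R n v (b w)"
    and "\<forall>w \<in> carrier (free_module R {..<k}). b w = (\<lambda>_. \<zero>\<^bsub>R\<^esub>) \<longleftrightarrow> \<delta> w = \<zero>\<^bsub>dual R M\<^esub>"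
proof -
  let ?T = "opp R"
  note T = ring_opp[OF R]
  obtain k b where b: "b \<in> mod_hom ?T (free_module ?T {..<k::nat}) (free_module ?T {..<n})"
    "b ` carrier (free_module R {..<k}) = {w \<in> carrier (free_module R {..<n}). p' w = (\<lambda>_. \<zero>\<^bsub>R\<^esub>)}"
    by (rule left_coherent_ker[OF coh p', unfolded free_opp opp_simps])
  have bc: "b w \<in> carrier (free_module R {..<n})" if "w \<in> carrier (free_module R {..<k})" for w
    using mod_hom_closed[OF b(1)] that by simp
  have "\<forall>w\<in>carrier (free_module R {..<k}). \<exists>h. h \<in> mod_hom R M (reg_module R)
      \<and> (\<forall>v\<in>carrier (free_module R {..<n}). h (q v) = dot R n v (b w))"
  proof
    fix w assume "w \<in> carrier (free_module R {..<k})"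
    then have "b w \<in> {w \<in> carrier (free_module R {..<n}). p' w = (\<lambda>_. \<zero>\<^bsub>R\<^esub>)}"
      using b(2) by blast
    then have bw: "b w \<in> carrier (free_module R {..<n})" "p' (b w) = (\<lambda>_. \<zero>\<^bsub>R\<^esub>)" by auto
    obtain h where "h \<in> mod_hom R M (reg_module R)"
      "\<And>v. v \<in> carrier (free_module R {..<n}) \<Longrightarrow> h (q v) = dot R n v (b w)"
      by (rule functional_of_vector[OF bw]) (rule that, auto)
    then show "\<exists>h. h \<in> mod_hom R M (reg_module R)
      \<and> (\<forall>v\<in>carrier (free_module R {..<n}). h (q v) = dot R n v (b w))" by blast
  qed
  then have "\<exists>d. \<forall>w\<in>carrier (free_module R {..<k}). d w \<in> mod_hom R M (reg_module R)
      \<and> (\<forall>v\<in>carrier (free_module R {..<n}). d w (q v) = dot R n v (b w))"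
    by (rule bchoice)
  then obtain d where d: "\<And>w. w \<in> carrier (free_module R {..<k}) \<Longrightarrow> d w \<in> mod_hom R M (reg_module R)"
    "\<And>v w. v \<in> carrier (free_module R {..<n}) \<Longrightarrow> w \<in> carrier (free_module R {..<k})
      \<Longrightarrow> d w (q v) = dot R n v (b w)"
    by blast
  \<comment> \<open>A functional on M is determined by its values on all q v, so identities between
    functionals are checked through the pairing.\<close>
  have eqI: "f = g" if "f \<in> mod_hom R M (reg_module R)" "g \<in> mod_hom R M (reg_module R)"
    "\<And>v. v \<in> carrier (free_module R {..<n}) \<Longrightarrow> f (q v) = g (q v)" for f g
    by (rule mod_hom_ext[OF that(1,2)]) (use that(3) carrier_imp_q in metis)
  note P' = left_module_free[OF T]
  interpret P': left_module ?T "free_module ?T {..<k}" by (rule P')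
  interpret D: left_module ?T "dual R M" by (rule left_module_dual[OF M])
  let ?\<delta> = "restrict d (carrier (free_module ?T {..<k}))"
  have "?\<delta> \<in> mod_hom ?T (free_module ?T {..<k}) (dual R M)"
  proof (rule mod_hom_restrictI[OF P'])
    fix u w assume u': "u \<in> carrier (free_module ?T {..<k})" and w': "w \<in> carrier (free_module ?T {..<k})"
    then have u: "u \<in> carrier (free_module R {..<k})" and w: "w \<in> carrier (free_module R {..<k})" by auto
    note s = P'.M.a_closed[OF u' w', unfolded free_opp]
    show "d (u \<oplus>\<^bsub>free_module ?T {..<k}\<^esub> w) = d u \<oplus>\<^bsub>dual R M\<^esub> d w"
    proof (rule eqI)
      show "d u \<oplus>\<^bsub>dual R M\<^esub> d w \<in> mod_hom R M (reg_module R)"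
        using D.M.a_closed[of "d u" "d w"] d(1) u w by simp
      fix v assume v: "v \<in> carrier (free_module R {..<n})"
      show "d (u \<oplus>\<^bsub>free_module ?T {..<k}\<^esub> w) (q v) = (d u \<oplus>\<^bsub>dual R M\<^esub> d w) (q v)"
        unfolding d(2)[OF v s] mod_hom_add[OF b(1) u' w']
        using v q_closed[OF v] d(2)[OF v u] d(2)[OF v w] dot_add_right[OF R v bc[OF u] bc[OF w]] by simp
    qed (rule d(1)[OF s])
  next
    fix r w assume r: "r \<in> carrier ?T" and w': "w \<in> carrier (free_module ?T {..<k})"
    then have w: "w \<in> carrier (free_module R {..<k})" by auto
    note s = P'.smult_closed[OF r w', unfolded free_opp]
    show "d (r \<odot>\<^bsub>free_module ?T {..<k}\<^esub> w) = r \<odot>\<^bsub>dual R M\<^esub> d w"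
    proof (rule eqI)
      show "r \<odot>\<^bsub>dual R M\<^esub> d w \<in> mod_hom R M (reg_module R)"
        using D.smult_closed[of r "d w"] d(1) r w by simp
      fix v assume v: "v \<in> carrier (free_module R {..<n})"
      show "d (r \<odot>\<^bsub>free_module ?T {..<k}\<^esub> w) (q v) = (r \<odot>\<^bsub>dual R M\<^esub> d w) (q v)"
        unfolding d(2)[OF v s] mod_hom_smult[OF b(1) r w']
        using v r q_closed[OF v] d(2)[OF v w] dot_smult_right[OF R _ v bc[OF w], of r] by simp
    qed (rule d(1)[OF s])
  qed (use d(1) in simp)
  moreover have "?\<delta> ` carrier (free_module R {..<k}) = carrier (dual R M)"
  proof (intro equalityI subsetI)
    fix h assume "h \<in> carrier (dual R M)"
    then have h: "h \<in> mod_hom R M (reg_module R)" by simp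
    then obtain w where w: "w \<in> carrier (free_module R {..<n})" "p' w = (\<lambda>_. \<zero>\<^bsub>R\<^esub>)"
      "\<And>v. v \<in> carrier (free_module R {..<n}) \<Longrightarrow> h (q v) = dot R n v w"
      using vector_of_functional by blast
    then obtain u where u: "u \<in> carrier (free_module R {..<k})" "w = b u" using b(2) by blast
    have "h = d u"
      by (rule eqI[OF h d(1)[OF u(1)]]) (use w u d(2) in simp)
    then show "h \<in> ?\<delta> ` carrier (free_module R {..<k})" using u(1) by auto
  qed (use d(1) in auto)
  moreover have "b w = (\<lambda>_. \<zero>\<^bsub>R\<^esub>) \<longleftrightarrow> ?\<delta> w = \<zero>\<^bsub>dual R M\<^esub>"
    if w: "w \<in> carrier (free_module R {..<k})" for w
  proof
    assume 0: "b w = (\<lambda>_. \<zero>\<^bsub>R\<^esub>)"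
    have "d w = \<zero>\<^bsub>dual R M\<^esub>"
    proof (rule eqI[OF d(1)[OF w]])
      show "\<zero>\<^bsub>dual R M\<^esub> \<in> mod_hom R M (reg_module R)"
        using D.M.zero_closed by simp
      show "d w (q v) = \<zero>\<^bsub>dual R M\<^esub> (q v)" if "v \<in> carrier (free_module R {..<n})" for v
        using d(2)[OF that w] 0 dot_zero[OF R that] q_closed[OF that] by simp
    qed
    then show "?\<delta> w = \<zero>\<^bsub>dual R M\<^esub>" using w by simp
  next
    assume 0: "?\<delta> w = \<zero>\<^bsub>dual R M\<^esub>"
    show "b w = (\<lambda>_. \<zero>\<^bsub>R\<^esub>)"
    proof (rule dot_right_eqI[OF R bc[OF w]])
      show "(\<lambda>_. \<zero>\<^bsub>R\<^esub>) \<in> carrier (free_module R {..<n})"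
        using submodule_zero[OF left_module.submodule_carrier[OF left_module_free[OF R, of "{..<n}"]]] by simp
      show "dot R n v (b w) = dot R n v (\<lambda>_. \<zero>\<^bsub>R\<^esub>)" if v: "v \<in> carrier (free_module R {..<n})" for v
        using d(2)[OF v w] 0 w dot_zero[OF R v] q_closed[OF v] by simp
    qed
  qed
  ultimately show ?thesis
    by (intro that[OF b, of ?\<delta>]) (use d(2) in simp_all)
qed

text \<open>The generators of the dual come from \<open>dual_cover\<close>; their relations form the
  kernel of b, which is finitely generated by a second use of coherence.\<close>

lemma fin_pres_dual:
  assumes coh: "left_coherent (opp R)"
  shows "fin_pres (opp R) (dual R M)"
proof -
  let ?T = "opp R"
  obtain k b \<delta> where b: "b \<in> mod_hom ?T (free_module ?T {..<k::nat}) (free_module ?T {..<n})"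
    and "b ` carrier (free_module R {..<k}) = {w \<in> carrier (free_module R {..<n}). p' w = (\<lambda>_. \<zero>\<^bsub>R\<^esub>)}"
    and \<delta>: "\<delta> \<in> mod_hom ?T (free_module ?T {..<k}) (dual R M)"
      "\<delta> ` carrier (free_module R {..<k}) = carrier (dual R M)"
    and \<delta>b: "\<forall>v \<in> carrier (free_module R {..<n}). \<forall>w \<in> carrier (free_module R {..<k}).
      \<delta> w (q v) = dot R n v (b w)"
    and ker: "\<forall>w \<in> carrier (free_module R {..<k}). b w = (\<lambda>_. \<zero>\<^bsub>R\<^esub>) \<longleftrightarrow> \<delta> w = \<zero>\<^bsub>dual R M\<^esub>"
    by (rule dual_cover[OF coh])
  obtain l c where c: "c \<in> mod_hom ?T (free_module ?T {..<l::nat}) (free_module ?T {..<k})"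
    "c ` carrier (free_module ?T {..<l}) = {w \<in> carrier (free_module ?T {..<k}). b w = (\<lambda>_. \<zero>\<^bsub>?T\<^esub>)}"
    by (rule left_coherent_ker[OF coh b])
  have "c ` carrier (free_module ?T {..<l}) = {w \<in> carrier (free_module ?T {..<k}). \<delta> w = \<zero>\<^bsub>dual R M\<^esub>}"
    unfolding c(2) using ker by (auto simp del: dual_simps)
  then show ?thesis
    unfolding fin_pres_def using c(1) \<delta>
    by (intro conjI left_module_dual[OF M] exI[of _ l] exI[of _ k] exI[of _ c] exI[of _ \<delta>])
       (simp_all del: dual_simps)
qed

text \<open>The evaluation map is injective because M is torsionless. For surjectivity, let \<phi>
  be a functional on the dual. Then \<phi> \<circ> \<delta> vanishes on ker \<delta> = ker b, so
  FP-injectivity factors it through b as a functional on R^n, that is, as the pairing with some y.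
  The value \<open>dot R n y (b w)\<close> is that of \<open>\<delta> w\<close> at q y, so \<phi> is
  evaluation at q y.\<close>

lemma reflexive:
  assumes coh: "left_coherent (opp R)" and inj: "free_fp_injective (opp R)"
  shows "reflexive_module R M"
proof -
  let ?T = "opp R"
  note T = ring_opp[OF R]
  let ?ev = "\<lambda>x\<in>carrier M. \<lambda>h\<in>carrier (dual R M). h x"
  interpret M: left_module R M by (rule M)
  note G = left_module_reg[OF R]
  obtain k b \<delta> where b: "b \<in> mod_hom ?T (free_module ?T {..<k::nat}) (free_module ?T {..<n})"
    and "b ` carrier (free_module R {..<k}) = {w \<in> carrier (free_module R {..<n}). p' w = (\<lambda>_. \<zero>\<^bsub>R\<^esub>)}"
    and \<delta>: "\<delta> \<in> mod_hom ?T (free_module ?T {..<k}) (dual R M)"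
      "\<delta> ` carrier (free_module R {..<k}) = carrier (dual R M)"
    and \<delta>b: "\<forall>v \<in> carrier (free_module R {..<n}). \<forall>w \<in> carrier (free_module R {..<k}).
      \<delta> w (q v) = dot R n v (b w)"
    and ker: "\<forall>w \<in> carrier (free_module R {..<k}). b w = (\<lambda>_. \<zero>\<^bsub>R\<^esub>) \<longleftrightarrow> \<delta> w = \<zero>\<^bsub>dual R M\<^esub>"
    by (rule dual_cover[OF coh])
  have evc: "?ev x \<in> carrier (bidual R M)" if "x \<in> carrier M" for x
    by (rule mod_hom_closed[OF evaluation_hom[OF M] that])
  have "inj_on ?ev (carrier M)"
  proof (rule inj_onI, rule ccontr)
    fix x y assume x: "x \<in> carrier M" and y: "y \<in> carrier M" and eq: "?ev x = ?ev y" and "x \<noteq> y"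
    then have "x \<ominus>\<^bsub>M\<^esub> y \<noteq> \<zero>\<^bsub>M\<^esub>" by (simp add: M.M.minus_eq_zero_iff)
    then obtain h where h: "h \<in> mod_hom R M (reg_module R)" "h (x \<ominus>\<^bsub>M\<^esub> y) \<noteq> \<zero>\<^bsub>R\<^esub>"
      using torsionless[OF inj] x y unfolding torsionless_def by auto
    have "h x = h y" using fun_cong[OF eq, of h] x y h(1) by simp
    then show False
      using h(2) mod_hom_minus[OF M G h(1) x y] mod_hom_closed[OF h(1) y]
        abelian_group.minus_eq_zero_iff[OF left_module.axioms(2)[OF G], of "h y" "h y"] by simp
  qed
  moreover have "?ev ` carrier M = carrier (bidual R M)"
  proof (intro equalityI subsetI)
    fix \<phi> assume \<phi>': "\<phi> \<in> carrier (bidual R M)"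
    then have \<phi>: "\<phi> \<in> mod_hom ?T (dual R M) (reg_module ?T)" by simp
    let ?g = "compose (carrier (free_module ?T {..<k})) \<phi> \<delta>"
    have g: "?g \<in> mod_hom ?T (free_module ?T {..<k}) (reg_module ?T)"
      by (rule mod_hom_compose[OF left_module_free[OF T] \<delta>(1) \<phi>])
    have "\<forall>w\<in>carrier (free_module ?T {..<k}). b w = (\<lambda>_. \<zero>\<^bsub>?T\<^esub>) \<longrightarrow> ?g w = \<zero>\<^bsub>?T\<^esub>"
    proof (intro ballI impI)
      fix w assume w: "w \<in> carrier (free_module ?T {..<k})" and 0: "b w = (\<lambda>_. \<zero>\<^bsub>?T\<^esub>)"
      have "\<delta> w = \<zero>\<^bsub>dual R M\<^esub>"
        using ker w 0 by (simp del: dual_simps)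
      then show "?g w = \<zero>\<^bsub>?T\<^esub>"
        using w mod_hom_zero[OF left_module_dual[OF M] left_module_reg[OF T] \<phi>] by (simp add: compose_def)
    qed
    then obtain h where h: "h \<in> mod_hom ?T (free_module ?T {..<n}) (reg_module ?T)"
      "\<forall>w\<in>carrier (free_module ?T {..<k}). ?g w = h (b w)"
      using inj[unfolded free_fp_injective_def, rule_format, OF b g] by blast
    obtain y where y: "y \<in> carrier (free_module R {..<n})"
      "\<And>w. w \<in> carrier (free_module R {..<n}) \<Longrightarrow> h w = dot R n y w"
      using free_hom_reg[OF T h(1)] by (auto simp: dot_opp)
    have "\<phi> f = ?ev (q y) f" if f: "f \<in> carrier (dual R M)" for f
    proof -
      obtain w where w: "w \<in> carrier (free_module R {..<k})" "f = \<delta> w" using f \<delta>(2) by blast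
      have "\<phi> f = ?g w" using w by (simp add: compose_def)
      also have "\<dots> = h (b w)" using h(2) w(1) by simp
      also have "\<dots> = dot R n y (b w)" using y(2) mod_hom_closed[OF b, of w] w(1) by simp
      also have "\<dots> = f (q y)" using \<delta>b[rule_format, OF y(1) w(1)] w(2) by simp
      finally show ?thesis using f q_closed[OF y(1)] by simp
    qed
    moreover have "?ev (q y) \<in> mod_hom ?T (dual R M) (reg_module ?T)"
      using evc[OF q_closed[OF y(1)]] by simp
    ultimately have "\<phi> = ?ev (q y)"
      using mod_hom_ext[OF \<phi>] by blast
    then show "\<phi> \<in> ?ev ` carrier M"
      by (rule image_eqI) (rule q_closed[OF y(1)])
  qed (use evc in blast)
  ultimately show ?thesis
    unfolding reflexive_module_def mod_iso_def bij_betw_def using M evaluation_hom[OF M] by blast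
qed

text \<open>The columns of b are k vectors that generate the functionals on M, and the adjoint
  \<open>b'\<close> lists their values: \<open>b' v\<close> is zero iff every functional vanishes at
  q v. For torsionless M this means q v = 0, so \<open>b'\<close> induces an injection of M into
  R^k.\<close>

lemma embeds_in_free:
  assumes coh: "left_coherent (opp R)" and tl: "torsionless R M"
  shows "embeds_in_free R M"
proof -
  let ?T = "opp R"
  note T = ring_opp[OF R]
  interpret M: left_module R M by (rule M)
  note P = left_module_free[OF R]
  obtain k b where b: "b \<in> mod_hom ?T (free_module ?T {..<k::nat}) (free_module ?T {..<n})"
    "b ` carrier (free_module R {..<k}) = {w \<in> carrier (free_module R {..<n}). p' w = (\<lambda>_. \<zero>\<^bsub>R\<^esub>)}"
    by (rule left_coherent_ker[OF coh p', unfolded free_opp opp_simps])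
  obtain b' where b': "b' \<in> mod_hom R (free_module R {..<n}) (free_module R {..<k})"
    and adjb: "\<And>w v. w \<in> carrier (free_module R {..<k}) \<Longrightarrow> v \<in> carrier (free_module R {..<n})
      \<Longrightarrow> dot ?T n (b w) v = dot ?T k w (b' v)"
    using adjoint[OF T b(1)] by auto
  \<comment> \<open>The index type prescribed by \<open>embeds_in_free\<close> is a product with
    \<open>nat\<close>. The set X is a copy of \<open>{..<k}\<close> in it with a dummy first
    component, and \<iota> renames the coordinates.\<close>
  define X where "X = Pair (undefined :: 'b) ` {..<k}"
  define \<iota> where "\<iota> = (\<lambda>v\<in>carrier (free_module R {..<k}). \<lambda>z. if z \<in> X then v (snd z) else \<zero>\<^bsub>R\<^esub>)"
  have finX: "finite X" by (simp add: X_def)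
  interpret R: ring R by (rule R)
  have \<iota>: "\<iota> \<in> mod_hom R (free_module R {..<k}) (free_module R X)"
    unfolding \<iota>_def
    by (rule mod_hom_restrictI[OF P]) (auto simp: free_finite_carrier[OF finX] free_closed[OF R])
  let ?g = "compose (carrier (free_module R {..<n})) \<iota> b'"
  have b'c: "b' v \<in> carrier (free_module R {..<k})" if "v \<in> carrier (free_module R {..<n})" for v
    by (rule mod_hom_closed[OF b' that])
  have g0: "?g v = (\<lambda>_. \<zero>\<^bsub>R\<^esub>) \<longleftrightarrow> b' v = (\<lambda>_. \<zero>\<^bsub>R\<^esub>)" if v: "v \<in> carrier (free_module R {..<n})" for v
  proof
    assume 0: "?g v = (\<lambda>_. \<zero>\<^bsub>R\<^esub>)"
    have "b' v i = \<zero>\<^bsub>R\<^esub>" for i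
    proof (cases "i < k")
      case True
      then show ?thesis
        using fun_cong[OF 0, of "(undefined, i)"] v b'c[OF v] by (simp add: compose_def \<iota>_def X_def)
    qed (use b'c[OF v] in \<open>auto simp: free_carrier\<close>)
    then show "b' v = (\<lambda>_. \<zero>\<^bsub>R\<^esub>)" by auto
  qed (use v b'c[OF v] in \<open>auto simp: compose_def \<iota>_def\<close>)
  have ker: "b' v = (\<lambda>_. \<zero>\<^bsub>R\<^esub>) \<longleftrightarrow> q v = \<zero>\<^bsub>M\<^esub>" if v: "v \<in> carrier (free_module R {..<n})" for v
  proof
    assume 0: "b' v = (\<lambda>_. \<zero>\<^bsub>R\<^esub>)"
    show "q v = \<zero>\<^bsub>M\<^esub>"
    proof (rule ccontr)
      assume "q v \<noteq> \<zero>\<^bsub>M\<^esub>"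
      then obtain h where h: "h \<in> mod_hom R M (reg_module R)" "h (q v) \<noteq> \<zero>\<^bsub>R\<^esub>"
        using tl q_closed[OF v] unfolding torsionless_def by blast
      obtain w where w: "w \<in> carrier (free_module R {..<n})" "p' w = (\<lambda>_. \<zero>\<^bsub>R\<^esub>)"
        "h (q v) = dot R n v w"
        using vector_of_functional[OF h(1)] v by metis
      obtain u where "u \<in> carrier (free_module R {..<k})" "w = b u" using b(2) w(1,2) by blast
      then show False
        using adjb[of u v] v 0 h(2) w(3) dot_zero(1)[OF T, of u k] by (simp add: dot_opp)
    qed
  next
    assume "q v = \<zero>\<^bsub>M\<^esub>"
    then obtain u where u: "u \<in> carrier (free_module R {..<m})" "v = p u" using v q_ker by blast
    show "b' v = (\<lambda>_. \<zero>\<^bsub>R\<^esub>)"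
    proof (rule dot_right_eqI[OF T])
      show "(\<lambda>_. \<zero>\<^bsub>R\<^esub>) \<in> carrier (free_module ?T {..<k})"
        using submodule_zero[OF left_module.submodule_carrier[OF P[of "{..<k}"]]] by simp
      fix w assume w': "w \<in> carrier (free_module ?T {..<k})"
      then have w: "w \<in> carrier (free_module R {..<k})" by simp
      have "b w \<in> {w \<in> carrier (free_module R {..<n}). p' w = (\<lambda>_. \<zero>\<^bsub>R\<^esub>)}"
        using b(2) w by blast
      then have "dot ?T n (b w) v = \<zero>\<^bsub>R\<^esub>"
        using adj[OF u(1), of "b w"] u(2) dot_zero[OF R u(1)] by (simp add: dot_opp)
      then show "dot ?T k w (b' v) = dot ?T k w (\<lambda>_. \<zero>\<^bsub>R\<^esub>)"
        using adjb[OF w v] dot_zero(1)[OF T w'] by simp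
    qed (use b'c[OF v] in simp)
  qed
  have g: "?g \<in> mod_hom R (free_module R {..<n}) (free_module R X)"
    by (rule mod_hom_compose[OF P b' \<iota>])
  have gker: "?g v = \<zero>\<^bsub>free_module R X\<^esub>" if "v \<in> carrier (free_module R {..<n})" "q v = \<zero>\<^bsub>M\<^esub>" for v
    using g0[OF that(1)] ker[OF that(1)] that(2) by simp
  obtain f where f: "f \<in> mod_hom R M (free_module R X)"
    "\<And>v. v \<in> carrier (free_module R {..<n}) \<Longrightarrow> f (q v) = ?g v"
    by (rule mod_hom_factor_surj[OF P M P q q_surj g], rule gker, assumption+) (rule that, auto)
  have "inj_on f (carrier M)"
  proof (rule inj_onI)
    fix x y assume x: "x \<in> carrier M" and y: "y \<in> carrier M" and "f x = f y"
    then have "f (x \<ominus>\<^bsub>M\<^esub> y) = \<zero>\<^bsub>free_module R X\<^esub>"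
      using mod_hom_minus[OF M P f(1) x y] mod_hom_closed[OF f(1) y]
        abelian_group.minus_eq_zero_iff[OF left_module.axioms(2)[OF P[of X]], of "f y" "f y"] by simp
    moreover obtain v where v: "v \<in> carrier (free_module R {..<n})" "x \<ominus>\<^bsub>M\<^esub> y = q v"
      using carrier_imp_q[of "x \<ominus>\<^bsub>M\<^esub> y"] x y by auto
    ultimately have "x \<ominus>\<^bsub>M\<^esub> y = \<zero>\<^bsub>M\<^esub>"
      using f(2)[OF v(1)] g0[OF v(1)] ker[OF v(1)] by simp
    then show "x = y" using x y by (simp add: M.M.minus_eq_zero_iff)
  qed
  then show ?thesis
    unfolding embeds_in_free_def using f(1) by blast
qed

end

subsection \<open>Annihilators of finitely generated ideals\<close>

lemma left_ann_opp [simp]: "left_ann (opp R) X = right_ann R X"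
  by (simp add: left_ann_def right_ann_def)

lemma right_ann_opp [simp]: "right_ann (opp R) X = left_ann R X"
  by (simp add: left_ann_def right_ann_def)

text \<open>Embed R/I in a free module and let w be the image of the class of 1. Then r lies in I
  iff r w = 0, that is, iff r kills every coordinate of w. The coordinates thus belong to the right
  annihilator of I, and whatever kills this annihilator kills w and lies in I.\<close>

lemma left_ideal_eq_if_embeds:
  fixes R :: "('a, 'z) ring_scheme"
  assumes R: "ring R"
    and emb: "\<And>M :: 'a fg_module. cyclic_module R M \<Longrightarrow> fin_pres R M \<Longrightarrow> embeds_in_free R M"
    and I: "fg_left_ideal R I"
  shows "left_ann R (right_ann R I) = I"
proof -
  interpret R: ring R by (rule R)
  note P = left_module_free[OF R] and G = left_module_reg[OF R]
  obtain m h where h: "h \<in> mod_hom R (free_module R {..<m::nat}) (reg_module R)"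
    "I = h ` carrier (free_module R {..<m})"
    using I fg_submodule_iff[OF G] by auto
  have Ic: "I \<subseteq> carrier R" using h mod_hom_closed[OF h(1)] by auto
  \<comment> \<open>R is replaced by R^1 through the injection e, so that R/I becomes a module of
    type \<open>'a fg_module\<close>; a finite generating family of I, moved to R^1, is its relation
    map.\<close>
  let ?P = "free_module R {..<1::nat}"
  interpret P: left_module R ?P by (rule P)
  let ?u = "unit_vec R (0::nat)"
  have u: "?u \<in> carrier ?P" by (rule unit_vec_closed[OF R]) simp
  define e where "e = (\<lambda>r\<in>carrier (reg_module R). r \<odot>\<^bsub>?P\<^esub> ?u)"
  have e: "e \<in> mod_hom R (reg_module R) ?P"
    unfolding e_def
    by (rule mod_hom_restrictI[OF G])
       (use u P.smult_closed P.smult_l_distr P.smult_assoc in \<open>simp_all del: free_simps\<close>)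
  have e_inj: "r = s" if "r \<in> carrier R" "s \<in> carrier R" "e r = e s" for r s
    using fun_cong[OF that(3), of 0] that(1,2) by (simp add: e_def unit_vec_def)
  let ?p = "compose (carrier (free_module R {..<m})) e h"
  have p: "?p \<in> mod_hom R (free_module R {..<m}) ?P"
    by (rule mod_hom_compose[OF P h(1) e])
  let ?K = "?p ` carrier (free_module R {..<m})"
  note K = mod_hom_image[OF P P p left_module.submodule_carrier[OF P]]
  have Ke: "?K = e ` I" by (simp add: h(2) compose_def image_image)
  let ?M = "quot_module ?P ?K"
  define c where "c = restrict (coset_of ?P ?K) (carrier ?P)"
  have M: "left_module R ?M" by (rule left_module_quot[OF P K])
  have c: "c \<in> mod_hom R ?P ?M" "c ` carrier ?P = carrier ?M"
    and cker: "{v \<in> carrier ?P. c v = \<zero>\<^bsub>?M\<^esub>} = ?K"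
    unfolding c_def by (rule quot_proj_hom[OF P K] quot_proj_surj[OF P K] quot_proj_ker[OF P K])+
  have "carrier ?M = mod_span R ?M {c ?u}"
    using free_hom_image_eq_span(1)[OF M c(1)] c(2) by (simp add: lessThan_Suc)
  then have "cyclic_module R ?M"
    unfolding cyclic_module_def using M mod_hom_closed[OF c(1) u] by blast
  then have "embeds_in_free R ?M"
    using emb fin_pres_quot[OF R p] by blast
  then obtain X f where f: "f \<in> mod_hom R ?M (free_module R (X :: ((nat \<Rightarrow> 'a) set \<times> nat) set))"
    "inj_on f (carrier ?M)"
    unfolding embeds_in_free_def by blast
  \<comment> \<open>The image of the class of 1 under the embedding.\<close>
  define w where "w = f (c ?u)"
  have w: "w \<in> carrier (free_module R X)"
    unfolding w_def by (intro mod_hom_closed[OF f(1)] mod_hom_closed[OF c(1)] u)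
  have iff: "r \<in> I \<longleftrightarrow> (\<forall>x. r \<otimes>\<^bsub>R\<^esub> w x = \<zero>\<^bsub>R\<^esub>)" if r: "r \<in> carrier R" for r
  proof -
    have er: "e r \<in> carrier ?P" using mod_hom_closed[OF e] r by simp
    have "r \<in> I \<longleftrightarrow> e r \<in> ?K"
      unfolding Ke using e_inj[OF r] Ic by blast
    also have "\<dots> \<longleftrightarrow> c (e r) = \<zero>\<^bsub>?M\<^esub>"
      using cker er by blast
    also have "\<dots> \<longleftrightarrow> f (c (e r)) = \<zero>\<^bsub>free_module R X\<^esub>"
      using mod_hom_zero[OF M P f(1)] inj_onD[OF f(2), of "c (e r)" "\<zero>\<^bsub>?M\<^esub>"] mod_hom_closed[OF c(1) er]
        submodule_zero[OF left_module.submodule_carrier[OF M]] by auto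
    also have "f (c (e r)) = r \<odot>\<^bsub>free_module R X\<^esub> w"
    proof -
      have "e r = r \<odot>\<^bsub>?P\<^esub> ?u" using r by (simp add: e_def)
      then show ?thesis
        using mod_hom_smult[OF f(1) r mod_hom_closed[OF c(1) u]]
        by (simp only: mod_hom_smult[OF c(1) r u] w_def)
    qed
    finally show ?thesis by (simp add: fun_eq_iff)
  qed
  show ?thesis
  proof (intro equalityI subsetI)
    fix r assume r: "r \<in> left_ann R (right_ann R I)"
    then have rc: "r \<in> carrier R" by (simp add: left_ann_def)
    have "y \<otimes>\<^bsub>R\<^esub> w x = \<zero>\<^bsub>R\<^esub>" if "y \<in> I" for x y
      using iff[of y] Ic that by blast
    then have "w x \<in> right_ann R I" for x
      using free_closed[OF R w] by (simp add: right_ann_def)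
    then show "r \<in> I"
      using r unfolding iff[OF rc] by (auto simp: left_ann_def)
  qed (use Ic in \<open>auto simp: left_ann_def right_ann_def\<close>)
qed

section \<open>The pairing for sequences constrained only below the given length, as inductions on
  the length require\<close>

lemma dot_cong:
  assumes "ring R" "\<And>i. i < n \<Longrightarrow> v i = v' i" "\<And>i. i < n \<Longrightarrow> w i = w' i"
    and "\<And>i. i < n \<Longrightarrow> v' i \<in> carrier R" "\<And>i. i < n \<Longrightarrow> w' i \<in> carrier R"
  shows "dot R n v w = dot R n v' w'"
proof -
  interpret ring R by fact
  show ?thesis
    unfolding dot_def by (rule finsum_cong') (use assms in auto)
qed

lemma dot_0 [simp]: "ring R \<Longrightarrow> dot R 0 v w = \<zero>\<^bsub>R\<^esub>"
proof -
  assume "ring R"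
  then interpret ring R .
  show ?thesis by (simp add: dot_def)
qed

lemma dot_entries_closed:
  assumes "ring R" "\<And>i. i < n \<Longrightarrow> v i \<in> carrier R" "\<And>i. i < n \<Longrightarrow> w i \<in> carrier R"
  shows "dot R n v w \<in> carrier R"
proof -
  interpret ring R by fact
  show ?thesis unfolding dot_def by (rule finsum_closed) (use assms in auto)
qed

lemma dot_Suc:
  assumes "ring R" "\<And>i. i < Suc n \<Longrightarrow> v i \<in> carrier R" "\<And>i. i < Suc n \<Longrightarrow> w i \<in> carrier R"
  shows "dot R (Suc n) v w = dot R n v w \<oplus>\<^bsub>R\<^esub> v n \<otimes>\<^bsub>R\<^esub> w n"
proof -
  interpret ring R by fact
  have "dot R (Suc n) v w = v n \<otimes>\<^bsub>R\<^esub> w n \<oplus>\<^bsub>R\<^esub> dot R n v w"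
    unfolding dot_def lessThan_Suc by (rule finsum_insert) (use assms in auto)
  then show ?thesis
    using assms dot_entries_closed[of R n v w] by (simp add: a_comm)
qed

lemma dot_add_entries:
  assumes "ring R" "\<And>i. i < n \<Longrightarrow> u i \<in> carrier R" "\<And>i. i < n \<Longrightarrow> v i \<in> carrier R"
    "\<And>i. i < n \<Longrightarrow> w i \<in> carrier R"
  shows "dot R n (\<lambda>i. u i \<oplus>\<^bsub>R\<^esub> v i) w = dot R n u w \<oplus>\<^bsub>R\<^esub> dot R n v w"
proof -
  interpret ring R by fact
  have "dot R n (\<lambda>i. u i \<oplus>\<^bsub>R\<^esub> v i) w = (\<Oplus>\<^bsub>R\<^esub>i\<in>{..<n}. u i \<otimes>\<^bsub>R\<^esub> w i \<oplus>\<^bsub>R\<^esub> v i \<otimes>\<^bsub>R\<^esub> w i)"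
    unfolding dot_def by (rule finsum_cong') (use assms in \<open>auto simp: l_distr\<close>)
  also have "\<dots> = dot R n u w \<oplus>\<^bsub>R\<^esub> dot R n v w"
    unfolding dot_def by (rule finsum_addf) (use assms in auto)
  finally show ?thesis .
qed

lemma dot_smult_entries:
  assumes "ring R" "r \<in> carrier R" "\<And>i. i < n \<Longrightarrow> v i \<in> carrier R"
    "\<And>i. i < n \<Longrightarrow> w i \<in> carrier R"
  shows "dot R n (\<lambda>i. r \<otimes>\<^bsub>R\<^esub> v i) w = r \<otimes>\<^bsub>R\<^esub> dot R n v w"
proof -
  interpret ring R by fact
  have "dot R n (\<lambda>i. r \<otimes>\<^bsub>R\<^esub> v i) w = (\<Oplus>\<^bsub>R\<^esub>i\<in>{..<n}. r \<otimes>\<^bsub>R\<^esub> (v i \<otimes>\<^bsub>R\<^esub> w i))"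
    unfolding dot_def by (rule finsum_cong') (use assms in \<open>auto simp: m_assoc\<close>)
  also have "\<dots> = r \<otimes>\<^bsub>R\<^esub> dot R n v w"
    unfolding dot_def by (rule finsum_rdistr[symmetric]) (use assms in auto)
  finally show ?thesis .
qed

lemma dot_smult_entries_right:
  assumes "ring R" "r \<in> carrier R" "\<And>i. i < n \<Longrightarrow> v i \<in> carrier R"
    "\<And>i. i < n \<Longrightarrow> w i \<in> carrier R"
  shows "dot R n v (\<lambda>i. w i \<otimes>\<^bsub>R\<^esub> r) = dot R n v w \<otimes>\<^bsub>R\<^esub> r"
  using dot_smult_entries[OF ring_opp[OF assms(1)], of r n w v] assms by (simp add: dot_opp)

lemma truncated_closed:
  assumes "\<And>i. i < n \<Longrightarrow> v i \<in> carrier R"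
  shows "(\<lambda>i::nat. if i < n then v i else \<zero>\<^bsub>R\<^esub>) \<in> carrier (free_module R {..<n})"
  using assms by (simp add: free_finite_carrier)

section \<open>Annihilators, spans and the extension of functionals from ideals\<close>

lemma left_ann_antimono: "X \<subseteq> Y \<Longrightarrow> left_ann R Y \<subseteq> left_ann R X"
  by (auto simp: left_ann_def)

text \<open>For each s the elements x with x s = 0 form a left ideal, so testing generators
  suffices.\<close>

lemma right_ann_span:
  assumes R: "ring R" and X: "X \<subseteq> carrier R"
  shows "right_ann R (mod_span R (reg_module R) X) = right_ann R X"
proof (intro equalityI subsetI)
  interpret R: ring R by (rule R)
  note G = left_module_reg[OF R]
  fix s assume s: "s \<in> right_ann R X"
  then have sc: "s \<in> carrier R" by (simp add: right_ann_def)
  have "submodule {x \<in> carrier (reg_module R). x \<otimes>\<^bsub>R\<^esub> s = \<zero>\<^bsub>R\<^esub>} R (reg_module R)"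
    by (rule left_module.submoduleI[OF G]) (use sc in \<open>auto simp: R.l_distr R.m_assoc\<close>)
  then have "mod_span R (reg_module R) X \<subseteq> {x \<in> carrier (reg_module R). x \<otimes>\<^bsub>R\<^esub> s = \<zero>\<^bsub>R\<^esub>}"
    by (rule mod_span_least) (use s X in \<open>auto simp: right_ann_def\<close>)
  then show "s \<in> right_ann R (mod_span R (reg_module R) X)"
    using sc by (auto simp: right_ann_def)
next
  fix s assume "s \<in> right_ann R (mod_span R (reg_module R) X)"
  then show "s \<in> right_ann R X"
    using mod_span_superset[of X R "reg_module R"] by (auto simp: right_ann_def)
qed

lemma span_family_eq_dot:
  assumes R: "ring R" and a: "\<And>i. i < m \<Longrightarrow> a i \<in> carrier R"
    and x: "x \<in> mod_span R (reg_module R) (a ` {..<m})"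
  obtains v where "v \<in> carrier (free_module R {..<m})" "x = dot R m v a"
proof -
  let ?a = "\<lambda>i. if i < m then a i else \<zero>\<^bsub>R\<^esub>" and ?P = "free_module R {..<m}"
  have a': "?a \<in> carrier ?P" by (rule truncated_closed) (rule a)
  let ?f = "\<lambda>v\<in>carrier ?P. dot R m v ?a"
  have "?f ` unit_vec R ` {..<m} = a ` {..<m}"
    unfolding image_image
    by (intro image_cong) (auto simp: unit_vec_closed[OF R] dot_unit_vec[OF R a'])
  then have "x \<in> ?f ` carrier ?P"
    using x free_hom_image_eq_span(1)[OF left_module_reg[OF R] dot_hom[OF R a']] by simp
  then obtain v where "v \<in> carrier ?P" "x = dot R m v ?a" by auto
  moreover from this have "dot R m v ?a = dot R m v a"
    using a free_closed[OF R] by (intro dot_cong[OF R]) auto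
  ultimately show ?thesis using that by simp
qed

lemma span_singleton:
  assumes R: "ring R" and a: "a \<in> carrier R" and x: "x \<in> mod_span R (reg_module R) {a}"
  obtains r where "r \<in> carrier R" "x = r \<otimes>\<^bsub>R\<^esub> a"
proof -
  interpret R: ring R by (rule R)
  have "submodule {r \<otimes>\<^bsub>R\<^esub> a |r. r \<in> carrier R} R (reg_module R)"
  proof (rule left_module.submoduleI[OF left_module_reg[OF R]])
    show "\<zero>\<^bsub>reg_module R\<^esub> \<in> {r \<otimes>\<^bsub>R\<^esub> a |r. r \<in> carrier R}"
      using a by (auto intro!: exI[of _ "\<zero>\<^bsub>R\<^esub>"])
  next
    fix x y assume "x \<in> {r \<otimes>\<^bsub>R\<^esub> a |r. r \<in> carrier R}" "y \<in> {r \<otimes>\<^bsub>R\<^esub> a |r. r \<in> carrier R}"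
    then obtain r s where "x = r \<otimes>\<^bsub>R\<^esub> a" "y = s \<otimes>\<^bsub>R\<^esub> a" "r \<in> carrier R" "s \<in> carrier R" by auto
    then show "x \<oplus>\<^bsub>reg_module R\<^esub> y \<in> {r \<otimes>\<^bsub>R\<^esub> a |r. r \<in> carrier R}"
      using a by (auto simp: R.l_distr intro!: exI[of _ "r \<oplus>\<^bsub>R\<^esub> s"])
  next
    fix t x assume t: "t \<in> carrier R" and "x \<in> {r \<otimes>\<^bsub>R\<^esub> a |r. r \<in> carrier R}"
    then obtain r where "x = r \<otimes>\<^bsub>R\<^esub> a" "r \<in> carrier R" by auto
    then show "t \<odot>\<^bsub>reg_module R\<^esub> x \<in> {r \<otimes>\<^bsub>R\<^esub> a |r. r \<in> carrier R}"
      using a t by (auto simp: R.m_assoc intro!: exI[of _ "t \<otimes>\<^bsub>R\<^esub> r"])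
  qed (use a in auto)
  then have "mod_span R (reg_module R) {a} \<subseteq> {r \<otimes>\<^bsub>R\<^esub> a |r. r \<in> carrier R}"
    by (rule mod_span_least) (use a in \<open>auto intro!: exI[of _ "\<one>\<^bsub>R\<^esub>"]\<close>)
  then show ?thesis using x that by auto
qed

text \<open>The left annihilator of finitely many elements is the common kernel of the right
  multiplications by them, seen as functionals on R^1.\<close>

lemma fg_left_ann:
  assumes coh: "left_coherent R" and X: "finite X" "X \<subseteq> carrier R"
  shows "fg_left_ideal R (left_ann R X)"
proof -
  have R: "ring R" using coh by (simp add: left_coherent_def)
  interpret R: ring R by (rule R)
  note P = left_module_free[OF R] and G = left_module_reg[OF R]
  obtain m a where a: "X = a ` {..<m::nat}"
    using finite_imp_nat_seg_image_inj_on[OF X(1)] unfolding lessThan_def by metis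
  let ?P = "free_module R {..<1::nat}"
  have ac: "a j \<in> carrier R" if "j < m" for j using a X(2) that by auto
  have h: "(\<lambda>v\<in>carrier ?P. v 0 \<otimes>\<^bsub>R\<^esub> a j) \<in> mod_hom R ?P (reg_module R)" if "j < m" for j
    by (rule mod_hom_restrictI[OF P]) (auto simp: free_closed[OF R] ac[OF that] R.l_distr R.m_assoc)
  have e: "(\<lambda>v\<in>carrier ?P. v 0) \<in> mod_hom R ?P (reg_module R)"
    by (rule mod_hom_restrictI[OF P]) (auto simp: free_closed[OF R])
  have "fg_submodule R ?P {v \<in> carrier ?P. \<forall>j<m. (\<lambda>v\<in>carrier ?P. v 0 \<otimes>\<^bsub>R\<^esub> a j) v = \<zero>\<^bsub>R\<^esub>}"
    by (rule left_coherent_ker_functionals[OF coh]) (rule h)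
  note fg = fg_submodule_image[OF P G e this]
  show ?thesis
  proof (rule back_subst[of "fg_left_ideal R", OF fg], intro equalityI subsetI)
    fix r assume r: "r \<in> left_ann R X"
    let ?v = "\<lambda>i::nat. if i < 1 then r else \<zero>\<^bsub>R\<^esub>"
    have v: "?v \<in> carrier ?P" by (rule truncated_closed) (use r in \<open>simp add: left_ann_def\<close>)
    show "r \<in> (\<lambda>v\<in>carrier ?P. v 0) ` {v \<in> carrier ?P. \<forall>j<m. (\<lambda>v\<in>carrier ?P. v 0 \<otimes>\<^bsub>R\<^esub> a j) v = \<zero>\<^bsub>R\<^esub>}"
      by (rule image_eqI[of _ _ ?v]) (use v r a in \<open>auto simp: left_ann_def\<close>)
  qed (use a free_closed[OF R] in \<open>auto simp: left_ann_def\<close>)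
qed

text \<open>
  The Ikeda-Nakayama argument: for finitely generated left ideals \<open>I\<close> and \<open>J\<close> the double
  annihilator condition gives \<open>right_ann (I \<inter> J) = right_ann I + right_ann J\<close>, which allows to
  glue right multiplications defined on \<open>I\<close> and on \<open>J\<close>.
\<close>

lemma right_multiplication_extends:
  assumes R: "ring R" and coh: "right_coherent R"
    and l: "\<And>I. fg_left_ideal R I \<Longrightarrow> left_ann R (right_ann R I) = I"
    and r: "\<And>J. fg_right_ideal R J \<Longrightarrow> right_ann R (left_ann R J) = J"
    and "\<And>i. i < m \<Longrightarrow> a i \<in> carrier R" and "\<And>i. i < m \<Longrightarrow> g i \<in> carrier R"
    and "\<And>v. (\<And>i. i < m \<Longrightarrow> v i \<in> carrier R) \<Longrightarrow> dot R m v a = \<zero>\<^bsub>R\<^esub> \<Longrightarrow> dot R m v g = \<zero>\<^bsub>R\<^esub>"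
  shows "\<exists>d\<in>carrier R. \<forall>i<m. g i = a i \<otimes>\<^bsub>R\<^esub> d"
  using assms(5-7)
proof (induct m)
  interpret R: ring R by (rule R)
  case 0
  show ?case using R.zero_closed by blast
next
  interpret R: ring R by (rule R)
  note T = ring_opp[OF R]
  note G = left_module_reg[OF R] and G' = left_module_reg[OF T]
  case (Suc m)
  have am: "a m \<in> carrier R" "g m \<in> carrier R" and ai: "\<And>i. i < m \<Longrightarrow> a i \<in> carrier R" "\<And>i. i < m \<Longrightarrow> g i \<in> carrier R"
    using Suc(2,3) by auto
  have "\<exists>d\<in>carrier R. \<forall>i<m. g i = a i \<otimes>\<^bsub>R\<^esub> d"
  proof (rule Suc(1)[OF ai])
    fix v assume v: "\<And>i. i < m \<Longrightarrow> v i \<in> carrier R" and 0: "dot R m v a = \<zero>\<^bsub>R\<^esub>"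
    \<comment> \<open>Padded by zero, a relation among the first m elements becomes one among all
      \<open>Suc m\<close>.\<close>
    let ?v = "\<lambda>i. if i < m then v i else \<zero>\<^bsub>R\<^esub>"
    have eq: "dot R (Suc m) ?v w = dot R m v w" if "\<And>i. i < Suc m \<Longrightarrow> w i \<in> carrier R" for w
    proof -
      have "dot R m ?v w = dot R m v w"
        by (rule dot_cong[OF R]) (use that v in auto)
      then show ?thesis
        using that v dot_entries_closed[OF R, of m v w] by (simp add: dot_Suc[OF R])
    qed
    have "dot R (Suc m) ?v g = \<zero>\<^bsub>R\<^esub>"
      by (rule Suc(4)) (use v 0 eq[OF Suc(2)] in auto)
    then show "dot R m v g = \<zero>\<^bsub>R\<^esub>" using eq[OF Suc(3)] by simp
  qed
  then obtain d where d: "d \<in> carrier R" "\<And>i. i < m \<Longrightarrow> g i = a i \<otimes>\<^bsub>R\<^esub> d" by blast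
  \<comment> \<open>The case of one generator: what kills a m on the left also kills g m, so g m
    lies in the double annihilator of the right ideal generated by a m, which is that ideal
    itself.\<close>
  have "g m \<in> right_ann R (left_ann R {a m})"
  proof -
    have "x \<otimes>\<^bsub>R\<^esub> g m = \<zero>\<^bsub>R\<^esub>" if x: "x \<in> carrier R" "x \<otimes>\<^bsub>R\<^esub> a m = \<zero>\<^bsub>R\<^esub>" for x
    proof -
      let ?v = "\<lambda>i. if i < m then \<zero>\<^bsub>R\<^esub> else x"
      have eq: "dot R (Suc m) ?v w = x \<otimes>\<^bsub>R\<^esub> w m" if "\<And>i. i < Suc m \<Longrightarrow> w i \<in> carrier R" for w
      proof -
        have "dot R m ?v w = (\<Oplus>\<^bsub>R\<^esub>i\<in>{..<m}. \<zero>\<^bsub>R\<^esub>)"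
          unfolding dot_def by (rule R.finsum_cong') (use that in auto)
        then show ?thesis
          using that x(1) by (simp add: dot_Suc[OF R])
      qed
      have "dot R (Suc m) ?v g = \<zero>\<^bsub>R\<^esub>"
        by (rule Suc(4)) (use x eq[OF Suc(2)] in auto)
      then show ?thesis using eq[OF Suc(3)] by simp
    qed
    then show ?thesis using am by (auto simp: right_ann_def left_ann_def)
  qed
  moreover have "left_ann R {a m} = left_ann R (mod_span (opp R) (reg_module (opp R)) {a m})"
    using right_ann_span[OF T, of "{a m}"] am by simp
  moreover have "fg_right_ideal R (mod_span (opp R) (reg_module (opp R)) {a m})"
    unfolding fg_submodule_def using am by (intro exI[of _ "{a m}"]) auto
  ultimately have "g m \<in> mod_span (opp R) (reg_module (opp R)) {a m}"
    using r by simp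
  then obtain d' where d': "d' \<in> carrier R" "g m = a m \<otimes>\<^bsub>R\<^esub> d'"
    using span_singleton[OF T, of "a m"] am by auto
  let ?I = "mod_span R (reg_module R) (a ` {..<m})" and ?J = "mod_span R (reg_module R) {a m}"
  let ?rI = "right_ann R (a ` {..<m})" and ?rJ = "right_ann R {a m}"
  have aI: "a ` {..<m} \<subseteq> carrier R" "{a m} \<subseteq> carrier R" using ai am by auto
  have fgI: "fg_left_ideal R ?I" "fg_left_ideal R ?J"
    unfolding fg_submodule_def using aI by (intro exI[of _ "a ` {..<m}"] exI[of _ "{a m}"]; simp)+
  have rI: "right_ann R ?I = ?rI" "right_ann R ?J = ?rJ"
    using right_ann_span[OF R] aI by auto
  \<comment> \<open>Coherence on the right makes both annihilators finitely generated. Their sum L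
    is then subject to the double annihilator condition on right ideals.\<close>
  have fgr: "fg_right_ideal R ?rI" "fg_right_ideal R ?rJ"
    using fg_left_ann[OF coh, of "a ` {..<m}"] fg_left_ann[OF coh, of "{a m}"] aI by auto
  let ?L = "{s \<oplus>\<^bsub>reg_module (opp R)\<^esub> t |s t. s \<in> ?rI \<and> t \<in> ?rJ}"
  have L: "fg_right_ideal R ?L" by (rule fg_submodule_sum[OF G' fgr])
  have z: "\<zero>\<^bsub>R\<^esub> \<in> ?rI" "\<zero>\<^bsub>R\<^esub> \<in> ?rJ" using aI by (auto simp: right_ann_def)
  have IL: "s \<in> ?L" if "s \<in> ?rI" for s
  proof -
    have "s = s \<oplus>\<^bsub>reg_module (opp R)\<^esub> \<zero>\<^bsub>R\<^esub>" using that by (simp add: right_ann_def)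
    then show ?thesis using that z(2) by blast
  qed
  have JL: "s \<in> ?L" if "s \<in> ?rJ" for s
  proof -
    have "s = \<zero>\<^bsub>R\<^esub> \<oplus>\<^bsub>reg_module (opp R)\<^esub> s" using that by (simp add: right_ann_def)
    then show ?thesis using that z(1) by blast
  qed
  have "?rI \<subseteq> ?L" by (rule subsetI) (rule IL)
  from left_ann_antimono[OF this, of R] have lI: "left_ann R ?L \<subseteq> ?I"
    using l[OF fgI(1)] rI(1) by simp
  have "?rJ \<subseteq> ?L" by (rule subsetI) (rule JL)
  from left_ann_antimono[OF this, of R] have lJ: "left_ann R ?L \<subseteq> ?J"
    using l[OF fgI(2)] rI(2) by simp
  \<comment> \<open>An element x killing L lies in both I and J. Subtracting its two expressions
    yields a relation among all the a i, with coefficient -w at a m; the hypothesis transfers it to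
    the g i, which says x d = x d'.\<close>
  have "d \<ominus>\<^bsub>R\<^esub> d' \<in> right_ann R (left_ann R ?L)"
  proof -
    have "x \<otimes>\<^bsub>R\<^esub> (d \<ominus>\<^bsub>R\<^esub> d') = \<zero>\<^bsub>R\<^esub>" if x: "x \<in> left_ann R ?L" for x
    proof -
      have xc: "x \<in> carrier R" using x by (simp add: left_ann_def)
      have xI: "x \<in> ?I" and xJ: "x \<in> ?J" by (rule subsetD[OF lI x], rule subsetD[OF lJ x])
      obtain v where v: "v \<in> carrier (free_module R {..<m})" "x = dot R m v a"
        using span_family_eq_dot[OF R ai(1) xI] by blast
      obtain w where w: "w \<in> carrier R" "x = w \<otimes>\<^bsub>R\<^esub> a m"
        using span_singleton[OF R am(1) xJ] by blast
      let ?v = "\<lambda>i. if i < m then v i else \<ominus>\<^bsub>R\<^esub> w"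
      have vc: "v i \<in> carrier R" for i by (rule free_closed[OF R v(1)])
      have eq: "dot R (Suc m) ?v y = dot R m v y \<ominus>\<^bsub>R\<^esub> w \<otimes>\<^bsub>R\<^esub> y m" if y: "\<And>i. i < Suc m \<Longrightarrow> y i \<in> carrier R" for y
      proof -
        have "dot R m ?v y = dot R m v y"
          by (rule dot_cong[OF R]) (use y vc in auto)
        then show ?thesis
          using y vc w(1) by (simp add: dot_Suc[OF R] a_minus_def R.l_minus)
      qed
      have "dot R (Suc m) ?v a = \<zero>\<^bsub>R\<^esub>"
        using eq[OF Suc(2)] v(2) w(2) xc by (simp add: R.minus_eq_zero_iff)
      then have "dot R (Suc m) ?v g = \<zero>\<^bsub>R\<^esub>"
        by (intro Suc(4)) (use vc w in auto)
      then have "dot R m v g \<ominus>\<^bsub>R\<^esub> w \<otimes>\<^bsub>R\<^esub> g m = \<zero>\<^bsub>R\<^esub>"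
        using eq[OF Suc(3)] by simp
      then have "dot R m v g = w \<otimes>\<^bsub>R\<^esub> g m"
        using dot_entries_closed[OF R, of m v g] vc ai(2) w(1) am by (simp add: R.minus_eq_zero_iff)
      moreover have "dot R m v g = dot R m v (\<lambda>i. a i \<otimes>\<^bsub>R\<^esub> d)"
        by (rule dot_cong[OF R]) (use d vc ai in auto)
      moreover have "dot R m v (\<lambda>i. a i \<otimes>\<^bsub>R\<^esub> d) = x \<otimes>\<^bsub>R\<^esub> d"
        unfolding v(2) by (rule dot_smult_entries_right[OF R d(1)]) (use vc ai in auto)
      moreover have "w \<otimes>\<^bsub>R\<^esub> g m = x \<otimes>\<^bsub>R\<^esub> d'"
        unfolding w(2) d'(2) using w d' am by (simp add: R.m_assoc)
      ultimately show ?thesis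
        using xc d d' by (simp add: a_minus_def R.r_distr R.r_minus R.r_neg)
    qed
    then show ?thesis using d d' by (auto simp: right_ann_def)
  qed
  then have "d \<ominus>\<^bsub>R\<^esub> d' \<in> ?L" using r[OF L] by simp
  then obtain s t where st: "d \<ominus>\<^bsub>R\<^esub> d' = s \<oplus>\<^bsub>R\<^esub> t" "s \<in> ?rI" "t \<in> ?rJ" by auto
  then have sc: "s \<in> carrier R" "t \<in> carrier R" by (auto simp: right_ann_def)
  \<comment> \<open>From d - d' = s + t follows d - s = d' + t. Since a i s = 0 for i < m and a m t
    = 0, this single element acts as d on I and as d' on J.\<close>
  let ?D = "d' \<oplus>\<^bsub>R\<^esub> t"
  have "d = (d \<ominus>\<^bsub>R\<^esub> d') \<oplus>\<^bsub>R\<^esub> d'"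
    using d(1) d'(1) by (simp add: a_minus_def R.a_assoc R.l_neg)
  then have dD: "d = s \<oplus>\<^bsub>R\<^esub> ?D"
    unfolding st(1) using sc d'(1) by (simp add: R.a_ac)
  have "g i = a i \<otimes>\<^bsub>R\<^esub> ?D" if "i < m" for i
  proof -
    have "a i \<otimes>\<^bsub>R\<^esub> s = \<zero>\<^bsub>R\<^esub>" using st(2) that by (auto simp: right_ann_def)
    have "a i \<otimes>\<^bsub>R\<^esub> d = a i \<otimes>\<^bsub>R\<^esub> (s \<oplus>\<^bsub>R\<^esub> ?D)" using dD by simp
    also have "\<dots> = a i \<otimes>\<^bsub>R\<^esub> ?D"
      using \<open>a i \<otimes>\<^bsub>R\<^esub> s = \<zero>\<^bsub>R\<^esub>\<close> ai(1)[OF that] sc d'(1) by (subst R.r_distr) auto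
    finally show ?thesis using d(2)[OF that] by simp
  qed
  moreover have "g m = a m \<otimes>\<^bsub>R\<^esub> ?D"
  proof -
    have "a m \<otimes>\<^bsub>R\<^esub> t = \<zero>\<^bsub>R\<^esub>" using st(3) by (auto simp: right_ann_def)
    then show ?thesis using d'(1,2) sc am by (simp add: R.r_distr)
  qed
  ultimately show ?case
    using sc d'(1) by (intro bexI[of _ ?D]) (auto simp: less_Suc_eq)
qed

text \<open>By induction on the number of functionals. Their restrictions to the kernel of h n, an
  image of some R^k by coherence, are covered by the induction hypothesis, which gives coefficients
  for the first n functionals. The error left over vanishes on that kernel, so it depends on h n v
  alone, and \<open>right_multiplication_extends\<close> supplies the last coefficient.\<close>

lemma functional_factors:
  assumes lcoh: "left_coherent R" and rcoh: "right_coherent R"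
    and l: "\<And>I. fg_left_ideal R I \<Longrightarrow> left_ann R (right_ann R I) = I"
    and r: "\<And>J. fg_right_ideal R J \<Longrightarrow> right_ann R (left_ann R J) = J"
    and "\<And>j. j < n \<Longrightarrow> h j \<in> mod_hom R (free_module R {..<m::nat}) (reg_module R)"
    and "g \<in> mod_hom R (free_module R {..<m}) (reg_module R)"
    and "\<And>v. v \<in> carrier (free_module R {..<m}) \<Longrightarrow> (\<And>j. j < n \<Longrightarrow> h j v = \<zero>\<^bsub>R\<^esub>) \<Longrightarrow> g v = \<zero>\<^bsub>R\<^esub>"
  shows "\<exists>d. (\<forall>j<n. d j \<in> carrier R) \<and>
    (\<forall>v\<in>carrier (free_module R {..<m}). g v = dot R n (\<lambda>j. h j v) d)"
  using assms(5-7)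
proof (induct n arbitrary: m h g)
  have R: "ring R" using lcoh by (simp add: left_coherent_def)
  case 0
  then show ?case using R by simp
next
  have R: "ring R" using lcoh by (simp add: left_coherent_def)
  interpret R: ring R by (rule R)
  note P = left_module_free[OF R] and G = left_module_reg[OF R]
  case (Suc n)
  let ?P = "free_module R {..<m}"
  interpret P: left_module R ?P by (rule P)
  have hn: "h n \<in> mod_hom R ?P (reg_module R)" using Suc(2) by simp
  have hj: "h j \<in> mod_hom R ?P (reg_module R)" if "j < n" for j using Suc(2) that by simp
  have hc: "h j v \<in> carrier R" if "j < Suc n" "v \<in> carrier ?P" for j v
    using mod_hom_closed[OF Suc(2) that(2)] that(1) by simp
  obtain k b where b: "b \<in> mod_hom R (free_module R {..<k::nat}) ?P"
    "{v \<in> carrier ?P. h n v = \<zero>\<^bsub>R\<^esub>} = b ` carrier (free_module R {..<k})"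
    using left_coherent_ker_functional[OF lcoh hn] unfolding fg_submodule_iff[OF P] by blast
  let ?Q = "free_module R {..<k}"
  have bb: "b u \<in> carrier ?P" "h n (b u) = \<zero>\<^bsub>R\<^esub>" if "u \<in> carrier ?Q" for u
    using that b(2) by blast+
  have "\<exists>d. (\<forall>j<n. d j \<in> carrier R) \<and>
    (\<forall>u\<in>carrier ?Q. compose (carrier ?Q) g b u = dot R n (\<lambda>j. compose (carrier ?Q) (h j) b u) d)"
  proof (rule Suc(1))
    show "compose (carrier ?Q) (h j) b \<in> mod_hom R ?Q (reg_module R)" if "j < n" for j
      by (rule mod_hom_compose[OF P b(1) hj[OF that]])
    show "compose (carrier ?Q) g b \<in> mod_hom R ?Q (reg_module R)"
      by (rule mod_hom_compose[OF P b(1) Suc(3)])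
    fix u assume u: "u \<in> carrier ?Q" and 0: "\<And>j. j < n \<Longrightarrow> compose (carrier ?Q) (h j) b u = \<zero>\<^bsub>R\<^esub>"
    have "g (b u) = \<zero>\<^bsub>R\<^esub>"
    proof (rule Suc(4)[OF bb(1)[OF u]])
      show "h j (b u) = \<zero>\<^bsub>R\<^esub>" if "j < Suc n" for j
        using 0[of j] bb(2)[OF u] that u by (cases "j = n") (auto simp: compose_def)
    qed
    then show "compose (carrier ?Q) g b u = \<zero>\<^bsub>R\<^esub>" using u by (simp add: compose_def)
  qed
  then obtain d where d: "\<And>j. j < n \<Longrightarrow> d j \<in> carrier R"
    "\<And>u. u \<in> carrier ?Q \<Longrightarrow> g (b u) = dot R n (\<lambda>j. h j (b u)) d"
    by (auto simp: compose_def)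
  let ?s = "\<lambda>v\<in>carrier ?P. dot R n (\<lambda>j. h j v) d"
  have s: "?s \<in> mod_hom R ?P (reg_module R)"
  proof (rule mod_hom_restrictI[OF P])
    show "dot R n (\<lambda>j. h j v) d \<in> carrier (reg_module R)" if "v \<in> carrier ?P" for v
      using hc[OF _ that] d(1) by (simp add: dot_entries_closed[OF R])
  next
    fix u v assume u: "u \<in> carrier ?P" and v: "v \<in> carrier ?P"
    have "dot R n (\<lambda>j. h j (u \<oplus>\<^bsub>?P\<^esub> v)) d = dot R n (\<lambda>j. h j u \<oplus>\<^bsub>R\<^esub> h j v) d"
      by (rule dot_cong[OF R]) (use mod_hom_add[OF hj u v] hc u v d(1) in auto)
    also have "\<dots> = dot R n (\<lambda>j. h j u) d \<oplus>\<^bsub>R\<^esub> dot R n (\<lambda>j. h j v) d"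
      by (rule dot_add_entries[OF R]) (use hc u v d(1) in auto)
    finally show "dot R n (\<lambda>j. h j (u \<oplus>\<^bsub>?P\<^esub> v)) d
      = dot R n (\<lambda>j. h j u) d \<oplus>\<^bsub>reg_module R\<^esub> dot R n (\<lambda>j. h j v) d" by simp
  next
    fix r v assume r: "r \<in> carrier R" and v: "v \<in> carrier ?P"
    have "dot R n (\<lambda>j. h j (r \<odot>\<^bsub>?P\<^esub> v)) d = dot R n (\<lambda>j. r \<otimes>\<^bsub>R\<^esub> h j v) d"
      by (rule dot_cong[OF R]) (use mod_hom_smult[OF hj r v] r hc v d(1) in auto)
    also have "\<dots> = r \<otimes>\<^bsub>R\<^esub> dot R n (\<lambda>j. h j v) d"
      by (rule dot_smult_entries[OF R r]) (use hc v d(1) in auto)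
    finally show "dot R n (\<lambda>j. h j (r \<odot>\<^bsub>?P\<^esub> v)) d
      = r \<odot>\<^bsub>reg_module R\<^esub> dot R n (\<lambda>j. h j v) d" by simp
  qed
  \<comment> \<open>The error of the first n coefficients, which are correct on the kernel of h
    n.\<close>
  let ?G = "\<lambda>v\<in>carrier ?P. g v \<ominus>\<^bsub>reg_module R\<^esub> ?s v"
  have G': "?G \<in> mod_hom R ?P (reg_module R)"
    by (rule mod_hom_comb(2)[OF P G Suc(3) s])
  have gc: "g v \<in> carrier R" if "v \<in> carrier ?P" for v using mod_hom_closed[OF Suc(3) that] by simp
  have sc: "?s v \<in> carrier R" if "v \<in> carrier ?P" for v using mod_hom_closed[OF s that] by simp
  have G0: "?G v = \<zero>\<^bsub>R\<^esub>" if v: "v \<in> carrier ?P" "h n v = \<zero>\<^bsub>R\<^esub>" for v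
  proof -
    obtain u where "u \<in> carrier ?Q" "v = b u" using v b(2) by blast
    then have "g v = ?s v" using d(2) v(1) by simp
    then show ?thesis
      using v(1) gc[OF v(1)] abelian_group.minus_eq_zero_iff[OF left_module.axioms(2)[OF G], of "g v" "g v"]
      by simp
  qed
  \<comment> \<open>The vectors a and c list the values of h n and of the error at the unit vectors.
    Vanishing of the error on the kernel of h n says that each relation among the entries of a holds
    among those of c.\<close>
  obtain a where a: "a \<in> carrier ?P" "\<And>v. v \<in> carrier ?P \<Longrightarrow> h n v = dot R m v a"
    using free_hom_reg[OF R hn] by blast
  obtain c where c: "c \<in> carrier ?P" "\<And>v. v \<in> carrier ?P \<Longrightarrow> ?G v = dot R m v c"
    using free_hom_reg[OF R G'] by blast
  have ac: "a i \<in> carrier R" "c i \<in> carrier R" for i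
    using free_closed[OF R a(1)] free_closed[OF R c(1)] by auto
  have "\<exists>e\<in>carrier R. \<forall>i<m. c i = a i \<otimes>\<^bsub>R\<^esub> e"
  proof (rule right_multiplication_extends[OF R rcoh l r])
    fix v assume v: "\<And>i. i < m \<Longrightarrow> v i \<in> carrier R" and 0: "dot R m v a = \<zero>\<^bsub>R\<^esub>"
    let ?v = "\<lambda>i. if i < m then v i else \<zero>\<^bsub>R\<^esub>"
    have v': "?v \<in> carrier ?P" by (rule truncated_closed) (rule v)
    have eq: "dot R m ?v y = dot R m v y" if "\<And>i. y i \<in> carrier R" for y
      by (rule dot_cong[OF R]) (use v that in auto)
    have "h n ?v = \<zero>\<^bsub>R\<^esub>" using a(2)[OF v'] eq[of a] ac 0 by simp
    then show "dot R m v c = \<zero>\<^bsub>R\<^esub>"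
      using G0[OF v'] c(2)[OF v'] eq[of c] ac by simp
  qed (use ac in auto)
  then obtain e where e: "e \<in> carrier R" "\<And>i. i < m \<Longrightarrow> c i = a i \<otimes>\<^bsub>R\<^esub> e" by blast
  have "g v = dot R (Suc n) (\<lambda>j. h j v) (d(n := e))" if v: "v \<in> carrier ?P" for v
  proof -
    have vc: "v i \<in> carrier R" for i by (rule free_closed[OF R v])
    have "?G v = dot R m v (\<lambda>i. a i \<otimes>\<^bsub>R\<^esub> e)"
      unfolding c(2)[OF v] by (rule dot_cong[OF R]) (use vc ac e in auto)
    also have "\<dots> = h n v \<otimes>\<^bsub>R\<^esub> e"
      unfolding a(2)[OF v] by (rule dot_smult_entries_right[OF R e(1)]) (use vc ac in auto)
    finally have "g v \<ominus>\<^bsub>reg_module R\<^esub> ?s v = h n v \<otimes>\<^bsub>R\<^esub> e" using v by simp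
    moreover have "g v = ?s v \<oplus>\<^bsub>reg_module R\<^esub> (g v \<ominus>\<^bsub>reg_module R\<^esub> ?s v)"
    proof -
      interpret G: left_module R "reg_module R" by (rule G)
      show ?thesis
        using gc[OF v] sc[OF v] G.M.a_lcomm[of "?s v" "g v" "\<ominus>\<^bsub>reg_module R\<^esub> ?s v"] G.M.r_neg[of "?s v"]
          G.M.r_zero[of "g v"] G.M.a_inv_closed[of "?s v"]
        by (simp add: a_minus_def)
    qed
    ultimately have "g v = ?s v \<oplus>\<^bsub>R\<^esub> h n v \<otimes>\<^bsub>R\<^esub> e" by simp
    also have "?s v = dot R n (\<lambda>j. h j v) (d(n := e))"
      using v by simp (rule dot_cong[OF R], use hc d(1) v in auto)
    also have "\<dots> \<oplus>\<^bsub>R\<^esub> h n v \<otimes>\<^bsub>R\<^esub> e = dot R (Suc n) (\<lambda>j. h j v) (d(n := e))"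
      by (subst dot_Suc[OF R]) (use hc v d(1) e(1) in \<open>auto simp: less_Suc_eq\<close>)
    finally show ?thesis .
  qed
  moreover have "\<forall>j<Suc n. (d(n := e)) j \<in> carrier R"
    using d(1) e(1) by (simp add: less_Suc_eq)
  ultimately show ?case by blast
qed

text \<open>The coordinates of p are n functionals whose common kernel is ker p, so g is a right
  linear combination of them; the coefficients define the functional on R^n.\<close>

lemma free_fp_injective_if_double_ann:
  assumes lcoh: "left_coherent R" and rcoh: "right_coherent R"
    and l: "\<And>I. fg_left_ideal R I \<Longrightarrow> left_ann R (right_ann R I) = I"
    and r: "\<And>J. fg_right_ideal R J \<Longrightarrow> right_ann R (left_ann R J) = J"
  shows "free_fp_injective R"
  unfolding free_fp_injective_def
proof (intro allI ballI impI)
  have R: "ring R" using lcoh by (simp add: left_coherent_def)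
  note P = left_module_free[OF R]
  fix m n p g
  assume p: "p \<in> mod_hom R (free_module R {..<m::nat}) (free_module R {..<n::nat})"
    and g: "g \<in> mod_hom R (free_module R {..<m}) (reg_module R)"
    and ker: "\<forall>v\<in>carrier (free_module R {..<m}). p v = (\<lambda>_. \<zero>\<^bsub>R\<^esub>) \<longrightarrow> g v = \<zero>\<^bsub>R\<^esub>"
  let ?P = "free_module R {..<m}"
  have pc: "p v j \<in> carrier R" if "v \<in> carrier ?P" for v j
    using free_closed[OF R mod_hom_closed[OF p that]] .
  let ?h = "\<lambda>j. \<lambda>v\<in>carrier ?P. p v j"
  have h: "?h j \<in> mod_hom R ?P (reg_module R)" for j
    by (rule mod_hom_restrictI[OF P])
       (auto simp: pc mod_hom_add[OF p, simplified] mod_hom_smult[OF p, simplified])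
  have "\<exists>d. (\<forall>j<n. d j \<in> carrier R) \<and> (\<forall>v\<in>carrier ?P. g v = dot R n (\<lambda>j. ?h j v) d)"
  proof (rule functional_factors[OF lcoh rcoh l r h g])
    fix v assume v: "v \<in> carrier ?P" and 0: "\<And>j. j < n \<Longrightarrow> ?h j v = \<zero>\<^bsub>R\<^esub>"
    have "p v j = \<zero>\<^bsub>R\<^esub>" for j
      using 0[of j] v mod_hom_closed[OF p v] by (cases "j < n") (auto simp: free_carrier)
    then show "g v = \<zero>\<^bsub>R\<^esub>" using ker v by auto
  qed
  then obtain d where d: "\<And>j. j < n \<Longrightarrow> d j \<in> carrier R"
    "\<And>v. v \<in> carrier ?P \<Longrightarrow> g v = dot R n (\<lambda>j. ?h j v) d"
    by blast
  let ?d = "\<lambda>j. if j < n then d j else \<zero>\<^bsub>R\<^esub>"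
  have d': "?d \<in> carrier (free_module R {..<n})" by (rule truncated_closed) (rule d(1))
  have "g v = (\<lambda>u\<in>carrier (free_module R {..<n}). dot R n u ?d) (p v)" if v: "v \<in> carrier ?P" for v
  proof -
    have "dot R n (\<lambda>j. ?h j v) d = dot R n (p v) ?d"
      by (rule dot_cong[OF R]) (use v pc d(1) in auto)
    then show ?thesis using d(2)[OF v] mod_hom_closed[OF p v] by simp
  qed
  then show "\<exists>h\<in>mod_hom R (free_module R {..<n}) (reg_module R). \<forall>v\<in>carrier ?P. g v = h (p v)"
    using dot_hom[OF R d'] by blast
qed

subsection \<open>Natural isomorphisms with the bidual\<close>

text \<open>
  An element \<open>x\<close> of \<open>M\<close> killed by all functionals is the image of a generator under a map \<open>f\<close> from a free
  module with \<open>dual_map f = 0\<close>, hence \<open>bidual_map f = 0\<close>; naturality then forces \<open>f = 0\<close>.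
\<close>

lemma torsionless_if_id_iso_bidual:
  fixes R :: "('a, 'z) ring_scheme" and M :: "'a fg_module"
  assumes R: "ring R" and nat: "id_iso_bidual R" and fp: "fin_pres R M"
  shows "torsionless R M"
  unfolding torsionless_def
proof (intro ballI impI, rule ccontr)
  fix x assume x: "x \<in> carrier M" "x \<noteq> \<zero>\<^bsub>M\<^esub>" and "\<not> (\<exists>h\<in>mod_hom R M (reg_module R). h x \<noteq> \<zero>\<^bsub>R\<^esub>)"
  then have hx: "\<And>h. h \<in> mod_hom R M (reg_module R) \<Longrightarrow> h x = \<zero>\<^bsub>R\<^esub>" by blast
  interpret R: ring R by (rule R)
  have M: "left_module R M" using fp by (simp add: fin_pres_def)
  interpret M: left_module R M by (rule M)
  note P = left_module_free[OF R] and G = left_module_reg[OF R]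
  let ?P = "free_module R {..<1::nat}"
  \<comment> \<open>The zero map from R^0 presents R^1 / 0, a copy of R whose elements have the type
    over which \<open>id_iso_bidual\<close> quantifies.\<close>
  have z: "restrict (\<lambda>_. \<zero>\<^bsub>?P\<^esub>) (carrier (free_module R {..<0::nat})) \<in> mod_hom R (free_module R {..<0}) ?P"
    using submodule_zero[OF left_module.submodule_carrier[OF P[of "{..<1::nat}"]]]
    by (intro mod_hom_restrictI[OF P]) auto
  let ?K = "restrict (\<lambda>_. \<zero>\<^bsub>?P\<^esub>) (carrier (free_module R {..<0::nat})) ` carrier (free_module R {..<0})"
  let ?U = "quot_module ?P ?K"
  note K = mod_hom_image[OF P P z left_module.submodule_carrier[OF P]]
  have fpU: "fin_pres R ?U" by (rule fin_pres_quot[OF R z])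
  define c where "c = restrict (coset_of ?P ?K) (carrier ?P)"
  have U: "left_module R ?U" by (rule left_module_quot[OF P K])
  have c: "c \<in> mod_hom R ?P ?U" "c ` carrier ?P = carrier ?U"
    and cker: "{v \<in> carrier ?P. c v = \<zero>\<^bsub>?U\<^esub>} = ?K"
    unfolding c_def by (rule quot_proj_hom[OF P K] quot_proj_surj[OF P K] quot_proj_ker[OF P K])+
  let ?u = "unit_vec R (0::nat)"
  have u: "?u \<in> carrier ?P" by (rule unit_vec_closed[OF R]) simp
  have f0: "(\<lambda>v\<in>carrier ?P. v 0 \<odot>\<^bsub>M\<^esub> x) \<in> mod_hom R ?P M"
    by (rule mod_hom_restrictI[OF P])
       (use x in \<open>auto simp: free_closed[OF R] M.smult_closed M.smult_l_distr M.smult_assoc\<close>)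
  have ker0: "(\<lambda>v\<in>carrier ?P. v 0 \<odot>\<^bsub>M\<^esub> x) v = \<zero>\<^bsub>M\<^esub>" if "v \<in> carrier ?P" "c v = \<zero>\<^bsub>?U\<^esub>" for v
  proof -
    have "v \<in> ?K" using cker that by blast
    then have "v = (\<lambda>_. \<zero>\<^bsub>R\<^esub>)" by auto
    then show ?thesis using that x by simp
  qed
  obtain f where f: "f \<in> mod_hom R ?U M"
    "\<And>v. v \<in> carrier ?P \<Longrightarrow> f (c v) = (\<lambda>v\<in>carrier ?P. v 0 \<odot>\<^bsub>M\<^esub> x) v"
    by (rule mod_hom_factor_surj[OF P U M c f0], rule ker0, assumption+) (rule that, auto)
  have fu: "f (c ?u) = x" using f(2)[OF u] u x by (simp add: unit_vec_def M.smult_one)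
  obtain \<eta> :: "'a fg_module \<Rightarrow> (nat \<Rightarrow> 'a) set \<Rightarrow> ((nat \<Rightarrow> 'a) set \<Rightarrow> 'a) \<Rightarrow> 'a"
    where iso: "\<And>M. fin_pres R M \<Longrightarrow> \<eta> M \<in> mod_iso R M (bidual R M)"
      and natural: "\<And>M N f y. f \<in> mod_hom R M N \<Longrightarrow> fin_pres R M \<Longrightarrow> fin_pres R N \<Longrightarrow> y \<in> carrier M
        \<Longrightarrow> \<eta> N (f y) = bidual_map R M N f (\<eta> M y)"
    using nat unfolding id_iso_bidual_def by blast
  \<comment> \<open>Every element of U is some c v, and h (f (c v)) = v 0 h x = 0.\<close>
  have dual0: "dual_map R ?U M f h = \<zero>\<^bsub>dual R ?U\<^esub>" if h: "h \<in> carrier (dual R M)" for h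
  proof -
    have "h (f y) = \<zero>\<^bsub>R\<^esub>" if y: "y \<in> carrier ?U" for y
    proof -
      obtain v where v: "v \<in> carrier ?P" "y = c v" using y c(2) by blast
      then have "h (f y) = v 0 \<otimes>\<^bsub>R\<^esub> h x"
        using mod_hom_smult[of h R M "reg_module R" "v 0" x] h x f(2)[OF v(1)] free_closed[OF R v(1)] by simp
      then show ?thesis using hx[of h] h free_closed[OF R v(1)] by simp
    qed
    then show ?thesis
      using h by (auto simp: dual_map_def compose_def intro!: restrict_ext)
  qed
  let ?y = "c ?u"
  have y: "?y \<in> carrier ?U" by (rule mod_hom_closed[OF c(1) u])
  have \<eta>y: "\<eta> ?U ?y \<in> mod_hom (opp R) (dual R ?U) (reg_module (opp R))"
    using iso[OF fpU] mod_hom_closed[OF _ y] by (fastforce simp: mod_iso_def)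
  have "\<eta> M x = bidual_map R ?U M f (\<eta> ?U ?y)"
    using natural[OF f(1) fpU fp y] fu by simp
  also have "\<dots> = \<zero>\<^bsub>bidual R M\<^esub>"
    using \<eta>y dual0 mod_hom_zero[OF left_module_dual[OF U] left_module_reg[OF ring_opp[OF R]] \<eta>y]
    by (auto simp: bidual_map_def dual_map_def[of "opp R"] compose_def intro!: restrict_ext simp del: dual_simps(2))
  finally have "\<eta> M x = \<zero>\<^bsub>bidual R M\<^esub>" .
  moreover have \<eta>M: "\<eta> M \<in> mod_hom R M (bidual R M)" "inj_on (\<eta> M) (carrier M)"
    using iso[OF fp] by (auto simp: mod_iso_def bij_betw_def)
  moreover have "\<eta> M \<zero>\<^bsub>M\<^esub> = \<zero>\<^bsub>bidual R M\<^esub>"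
    by (rule mod_hom_zero[OF M left_module_bidual[OF M] \<eta>M(1)])
  ultimately show False
    using x inj_onD[OF \<eta>M(2), of x "\<zero>\<^bsub>M\<^esub>"] by simp
qed

text \<open>The evaluation maps serve as \<eta>; their naturality is the identity (h \<circ> f) x =
  h (f x).\<close>

lemma id_iso_bidual_if_reflexive:
  fixes R :: "('a, 'z) ring_scheme"
  assumes refl: "\<And>M :: 'a fg_module. fin_pres R M \<Longrightarrow> reflexive_module R M"
  shows "id_iso_bidual R"
  unfolding id_iso_bidual_def
proof (intro exI conjI allI impI ballI)
  let ?\<eta> = "\<lambda>M :: 'a fg_module. \<lambda>x\<in>carrier M. \<lambda>h\<in>carrier (dual R M). h x"
  show "?\<eta> M \<in> mod_iso R M (bidual R M)" if "fin_pres R M" for M :: "'a fg_module"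
    using refl[OF that] by (simp add: reflexive_module_def)
  fix M N :: "'a fg_module" and f x
  assume f: "f \<in> mod_hom R M N" and fp: "fin_pres R M \<and> fin_pres R N" and x: "x \<in> carrier M"
  have M: "left_module R M" using fp by (simp add: fin_pres_def)
  have c: "?\<eta> M x \<in> carrier (dual (opp R) (dual R M))"
    using mod_hom_closed[OF evaluation_hom[OF M] x] by simp
  have "h (f x) = dual_map R M N f h x" and "dual_map R M N f h \<in> carrier (dual R M)" if "h \<in> carrier (dual R N)" for h
    using that x mod_hom_compose[OF M f, of h] by (auto simp: dual_map_def compose_def)
  then show "?\<eta> N (f x) = bidual_map R M N f (?\<eta> M x)"
    using c x mod_hom_closed[OF f x]
    by (auto simp: bidual_map_def dual_map_def[of "opp R"] compose_def intro!: restrict_ext simp del: dual_simps)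
qed

text \<open>An element killed by all functionals has the same evaluation as zero, and evaluation is
  injective.\<close>

lemma torsionless_if_reflexive:
  assumes R: "ring R" and refl: "reflexive_module R M"
  shows "torsionless R M"
  unfolding torsionless_def
proof (intro ballI impI, rule ccontr)
  fix x assume x: "x \<in> carrier M" "x \<noteq> \<zero>\<^bsub>M\<^esub>" and "\<not> (\<exists>h\<in>mod_hom R M (reg_module R). h x \<noteq> \<zero>\<^bsub>R\<^esub>)"
  then have hx: "\<And>h. h \<in> mod_hom R M (reg_module R) \<Longrightarrow> h x = \<zero>\<^bsub>R\<^esub>" by blast
  have M: "left_module R M" using refl by (simp add: reflexive_module_def)
  have z: "\<zero>\<^bsub>M\<^esub> \<in> carrier M" by (rule submodule_zero[OF left_module.submodule_carrier[OF M]])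
  let ?\<eta> = "\<lambda>x\<in>carrier M. \<lambda>h\<in>carrier (dual R M). h x"
  have inj: "inj_on ?\<eta> (carrier M)"
    using refl by (simp add: reflexive_module_def mod_iso_def bij_betw_def)
  have "?\<eta> x = ?\<eta> \<zero>\<^bsub>M\<^esub>"
    using x z by (auto simp: hx mod_hom_zero[OF M left_module_reg[OF R]] intro!: restrict_ext)
  then show False using inj_onD[OF inj _ x(1) z] x(2) by simp
qed

section \<open>The eight conditions compared with FP-injectivity on both sides\<close>

theorem theorem2p9:
  fixes R :: "('a, 'z) ring_scheme"
  assumes "ring R" and "left_coherent R" and "right_coherent R"
  defines "C1 \<equiv> weakly_quasi_frobenius R"
    and "C2 \<equiv> fp_injective R (reg_module R) \<and> fp_injective (opp R) (reg_module (opp R))"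
    and "C3 \<equiv> fp_cogenerator R (reg_module R) \<and> fp_cogenerator (opp R) (reg_module (opp R))"
    and "C4 \<equiv> fp_injective (opp R) (reg_module (opp R)) \<and>
               fp_cogenerator (opp R) (reg_module (opp R))"
    and "C5 \<equiv> (\<forall>M :: 'a fg_module. fin_pres R M \<longrightarrow> reflexive_module R M) \<and>
               (\<forall>M :: 'a fg_module. fin_pres (opp R) M \<longrightarrow> reflexive_module (opp R) M)"
    and "C6 \<equiv> (\<forall>M :: 'a fg_module. cyclic_module R M \<and> fin_pres R M
                  \<longrightarrow> reflexive_module R M) \<and>
               (\<forall>M :: 'a fg_module. cyclic_module (opp R) M \<and> fin_pres (opp R) M
                  \<longrightarrow> reflexive_module (opp R) M)"
    and "C7 \<equiv> (\<forall>M :: 'a fg_module. cyclic_module R M \<and> fin_pres R M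
                  \<longrightarrow> embeds_in_free R M) \<and>
               (\<forall>M :: 'a fg_module. cyclic_module (opp R) M \<and> fin_pres (opp R) M
                  \<longrightarrow> embeds_in_free (opp R) M)"
    and "C8 \<equiv> (\<forall>I. fg_left_ideal R I \<longrightarrow> left_ann R (right_ann R I) = I) \<and>
               (\<forall>J. fg_right_ideal R J \<longrightarrow> right_ann R (left_ann R J) = J)"
  shows "(C1 \<longleftrightarrow> C2) \<and> (C2 \<longleftrightarrow> C3) \<and> (C3 \<longleftrightarrow> C4) \<and> (C4 \<longleftrightarrow> C5) \<and>
         (C5 \<longleftrightarrow> C6) \<and> (C6 \<longleftrightarrow> C7) \<and> (C7 \<longleftrightarrow> C8)"
proof -
  note R = assms(1) and lcoh = assms(2) and rcoh = assms(3)
  let ?T = "opp R"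
  note T = ring_opp[OF R]
  let ?FR = "free_fp_injective R" and ?FT = "free_fp_injective ?T"
  \<comment> \<open>Facts about right modules are instances at the opposite ring, whose own right
    coherence has this form.\<close>
  have lcoh': "left_coherent (opp ?T)" using lcoh by simp
  have tlR: "(\<forall>M :: 'a fg_module. fin_pres R M \<longrightarrow> torsionless R M) \<longleftrightarrow> ?FT"
    by (rule fin_pres_torsionless_iff[OF R])
  have tlT: "(\<forall>M :: 'a fg_module. fin_pres ?T M \<longrightarrow> torsionless ?T M) \<longleftrightarrow> ?FR"
    using fin_pres_torsionless_iff[OF T] by simp
  have reflR: "reflexive_module R M" if ?FT "fin_pres R M" for M :: "'a fg_module"
    using fin_pres_presentation[OF that(2)] presentation.reflexive[OF _ rcoh that(1)] by metis
  have reflT: "reflexive_module ?T M" if ?FR "fin_pres ?T M" for M :: "'a fg_module"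
    using fin_pres_presentation[OF that(2)] presentation.reflexive[OF _ lcoh'] that(1) by (metis opp_opp)
  have dualR: "fin_pres ?T (dual R M)" if "fin_pres R M" for M :: "'a fg_module"
    using fin_pres_presentation[OF that] presentation.fin_pres_dual[OF _ rcoh] by metis
  have dualT: "fin_pres R (dual ?T M)" if "fin_pres ?T M" for M :: "'a fg_module"
    using fin_pres_presentation[OF that] presentation.fin_pres_dual[OF _ lcoh'] by (metis opp_opp)
  have embR: "embeds_in_free R M" if "fin_pres R M" "torsionless R M" for M :: "'a fg_module"
    using fin_pres_presentation[OF that(1)] presentation.embeds_in_free[OF _ rcoh that(2)] by metis
  have embT: "embeds_in_free ?T M" if "fin_pres ?T M" "torsionless ?T M" for M :: "'a fg_module"
    using fin_pres_presentation[OF that(1)] presentation.embeds_in_free[OF _ lcoh' that(2)] by metis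
  have C2: "C2 \<longleftrightarrow> ?FR \<and> ?FT"
    unfolding C2_def fp_injective_reg_iff[OF R] fp_injective_reg_iff[OF T] ..
  have C3: "C3 \<longleftrightarrow> ?FR \<and> ?FT"
    unfolding C3_def fp_cogenerator_reg_iff[OF R] fp_cogenerator_reg_iff[OF T] tlR tlT by blast
  \<comment> \<open>By \<open>tlT\<close> the cogenerator property of the right module R amounts to
    \<open>?FR\<close>, while its FP-injectivity is \<open>?FT\<close>; so (4), though stated on one
    side, covers both.\<close>
  have C4: "C4 \<longleftrightarrow> ?FR \<and> ?FT"
    unfolding C4_def fp_injective_reg_iff[OF T] fp_cogenerator_reg_iff[OF T] tlT by blast
  have C5: "C5" if ?FR ?FT
    unfolding C5_def using reflR[OF that(2)] reflT[OF that(1)] by blast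
  have C1: "C1" if ?FR ?FT
    unfolding C1_def weakly_quasi_frobenius_def
    using R dualR dualT id_iso_bidual_if_reflexive[OF reflR[OF that(2)]]
      id_iso_bidual_if_reflexive[OF reflT[OF that(1)]] by blast
  have C1': "?FR \<and> ?FT" if C1
    using that torsionless_if_id_iso_bidual[OF R] torsionless_if_id_iso_bidual[OF T]
    unfolding C1_def weakly_quasi_frobenius_def tlR[symmetric] tlT[symmetric] by blast
  have C6: "C5 \<Longrightarrow> C6"
    unfolding C5_def C6_def by blast
  have C7: "C6 \<Longrightarrow> C7"
    unfolding C6_def C7_def using embR embT torsionless_if_reflexive[OF R] torsionless_if_reflexive[OF T]
    by blast
  have C8: "C8" if C7
    using that left_ideal_eq_if_embeds[OF R] left_ideal_eq_if_embeds[OF T]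
    unfolding C7_def C8_def by simp
  \<comment> \<open>The implications from (5) through (6) and (7) to (8) are closed to a cycle here;
    (1) to (4) are each equivalent to \<open>?FR\<close> and \<open>?FT\<close> together.
    \<open>?FT\<close> is the same fact with the sides exchanged.\<close>
  have "?FR" if C8
    using that free_fp_injective_if_double_ann[OF lcoh rcoh] unfolding C8_def by blast
  moreover have "?FT" if C8
    using that free_fp_injective_if_double_ann[OF rcoh lcoh'] unfolding C8_def by simp
  ultimately show ?thesis
    using C1 C1' C2 C3 C4 C5 C6 C7 C8 by blast
qed

end
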